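(* There is an absolute constant $c>0$ with the following property. Let $(A_r)_{1<r<2}$ be positive constants such that for every $1<r<2$, every weight $w$ on $\mathbb{R}$ and all $f\in L^1(M_rw)$, $$\|Hf\|_{L^{1,\infty}(w)}\le A_r\|f\|_{L^1(M_rw)}.$$ Let $\alpha_r=\frac{r}{2-r}$. Then for every $1<r<2$ and every weight $w$ supported in $[0,1]$, $$\int_0^1\left(\frac{|Hw|}{(M_{\alpha_r}w)^{\alpha_r/r}}\right)^2w^{\alpha_r}\,dx\le c\,A_r^2\int_0^1w\,dx.$$
   Context: A weight is a non-negative measurable function on $\mathbb{R}$. $H$ denotes the Hilbert transform on $\mathbb{R}$ (the principal value convolution with $1/x$, up to the usual normalizing constant). For $s>1$, $M_sf(x)=\sup_{I\ni x}\left(\frac{1}{|I|}\int_I|f(y)|^s\,dy\right)^{1/s}$, the supremum being over all bounded intervals $I\subset\mathbb{R}$ containing $x$. For a weight $v$, $\|f\|_{L^1(v)}=\int_{\mathbb{R}}|f|v\,dx$ and $\|g\|_{L^{1,\infty}(v)}=\sup_{\lambda>0}\lambda\, v\{x\in\mathbb{R}:|g(x)|>\lambda\}$, where $v(E)=\int_Ev\,dx$. *)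

theory Defs
  imports "HOL-Analysis.Analysis"
begin

definition weight :: "(real \<Rightarrow> real) \<Rightarrow> bool" where
  "weight w \<longleftrightarrow> w \<in> borel_measurable lebesgue \<and> (\<forall>x. 0 \<le> w x)"

(* Only used with exponents p > 0, where \<infinity>^p = \<infinity> and 0^p = 0. *)
definition ennpowr :: "ennreal \<Rightarrow> real \<Rightarrow> ennreal" where
  "ennpowr a p = (if a = \<infinity> then \<infinity> else ennreal (enn2real a powr p))"

(* One-point intervals, for which the average is meaningless, are excluded
   by the condition on the length. *)
definition maximal :: "real \<Rightarrow> (real \<Rightarrow> real) \<Rightarrow> real \<Rightarrow> ennreal" where
  "maximal s f x =
     (SUP I \<in> {I. is_interval I \<and> bounded I \<and> x \<in> I \<and> 0 < emeasure lebesgue I}.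
        ennpowr ((\<integral>\<^sup>+y\<in>I. ennreal (\<bar>f y\<bar> powr s) \<partial>lebesgue) / emeasure lebesgue I) (1 / s))"

(* The value is unspecified (by the convention of Lim) at points where the
   limit does not exist. If |f(y)|/(1+|y|) is integrable, the truncated integrals
   converge absolutely and these points form a null set. *)
definition hilbert :: "(real \<Rightarrow> real) \<Rightarrow> real \<Rightarrow> real" where
  "hilbert f x =
     Lim (at_right 0) (\<lambda>\<epsilon>. 1 / pi * (LINT y:{y. \<epsilon> < \<bar>x - y\<bar>}|lebesgue. f y / (x - y)))"

(* The weight takes values in [0,\<infinity>], since maximal functions may be infinite. *)
definition L1_norm :: "(real \<Rightarrow> ennreal) \<Rightarrow> (real \<Rightarrow> real) \<Rightarrow> ennreal" where
  "L1_norm v f = (\<integral>\<^sup>+x. ennreal \<bar>f x\<bar> * v x \<partial>lebesgue)"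

definition L1_space :: "(real \<Rightarrow> ennreal) \<Rightarrow> (real \<Rightarrow> real) set" where
  "L1_space v = {f \<in> borel_measurable lebesgue. L1_norm v f < \<infinity>}"

definition weak_L1_norm :: "(real \<Rightarrow> ennreal) \<Rightarrow> (real \<Rightarrow> real) \<Rightarrow> ennreal" where
  "weak_L1_norm v g =
     (SUP t\<in>{0<..}. ennreal t * (\<integral>\<^sup>+x\<in>{x. t < \<bar>g x\<bar>}. v x \<partial>lebesgue))"

end

theory Submission
  imports Defs
begin

text \<open>
  Let \<open>\<alpha> = r / (2 - r)\<close>, let \<open>S\<close> be the maximal function (supremum of averages over intervals) of
  \<open>w\<^sup>\<alpha>\<close>, and let \<open>\<sigma> = S powr (- 2 / r) * w\<^sup>\<alpha>\<close>. The maximal function of order \<open>\<alpha>\<close> of \<open>w\<close> is the power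
  \<open>1 / \<alpha>\<close> of \<open>S\<close>, so the left-hand side of the theorem is \<open>\<integral> |Hw|\<^sup>2 \<sigma>\<close>.

  \<^bold>\<open>Duality.\<close> For \<open>h = q \<sigma>\<close> the antisymmetry of \<open>H\<close> gives \<open>\<integral> h Hw = - \<integral> w Hh\<close>, and the weak type
  inequality can be applied to \<open>h\<close>. Take \<open>E = {|Hh| > t}\<close> and the weight \<open>w 1\<^sub>E\<close>. Then
  \<open>t w(E) \<le> A\<^sub>r \<integral> |h| M\<^sub>r(w 1\<^sub>E)\<close>. With \<open>d\<mu> = w\<^sup>\<alpha> dx\<close>, the average of \<open>(w 1\<^sub>E)\<^sup>r\<close> over an interval is the
  average of \<open>w\<^sup>\<alpha>\<close> times the \<open>\<mu>\<close>-average of \<open>g = w powr (r - \<alpha>) 1\<^sub>E\<close>. Hence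
  \<open>M\<^sub>r(w 1\<^sub>E) \<le> (S N) powr (1 / r)\<close>, where \<open>N\<close> is the maximal function of \<open>g\<close> with respect to \<open>\<mu>\<close>
  (lemma \<open>maximal_indicator_le\<close>). On the line \<open>N\<close> is bounded on \<open>L\<^sup>p(\<mu>)\<close> for every locally finite \<open>\<mu>\<close> and every \<open>p > 1\<close>,
  with a constant that depends on \<open>p\<close> only (lemma \<open>rational_maximal_strong_type\<close>). The exponent \<open>\<alpha>\<close> is
  the one for which \<open>\<integral> g powr (2 / r) d\<mu> = w(E)\<close>, so \<open>p = 2 / r\<close> and Cauchy-Schwarz yield
  \<open>w(E) \<le> 24 A\<^sub>r\<^sup>2 Q / t\<^sup>2\<close> with \<open>Q = \<integral> q\<^sup>2 \<sigma>\<close> (lemma \<open>hilbert_level_set_bound\<close>). Integrating over the levels,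
  \<open>\<integral> w |Hh| \<le> t \<integral> w + 24 A\<^sub>r\<^sup>2 Q / t\<close> for every \<open>t > 0\<close>. Letting \<open>q\<close> tend to \<open>Hw\<close> gives the estimate
  (lemma \<open>test_function_estimate_small_exponent\<close>).

  \<^bold>\<open>Exponents near 2.\<close> The constant for \<open>L\<^sup>p(\<mu>)\<close> blows up as \<open>p = 2 / r\<close> tends to 1, so the argument
  is used for \<open>r \<le> 4/3\<close> only. For \<open>r \<ge> 4/3\<close> the integrand is at most the one for \<open>r = 4/3\<close>
  (lemma \<open>hilbert_density_mono_exponent\<close>), which leads to the constant of the weak type inequality
  for \<open>4/3\<close> in place of \<open>A\<^sub>r\<close>. This exchange is harmless: any number \<open>a\<close> for which the weak type
  inequality with exponent \<open>4/3\<close> holds may be fixed once and for all, independently of the family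
  \<open>A\<close>, and \<open>A\<^sub>r \<ge> 1/12\<close> always (lemma \<open>weak_type_bound_ge\<close>), so \<open>a\<^sup>2 \<le> 144 a\<^sup>2 A\<^sub>r\<^sup>2\<close>.

  \<^bold>\<open>Rough weights.\<close> The above is carried out for Lipschitz weights, where all principal values exist.
  A general \<open>w\<close> is approximated by such weights \<open>v\<^sub>n\<close>. The weak type inequality for the weight 1 shows
  that \<open>H(w - v\<^sub>n)\<close> tends to 0 almost everywhere, the weak type of the maximal function controls \<open>S\<close>,
  and Fatou's lemma concludes (lemma \<open>hilbert_density_estimate\<close>). The same inequality settles the
  points without a principal value. There the transforms of \<open>f\<close> and of all its multiples \<open>c f\<close> take
  one and the same default value. Letting \<open>c\<close> tend to 0 shows that this value is 0 or that almost
  every point has a principal value (lemma \<open>has_pv_AE_or_no_pv_value_eq_0\<close>).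
\<close>

section \<open>Maximal functions with respect to a measure on the line\<close>

text \<open>
  Take a subfamily with the same union and the least possible number of members. If three of its
  intervals met in a point, the one reaching furthest to the left and the one reaching furthest to
  the right would cover the third, which could be dropped.
\<close>
lemma interval_subfamily_overlap_le_2:
  fixes F :: "(real \<times> real) set"
  assumes "finite F"
  obtains G where "G \<subseteq> F" "(\<Union>p\<in>G. {fst p<..<snd p}) = (\<Union>p\<in>F. {fst p<..<snd p})"
    "\<And>x. card {p \<in> G. x \<in> {fst p<..<snd p}} \<le> 2"
proof -
  define U where "U = (\<lambda>G::(real \<times> real) set. \<Union>p\<in>G. {fst p<..<snd p})"
  define Q where "Q = (\<lambda>n. \<exists>G\<subseteq>F. U G = U F \<and> card G = n)"
  have "\<exists>n. Q n" unfolding Q_def by blast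
  then have "Q (LEAST n. Q n)" by (rule LeastI_ex)
  then obtain G where G: "G \<subseteq> F" "U G = U F" "card G = (LEAST n. Q n)"
    unfolding Q_def by blast
  have finG: "finite G" using G(1) assms by (rule finite_subset)
  have "card {p \<in> G. x \<in> {fst p<..<snd p}} \<le> 2" for x
  proof (rule ccontr)
    let ?T = "{p \<in> G. x \<in> {fst p<..<snd p}}"
    assume "\<not> card ?T \<le> 2"
    then have c3: "card ?T \<ge> 3" by simp
    have finT: "finite ?T" using finG by simp
    have neT: "?T \<noteq> {}" using c3 by (metis card.empty not_numeral_le_zero)
    obtain i where i: "i \<in> ?T" "\<And>p. p \<in> ?T \<Longrightarrow> fst i \<le> fst p"
      using arg_min_if_finite(1)[OF finT neT, of fst] arg_min_least[OF finT neT, of _ fst] by blast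
    obtain j where j: "j \<in> ?T" "\<And>p. p \<in> ?T \<Longrightarrow> snd p \<le> snd j"
      using arg_min_if_finite(1)[OF finT neT, of "\<lambda>p. - snd p"]
        arg_min_least[OF finT neT, of _ "\<lambda>p. - snd p"] by (meson neg_le_iff_le)
    have "card {i, j} < card ?T" using c3 by (cases "i = j") auto
    then obtain k where k: "k \<in> ?T" "k \<notin> {i, j}"
      using card_mono[of "{i, j}" ?T] by (meson finite.emptyI finite.insertI not_le subsetI)
    have "{fst k<..<snd k} \<subseteq> {fst i<..<snd i} \<union> {fst j<..<snd j}"
      using i(1) j(1) k(1) i(2)[OF k(1)] j(2)[OF k(1)] by auto
    moreover have "i \<in> G - {k}" "j \<in> G - {k}" using i(1) j(1) k(2) by auto
    ultimately have "{fst k<..<snd k} \<subseteq> U (G - {k})" unfolding U_def by blast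
    moreover have "U G = U (G - {k}) \<union> {fst k<..<snd k}" using k(1) unfolding U_def by auto
    ultimately have "U (G - {k}) = U F" using G(2) by auto
    then have "Q (card (G - {k}))" unfolding Q_def using G(1) by blast
    then have "card G \<le> card (G - {k})" using G(3) by (simp add: Least_le)
    moreover have "card (G - {k}) < card G" using k(1) finG by (intro psubset_card_mono) auto
    ultimately show False by simp
  qed
  then show ?thesis using that G(1,2) unfolding U_def by blast
qed

text \<open>
  Rational endpoints make this a countable supremum, hence measurable. For measures without atoms
  that are finite on bounded intervals it dominates the averages over all non-degenerate intervals through \<open>x\<close>
  (lemma \<open>interval_integral_le_rational_maximal\<close>).
\<close>
definition rational_maximal :: "real measure \<Rightarrow> (real \<Rightarrow> ennreal) \<Rightarrow> real \<Rightarrow> ennreal" where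
  "rational_maximal \<mu> g x =
     (SUP p\<in>\<rat> \<times> \<rat>. (\<integral>\<^sup>+y\<in>{fst p<..<snd p}. g y \<partial>\<mu>) / emeasure \<mu> {fst p<..<snd p}
        * indicator {fst p<..<snd p} x)"

lemma borel_measurable_rational_maximal [measurable]:
  "rational_maximal \<mu> g \<in> borel_measurable borel"
  unfolding rational_maximal_def
  by (intro borel_measurable_SUP borel_measurable_times) (auto intro!: countable_SIGMA simp: countable_rat)

lemma ennreal_less_divide_imp:
  fixes a b t :: ennreal
  assumes "t < a / b" "b < \<infinity>" "b = 0 \<Longrightarrow> a = 0"
  shows "t * b \<le> a"
proof (cases "b = 0")
  case False
  have "t * b \<le> (a / b) * b" using assms(1) by (intro mult_right_mono) auto
  also have "\<dots> = a" using False assms(2)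
    by (simp add: ennreal_divide_times ennreal_divide_self)
  finally show ?thesis .
qed simp

text \<open>
  Bounded overlap does the work of a Vitali covering without enlarging intervals, so the constant
  is 2 for every measure that is finite on bounded intervals, doubling or not. This matters for the
  measures \<open>v\<^sup>\<alpha> dx\<close>, about which nothing quantitative is known.
\<close>
lemma rational_maximal_weak_type:
  fixes t :: ennreal
  assumes [measurable_cong]: "sets \<mu> = sets borel" and [measurable]: "g \<in> borel_measurable borel"
    and fin: "\<And>a b. emeasure \<mu> {a<..<b} < \<infinity>"
  shows "t * emeasure \<mu> {x. t < rational_maximal \<mu> g x} \<le> 2 * (\<integral>\<^sup>+x. g x \<partial>\<mu>)"
proof -
  have sets: "{a<..<b} \<in> sets \<mu>" for a b :: real using assms(1) by simp
  define I where "I = (\<lambda>p::real \<times> real. {fst p<..<snd p})"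
  define P where "P = {p \<in> \<rat> \<times> \<rat>. t < (\<integral>\<^sup>+y\<in>I p. g y \<partial>\<mu>) / emeasure \<mu> (I p)}"
  have P: "t * emeasure \<mu> (I p) \<le> (\<integral>\<^sup>+y\<in>I p. g y \<partial>\<mu>)" if "p \<in> P" for p
  proof (rule ennreal_less_divide_imp)
    show "t < (\<integral>\<^sup>+y\<in>I p. g y \<partial>\<mu>) / emeasure \<mu> (I p)" using that by (simp add: P_def)
    show "emeasure \<mu> (I p) < \<infinity>" using fin by (simp add: I_def)
    assume "emeasure \<mu> (I p) = 0"
    then have "I p \<in> null_sets \<mu>" using sets by (auto simp: I_def)
    then show "(\<integral>\<^sup>+y\<in>I p. g y \<partial>\<mu>) = 0" by (rule nn_integral_null_set)
  qed
  have finite_case: "t * emeasure \<mu> (\<Union>p\<in>F. I p) \<le> 2 * (\<integral>\<^sup>+x. g x \<partial>\<mu>)"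
    if F: "finite F" "F \<subseteq> P" for F
  proof -
    obtain G where G: "G \<subseteq> F" "(\<Union>p\<in>G. I p) = (\<Union>p\<in>F. I p)" "\<And>x. card {p \<in> G. x \<in> I p} \<le> 2"
      using interval_subfamily_overlap_le_2[OF F(1)] unfolding I_def by blast
    have finG: "finite G" using G(1) F(1) finite_subset by blast
    have "t * emeasure \<mu> (\<Union>p\<in>F. I p) \<le> t * (\<Sum>p\<in>G. emeasure \<mu> (I p))"
      unfolding G(2)[symmetric] using finG sets
      by (intro mult_left_mono emeasure_subadditive_finite) (auto simp: I_def)
    also have "\<dots> \<le> (\<Sum>p\<in>G. \<integral>\<^sup>+y\<in>I p. g y \<partial>\<mu>)"
      unfolding sum_distrib_left using P G(1) F(2) by (intro sum_mono) auto
    also have "\<dots> = (\<integral>\<^sup>+y. (\<Sum>p\<in>G. g y * indicator (I p) y) \<partial>\<mu>)"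
      by (subst nn_integral_sum) (auto simp: I_def)
    also have "\<dots> \<le> (\<integral>\<^sup>+y. 2 * g y \<partial>\<mu>)"
    proof (rule nn_integral_mono)
      fix y
      have "(\<Sum>p\<in>G. g y * indicator (I p) y) = g y * of_nat (card {p \<in> G. y \<in> I p})"
        using finG by (simp add: sum_distrib_left[symmetric] indicator_def sum.If_cases Int_def)
      also have "\<dots> \<le> g y * 2"
        using of_nat_mono[OF G(3)[of y], where 'a = ennreal] by (intro mult_left_mono) simp_all
      finally show "(\<Sum>p\<in>G. g y * indicator (I p) y) \<le> 2 * g y" by (simp add: mult.commute)
    qed
    also have "\<dots> = 2 * (\<integral>\<^sup>+y. g y \<partial>\<mu>)" by (rule nn_integral_cmult) simp
    finally show ?thesis .
  qed
  have set_eq: "{x. t < rational_maximal \<mu> g x} = (\<Union>p\<in>P. I p)"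
  proof -
    have "t < c * indicator A x \<longleftrightarrow> x \<in> A \<and> t < c" for c and A :: "real set" and x
      by (cases "x \<in> A") simp_all
    then show ?thesis unfolding rational_maximal_def less_SUP_iff P_def I_def by auto blast
  qed
  show ?thesis
  proof (cases "P = {}")
    case True then show ?thesis by (simp add: set_eq)
  next
    case False
    have cP: "countable P" unfolding P_def
      by (rule countable_subset[of _ "\<rat> \<times> \<rat>"]) (auto intro!: countable_SIGMA simp: countable_rat)
    define e where "e = from_nat_into P"
    have re: "range e = P" unfolding e_def by (rule range_from_nat_into[OF False cP])
    define V where "V = (\<lambda>n. \<Union>p\<in>e ` {..n}. I p)"
    have UV: "(\<Union>p\<in>P. I p) = (\<Union>n. V n)" unfolding V_def re[symmetric] by auto
    have "emeasure \<mu> (\<Union>n. V n) = (SUP n. emeasure \<mu> (V n))"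
    proof (rule SUP_emeasure_incseq[symmetric])
      show "incseq V" unfolding V_def incseq_def by (intro allI impI UN_mono image_mono) auto
      show "range V \<subseteq> sets \<mu>" using sets by (auto simp: V_def I_def)
    qed
    then have "t * emeasure \<mu> (\<Union>n. V n) = (SUP n. t * emeasure \<mu> (V n))"
      by (simp add: SUP_mult_left_ennreal)
    also have "\<dots> \<le> 2 * (\<integral>\<^sup>+x. g x \<partial>\<mu>)"
    proof (rule SUP_least)
      fix n show "t * emeasure \<mu> (V n) \<le> 2 * (\<integral>\<^sup>+x. g x \<partial>\<mu>)"
        unfolding V_def using re by (intro finite_case) auto
    qed
    finally show ?thesis unfolding set_eq UV .
  qed
qed

section \<open>Powers of extended non-negative numbers\<close>

lemma ennpowr_ennreal: "0 \<le> x \<Longrightarrow> ennpowr (ennreal x) p = ennreal (x powr p)"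
  by (simp add: ennpowr_def)

lemma ennpowr_top [simp]: "ennpowr top p = top"
  by (simp add: ennpowr_def)

lemma ennpowr_zero [simp]: "ennpowr 0 p = 0"
  by (simp add: ennpowr_def)

lemma ennpowr_mono: "a \<le> b \<Longrightarrow> 0 \<le> p \<Longrightarrow> ennpowr a p \<le> ennpowr b p"
  by (cases a; cases b) (auto simp: ennpowr_ennreal ennreal_leI powr_mono2 top_unique)

lemma ennpowr_powr: "ennpowr (ennpowr a p) q = ennpowr a (p * q)"
  by (cases a) (auto simp: ennpowr_ennreal powr_powr)

lemma ennpowr_one [simp]: "ennpowr a 1 = a"
  by (cases a) (auto simp: ennpowr_ennreal)

lemma ennpowr_le_iff:
  assumes "0 < p" shows "ennpowr a p \<le> b \<longleftrightarrow> a \<le> ennpowr b (1 / p)"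
proof
  assume "ennpowr a p \<le> b"
  then have "ennpowr (ennpowr a p) (1 / p) \<le> ennpowr b (1 / p)" using assms by (intro ennpowr_mono) auto
  then show "a \<le> ennpowr b (1 / p)" using assms by (simp add: ennpowr_powr)
next
  assume "a \<le> ennpowr b (1 / p)"
  then have "ennpowr a p \<le> ennpowr (ennpowr b (1 / p)) p" using assms by (intro ennpowr_mono) auto
  then show "ennpowr a p \<le> b" using assms by (simp add: ennpowr_powr)
qed

lemma ennpowr_SUP:
  assumes "0 < p" shows "(SUP i\<in>I. ennpowr (f i) p) = ennpowr (SUP i\<in>I. f i) p"
proof (rule antisym)
  show "(SUP i\<in>I. ennpowr (f i) p) \<le> ennpowr (SUP i\<in>I. f i) p"
    using assms by (intro SUP_least ennpowr_mono SUP_upper) auto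
  show "ennpowr (SUP i\<in>I. f i) p \<le> (SUP i\<in>I. ennpowr (f i) p)"
    unfolding ennpowr_le_iff[OF assms]
    by (intro SUP_least) (auto simp: ennpowr_le_iff[OF assms, symmetric] intro: SUP_upper)
qed

lemma ennpowr_mult: "0 < p \<Longrightarrow> ennpowr (a * b) p = ennpowr a p * ennpowr b p"
proof (cases a; cases b)
  assume p: "0 < p"
  fix x y :: real assume "0 \<le> x" "a = ennreal x" "0 \<le> y" "b = ennreal y"
  then show ?thesis by (simp add: ennpowr_ennreal powr_mult flip: ennreal_mult)
next
  assume p: "0 < p"
  fix x :: real assume "0 \<le> x" "a = ennreal x" "b = top"
  then show ?thesis using p by (cases "x = 0") (auto simp: ennpowr_ennreal ennreal_mult_top)
next
  assume p: "0 < p"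
  fix x :: real assume "a = top" "0 \<le> x" "b = ennreal x"
  then show ?thesis using p by (cases "x = 0") (auto simp: ennpowr_ennreal ennreal_top_mult)
qed auto

lemma measurable_ennpowr [measurable]: "(\<lambda>x. ennpowr x p) \<in> borel_measurable borel"
  unfolding ennpowr_def by measurable

lemma less_ennpowr_iff:
  "0 < p \<Longrightarrow> 0 \<le> s \<Longrightarrow> ennreal s < ennpowr a p \<longleftrightarrow> ennreal (s powr (1 / p)) < a"
  using ennpowr_le_iff[of "1 / p" "ennreal s" a] ennpowr_le_iff[of p a "ennreal s"]
  by (auto simp: not_le[symmetric] ennpowr_ennreal)

section \<open>Marcinkiewicz interpolation for the maximal function\<close>

lemma nn_integral_layer_cake:
  assumes "sigma_finite_measure \<mu>" and [measurable]: "\<phi> \<in> borel_measurable \<mu>"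
  shows "(\<integral>\<^sup>+x. \<phi> x \<partial>\<mu>) = (\<integral>\<^sup>+s\<in>{0<..}. emeasure \<mu> {x \<in> space \<mu>. ennreal s < \<phi> x} \<partial>lborel)"
proof -
  interpret sigma_finite_measure \<mu> by fact
  interpret pair_sigma_finite lborel \<mu> by unfold_locales
  have inner: "(\<integral>\<^sup>+s. indicator {s. 0 < s \<and> ennreal s < a} s \<partial>lborel) = a" for a :: ennreal
  proof (cases a)
    case (real b)
    then have "{s. 0 < s \<and> ennreal s < a} = {0<..<b}" by (auto simp: ennreal_less_iff)
    then show ?thesis using real by simp
  next
    case top
    then have "{s. 0 < s \<and> ennreal s < a} = {0<..}" by auto
    moreover have "emeasure lborel {0::real<..} = \<infinity>"
    proof (rule ennreal_le_epsilon[THEN antisym[OF top_greatest], unfolded infinity_ennreal_def[symmetric]])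
      show "\<infinity> \<le> emeasure lborel {0::real<..} + ennreal e" for e
      proof -
        have "of_nat n \<le> emeasure lborel {0::real<..}" for n
          using emeasure_mono[of "{0<..<real n}" "{0<..}" lborel]
            by (simp add: ennreal_of_nat_eq_real_of_nat subset_iff)
        then have "emeasure lborel {0::real<..} = \<infinity>"
          by (metis ennreal_Ex_less_of_nat infinity_ennreal_def leD top.not_eq_extremum)
        then show ?thesis by simp
      qed
    qed
    ultimately show ?thesis using top by simp
  qed
  have "(\<integral>\<^sup>+x. \<phi> x \<partial>\<mu>) = (\<integral>\<^sup>+x. (\<integral>\<^sup>+s. indicator {s. 0 < s \<and> ennreal s < \<phi> x} s \<partial>lborel) \<partial>\<mu>)"
    by (simp only: inner)
  also have "\<dots> = (\<integral>\<^sup>+s. (\<integral>\<^sup>+x. indicator {s. 0 < s \<and> ennreal s < \<phi> x} s \<partial>\<mu>) \<partial>lborel)"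
    by (rule Fubini'[of "\<lambda>s x. indicator {s. 0 < s \<and> ennreal s < \<phi> x} s"]) measurable
  also have "\<dots> = (\<integral>\<^sup>+s\<in>{0<..}. emeasure \<mu> {x \<in> space \<mu>. ennreal s < \<phi> x} \<partial>lborel)"
  proof (rule nn_integral_cong)
    fix s :: real
    have "(\<integral>\<^sup>+x. indicator {s. 0 < s \<and> ennreal s < \<phi> x} s \<partial>\<mu>)
        = (\<integral>\<^sup>+x. indicator {x \<in> space \<mu>. ennreal s < \<phi> x} x * indicator {0<..} s \<partial>\<mu>)"
      by (intro nn_integral_cong) (auto simp: indicator_def)
    also have "\<dots> = emeasure \<mu> {x \<in> space \<mu>. ennreal s < \<phi> x} * indicator {0<..} s"
      by (subst nn_integral_multc) auto
    finally show "(\<integral>\<^sup>+x. indicator {s. 0 < s \<and> ennreal s < \<phi> x} s \<partial>\<mu>)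
        = emeasure \<mu> {x \<in> space \<mu>. ennreal s < \<phi> x} * indicator {0<..} s" .
  qed
  finally show ?thesis .
qed

lemma nn_integral_powr_from_0:
  assumes "-1 < a" "0 \<le> c"
  shows "(\<integral>\<^sup>+s\<in>{0..c}. ennreal (s powr a) \<partial>lborel) = ennreal (c powr (a + 1) / (a + 1))"
proof -
  have "(\<integral>\<^sup>+s\<in>{0..c}. ennreal (s powr a) \<partial>lborel) = (\<integral>\<^sup>+s. indicator {0..c} s * ennreal (s powr a) \<partial>lborel)"
    by (simp add: mult.commute)
  also have "\<dots> = (\<integral>\<^sup>+s. ennreal (indicator {0..c} s * s powr a) \<partial>lborel)"
    by (intro nn_integral_cong) (auto simp: indicator_def)
  also have "\<dots> = ennreal (c powr (a + 1) / (a + 1))"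
    by (rule nn_integral_has_integral_lebesgue[OF _ has_integral_powr_from_0[OF assms]]) auto
  finally show ?thesis .
qed

text \<open>
  The truncation behind Marcinkiewicz interpolation: the part of \<open>g\<close> below the level \<open>s\<close> adds at most \<open>s\<close> to
  every average.
\<close>
lemma rational_maximal_le_tail:
  fixes s :: real
  assumes [measurable_cong]: "sets \<mu> = sets borel" and [measurable]: "g \<in> borel_measurable borel"
    and fin: "\<And>a b. emeasure \<mu> {a<..<b} < \<infinity>" and s: "0 \<le> s"
  shows "rational_maximal \<mu> (\<lambda>y. ennreal (g y)) x
     \<le> rational_maximal \<mu> (\<lambda>y. ennreal (g y) * indicator {y. s < g y} y) x + ennreal s"
  unfolding rational_maximal_def
proof (rule SUP_least)
  fix p :: "real \<times> real" assume p: "p \<in> \<rat> \<times> \<rat>"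
  let ?I = "{fst p<..<snd p}" and ?m = "emeasure \<mu> {fst p<..<snd p}"
  let ?h = "\<lambda>y. ennreal (g y) * indicator {y. s < g y} y"
  have "(\<integral>\<^sup>+y\<in>?I. ennreal (g y) \<partial>\<mu>) \<le> (\<integral>\<^sup>+y. ?h y * indicator ?I y + ennreal s * indicator ?I y \<partial>\<mu>)"
    using s by (intro nn_integral_mono) (auto simp: indicator_def intro: ennreal_leI)
  also have "\<dots> = (\<integral>\<^sup>+y\<in>?I. ?h y \<partial>\<mu>) + ennreal s * ?m"
    using assms(1) by (subst nn_integral_add) (auto simp: nn_integral_cmult_indicator)
  finally have "(\<integral>\<^sup>+y\<in>?I. ennreal (g y) \<partial>\<mu>) / ?m \<le> ((\<integral>\<^sup>+y\<in>?I. ?h y \<partial>\<mu>) + ennreal s * ?m) / ?m"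
    by (rule divide_right_mono_ennreal)
  also have "\<dots> \<le> (\<integral>\<^sup>+y\<in>?I. ?h y \<partial>\<mu>) / ?m + ennreal s"
  proof (cases "?m = 0")
    case False
    have "ennreal s * ?m / ?m = ennreal s"
      using False fin[of "fst p" "snd p"] by (intro ennreal_mult_divide_eq) auto
    then show ?thesis by (simp add: add_divide_distrib_ennreal)
  next
    case True
    then have "?I \<in> null_sets \<mu>" using assms(1) by auto
    then have "(\<integral>\<^sup>+y\<in>?I. ?h y \<partial>\<mu>) = 0" by (rule nn_integral_null_set)
    then show ?thesis using True by simp
  qed
  finally have *: "(\<integral>\<^sup>+y\<in>?I. ennreal (g y) \<partial>\<mu>) / ?m \<le> (\<integral>\<^sup>+y\<in>?I. ?h y \<partial>\<mu>) / ?m + ennreal s" .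
  have "(\<integral>\<^sup>+y\<in>?I. ennreal (g y) \<partial>\<mu>) / ?m * indicator ?I x
      \<le> (\<integral>\<^sup>+y\<in>?I. ?h y \<partial>\<mu>) / ?m * indicator ?I x + ennreal s"
    using * by (cases "x \<in> ?I") auto
  also have "\<dots> \<le> (SUP p\<in>\<rat> \<times> \<rat>. (\<integral>\<^sup>+y\<in>{fst p<..<snd p}. ?h y \<partial>\<mu>) / emeasure \<mu> {fst p<..<snd p}
        * indicator {fst p<..<snd p} x) + ennreal s"
    using p by (intro add_right_mono SUP_upper2[of p]) auto
  finally show "(\<integral>\<^sup>+y\<in>?I. ennreal (g y) \<partial>\<mu>) / ?m * indicator ?I x \<le> \<dots>" .
qed

text \<open>
  Marcinkiewicz interpolation between the weak type bound and the trivial bound for bounded functions: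
  \<open>{N > 2 t}\<close> has measure at most \<open>2 / t\<close> times the integral of \<open>g\<close> over \<open>{g > t}\<close>, and this is integrated
  over the levels.
\<close>
lemma rational_maximal_strong_type:
  assumes "sigma_finite_measure \<mu>" and [measurable_cong]: "sets \<mu> = sets borel"
    and [measurable]: "g \<in> borel_measurable borel"
    and fin: "\<And>a b. emeasure \<mu> {a<..<b} < \<infinity>" and g: "\<And>x. 0 \<le> g x" and p: "1 < p"
  shows "(\<integral>\<^sup>+x. ennpowr (rational_maximal \<mu> (\<lambda>y. ennreal (g y)) x) p \<partial>\<mu>)
     \<le> ennreal (2 powr (p + 1) * p / (p - 1)) * (\<integral>\<^sup>+x. ennreal (g x powr p) \<partial>\<mu>)"
proof -
  interpret sigma_finite_measure \<mu> by fact
  interpret pair_sigma_finite lborel \<mu> by unfold_locales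
  let ?M = "rational_maximal \<mu> (\<lambda>y. ennreal (g y))"
  have space: "space \<mu> = UNIV" using sets_eq_imp_space_eq[OF assms(2)] by simp
  have level: "emeasure \<mu> {x. ennreal (2 * t) < ?M x} \<le> ennreal (2 / t) * (\<integral>\<^sup>+x\<in>{x. t < g x}. ennreal (g x) \<partial>\<mu>)"
    if t: "0 < t" for t :: real
  proof -
    let ?h = "\<lambda>y. ennreal (g y) * indicator {y. t < g y} y"
    have tt: "ennreal (2 * t) = ennreal t + ennreal t" using t by (simp flip: ennreal_plus)
    have sub: "{x. ennreal (2 * t) < ?M x} \<subseteq> {x. ennreal t < rational_maximal \<mu> ?h x}"
    proof (intro subsetI CollectI, rule ccontr)
      fix x assume x: "x \<in> {x. ennreal (2 * t) < ?M x}" "\<not> ennreal t < rational_maximal \<mu> ?h x"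
      have "?M x \<le> rational_maximal \<mu> ?h x + ennreal t"
        using t by (intro rational_maximal_le_tail assms(2,3) fin) simp
      also have "\<dots> \<le> ennreal t + ennreal t" using x(2) by (intro add_right_mono) simp
      finally show False using x(1) tt by simp
    qed
    have "ennreal t * emeasure \<mu> {x. ennreal (2 * t) < ?M x}
        \<le> ennreal t * emeasure \<mu> {x. ennreal t < rational_maximal \<mu> ?h x}"
      by (intro mult_left_mono emeasure_mono sub) auto
    also have "\<dots> \<le> 2 * (\<integral>\<^sup>+x. ?h x \<partial>\<mu>)"
      by (intro rational_maximal_weak_type assms(2) fin) measurable
    finally have "ennreal (1 / t) * (ennreal t * emeasure \<mu> {x. ennreal (2 * t) < ?M x})
        \<le> ennreal (1 / t) * (2 * (\<integral>\<^sup>+x. ?h x \<partial>\<mu>))" by (rule mult_left_mono) simp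
    moreover have "ennreal (1 / t) * ennreal t = 1" using t by (simp flip: ennreal_mult)
    moreover have "ennreal (1 / t) * 2 = ennreal (2 / t)"
      using t by (simp flip: ennreal_mult ennreal_numeral)
    ultimately show ?thesis by (simp add: mult.assoc[symmetric])
  qed
  have "(\<integral>\<^sup>+x. ennpowr (?M x) p \<partial>\<mu>)
      = (\<integral>\<^sup>+s\<in>{0<..}. emeasure \<mu> {x \<in> space \<mu>. ennreal s < ennpowr (?M x) p} \<partial>lborel)"
    by (rule nn_integral_layer_cake[OF assms(1)]) measurable
  also have "\<dots> \<le> (\<integral>\<^sup>+s. (\<integral>\<^sup>+x. ennreal (4 * g x) * (ennreal (s powr (- 1 / p)) * indicator {0..(2 * g x) powr p} s) \<partial>\<mu>) \<partial>lborel)"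
  proof (rule nn_integral_mono)
    fix s :: real
    show "emeasure \<mu> {x \<in> space \<mu>. ennreal s < ennpowr (?M x) p} * indicator {0<..} s
      \<le> (\<integral>\<^sup>+x. ennreal (4 * g x) * (ennreal (s powr (- 1 / p)) * indicator {0..(2 * g x) powr p} s) \<partial>\<mu>)"
    proof (cases "0 < s")
      case s: True
      define t where "t = s powr (1 / p) / 2"
      have t: "0 < t" using s by (simp add: t_def)
      have "{x \<in> space \<mu>. ennreal s < ennpowr (?M x) p} = {x. ennreal (2 * t) < ?M x}"
        using s p by (auto simp: t_def less_ennpowr_iff space)
      then have "emeasure \<mu> {x \<in> space \<mu>. ennreal s < ennpowr (?M x) p} * indicator {0<..} s
          \<le> ennreal (2 / t) * (\<integral>\<^sup>+x\<in>{x. t < g x}. ennreal (g x) \<partial>\<mu>)"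
        using level[OF t] s by simp
      also have "\<dots> = (\<integral>\<^sup>+x. ennreal (2 / t) * (ennreal (g x) * indicator {x. t < g x} x) \<partial>\<mu>)"
        by (subst nn_integral_cmult) auto
      also have "\<dots> \<le> (\<integral>\<^sup>+x. ennreal (4 * g x) * (ennreal (s powr (- 1 / p)) * indicator {0..(2 * g x) powr p} s) \<partial>\<mu>)"
      proof (rule nn_integral_mono)
        fix x
        have t2: "2 / t = 4 * s powr (- 1 / p)" by (simp add: t_def powr_minus_divide)
        have "s \<le> (2 * g x) powr p" if "t < g x"
        proof -
          have "s = (2 * t) powr p" using s p by (simp add: t_def powr_powr)
          also have "\<dots> \<le> (2 * g x) powr p" using that t p by (intro powr_mono2) auto
          finally show ?thesis .
        qed
        then show "ennreal (2 / t) * (ennreal (g x) * indicator {x. t < g x} x)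
          \<le> ennreal (4 * g x) * (ennreal (s powr (- 1 / p)) * indicator {0..(2 * g x) powr p} s)"
          using s g[of x] by (auto simp: indicator_def t2 mult_ac simp flip: ennreal_mult)
      qed
      finally show ?thesis .
    qed simp
  qed
  also have "\<dots> = (\<integral>\<^sup>+x. (\<integral>\<^sup>+s. ennreal (4 * g x) * (ennreal (s powr (- 1 / p)) * indicator {0..(2 * g x) powr p} s) \<partial>lborel) \<partial>\<mu>)"
    by (rule Fubini'[of "\<lambda>s x. ennreal (4 * g x) * (ennreal (s powr (- 1 / p)) * indicator {0..(2 * g x) powr p} s)", symmetric])
      (measurable, unfold atLeastAtMost_iff, measurable)
  also have "\<dots> = (\<integral>\<^sup>+x. ennreal (2 powr (p + 1) * p / (p - 1)) * ennreal (g x powr p) \<partial>\<mu>)"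
  proof (rule nn_integral_cong)
    fix x
    have "(\<integral>\<^sup>+s. ennreal (4 * g x) * (ennreal (s powr (- 1 / p)) * indicator {0..(2 * g x) powr p} s) \<partial>lborel)
        = ennreal (4 * g x) * (\<integral>\<^sup>+s\<in>{0..(2 * g x) powr p}. ennreal (s powr (- 1 / p)) \<partial>lborel)"
      by (rule nn_integral_cmult) measurable
    also have "\<dots> = ennreal (4 * g x) * ennreal (((2 * g x) powr p) powr (- 1 / p + 1) / (- 1 / p + 1))"
      using p by (subst nn_integral_powr_from_0) auto
    also have "\<dots> = ennreal (4 * g x * (((2 * g x) powr p) powr (- 1 / p + 1) / (- 1 / p + 1)))"
      using g[of x] by (subst ennreal_mult') auto
    also have "4 * g x * (((2 * g x) powr p) powr (- 1 / p + 1) / (- 1 / p + 1))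
        = 2 powr (p + 1) * p / (p - 1) * g x powr p"
    proof (cases "g x = 0")
      case False
      then have gx: "0 < g x" using g[of x] by simp
      have "((2 * g x) powr p) powr (- 1 / p + 1) = (2 * g x) powr (p - 1)"
        using p by (simp add: powr_powr algebra_simps)
      also have "\<dots> = 2 powr (p - 1) * g x powr (p - 1)" using gx by (simp add: powr_mult)
      finally have 1: "((2 * g x) powr p) powr (- 1 / p + 1) = 2 powr (p - 1) * g x powr (p - 1)" .
      have 2: "(2::real) powr (p + 1) = 4 * 2 powr (p - 1)" by (simp add: powr_add powr_diff)
      have 3: "g x powr p = g x * g x powr (p - 1)" using gx by (simp add: powr_diff)
      have 4: "- 1 / p + 1 = (p - 1) / p" using p by (simp add: field_simps)
      show ?thesis unfolding 1 2 3 unfolding 4 using p by simp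
    qed simp
    also have "ennreal (2 powr (p + 1) * p / (p - 1) * g x powr p)
        = ennreal (2 powr (p + 1) * p / (p - 1)) * ennreal (g x powr p)"
      using p by (intro ennreal_mult) auto
    finally show "(\<integral>\<^sup>+s. ennreal (4 * g x) * (ennreal (s powr (- 1 / p)) * indicator {0..(2 * g x) powr p} s) \<partial>lborel)
      = ennreal (2 powr (p + 1) * p / (p - 1)) * ennreal (g x powr p)" .
  qed
  also have "\<dots> = ennreal (2 powr (p + 1) * p / (p - 1)) * (\<integral>\<^sup>+x. ennreal (g x powr p) \<partial>\<mu>)"
    by (rule nn_integral_cmult) measurable
  finally show ?thesis .
qed

section \<open>The maximal function for Lebesgue measure\<close>

abbreviation intervals_at :: "real \<Rightarrow> real set set" where
  "intervals_at x \<equiv> {I. is_interval I \<and> bounded I \<and> x \<in> I \<and> 0 < emeasure lebesgue I}"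

text \<open>
  The maximal function without exponents: \<open>maximal s f\<close> is the power \<open>1 / s\<close> of this one at \<open>|f|\<^sup>s\<close>
  (lemma \<open>maximal_eq\<close>). Being subadditive, it is easier to follow along an approximating sequence.
\<close>
definition interval_maximal :: "(real \<Rightarrow> ennreal) \<Rightarrow> real \<Rightarrow> ennreal" where
  "interval_maximal F x = (SUP I \<in> intervals_at x. (\<integral>\<^sup>+y\<in>I. F y \<partial>lebesgue) / emeasure lebesgue I)"

lemma maximal_eq:
  "0 < s \<Longrightarrow> maximal s f x = ennpowr (interval_maximal (\<lambda>y. ennreal (\<bar>f y\<bar> powr s)) x) (1 / s)"
  unfolding maximal_def interval_maximal_def by (subst ennpowr_SUP) auto

lemma intervals_atE:
  assumes "I \<in> intervals_at x"
  obtains a b where "a < b" "x \<in> {a..b}" "{a<..<b} \<subseteq> I" "I \<subseteq> {a..b}" "I \<in> sets borel"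
    "emeasure lborel I = ennreal (b - a)" "emeasure lebesgue I = ennreal (b - a)"
proof -
  have I: "is_interval I" "bounded I" "x \<in> I" "0 < emeasure lebesgue I" using assms by auto
  define a b where "a = Inf I" and "b = Sup I"
  have bdd: "bdd_below I" "bdd_above I" using I(2) by (auto simp: bounded_imp_bdd_below bounded_imp_bdd_above)
  have sub: "I \<subseteq> {a..b}" using bdd by (auto simp: a_def b_def intro: cInf_lower cSup_upper)
  have sup: "{a<..<b} \<subseteq> I"
  proof
    fix y assume y: "y \<in> {a<..<b}"
    obtain u where u: "u \<in> I" "u < y" using y cInf_less_iff[of I y] bdd I(3) by (auto simp: a_def)
    obtain v where v: "v \<in> I" "y < v" using y less_cSup_iff[of I y] bdd I(3) by (auto simp: b_def)
    show "y \<in> I" using I(1) u v unfolding is_interval_1 by (meson less_imp_le)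
  qed
  have "I = {a<..<b} \<union> (I \<inter> {a, b})" using sub sup by auto
  moreover have "I \<inter> {a, b} \<in> sets borel" by (intro borel_closed finite_imp_closed) auto
  ultimately have meas: "I \<in> sets borel" by (metis borel_open open_greaterThanLessThan sets.Un)
  have ab: "a \<le> b" using sub I(3) by auto
  have "emeasure lborel I \<le> emeasure lborel {a..b}" "emeasure lborel {a<..<b} \<le> emeasure lborel I"
    using sub sup meas by (auto intro!: emeasure_mono)
  then have em: "emeasure lborel I = ennreal (b - a)" using ab by auto
  then have em': "emeasure lebesgue I = ennreal (b - a)" using meas by (simp add: emeasure_completion)
  have "a < b" using I(4) em' ab by (cases "a = b") auto
  then show ?thesis using that sub sup meas em em' I(3) by blast
qed

lemma intervals_at_sets: "I \<in> intervals_at x \<Longrightarrow> I \<in> sets borel"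
  by (elim intervals_atE)

text \<open>
  Enlarge the interval slightly to an open one with rational endpoints. As the enlargements shrink to the
  closure of \<open>I\<close>, their measures decrease to the measure of \<open>I\<close>, because endpoints carry no mass.
\<close>
lemma interval_integral_le_rational_maximal:
  assumes [measurable_cong]: "sets \<mu> = sets borel" and [measurable]: "g \<in> borel_measurable borel"
    and fin: "\<And>a b. emeasure \<mu> {a<..<b} < \<infinity>" and atomless: "\<And>c. emeasure \<mu> {c} = 0"
    and I: "I \<in> intervals_at x"
  shows "(\<integral>\<^sup>+y\<in>I. g y \<partial>\<mu>) \<le> rational_maximal \<mu> g x * emeasure \<mu> I"
proof -
  obtain a b where ab: "a < b" "x \<in> {a..b}" "{a<..<b} \<subseteq> I" "I \<subseteq> {a..b}" "I \<in> sets borel"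
    using I by (elim intervals_atE)
  have sets: "A \<in> sets \<mu>" if "A \<in> sets borel" for A using that assms(1) by simp
  let ?R = "rational_maximal \<mu> g x"
  define K where "K = (\<lambda>n. {a - 1 / real (Suc n) <..< b + 1 / real (Suc n)})"
  have step: "(\<integral>\<^sup>+y\<in>I. g y \<partial>\<mu>) \<le> ?R * emeasure \<mu> (K n)" for n
  proof -
    obtain p where p: "p \<in> \<rat>" "a - 1 / real (Suc n) < p" "p < a"
      using Rats_dense_in_real[of "a - 1 / real (Suc n)" a] by auto
    obtain q where q: "q \<in> \<rat>" "b < q" "q < b + 1 / real (Suc n)"
      using Rats_dense_in_real[of b "b + 1 / real (Suc n)"] by auto
    let ?J = "{p<..<q}"
    have xJ: "x \<in> ?J" using ab p q by auto
    have "(\<integral>\<^sup>+y\<in>I. g y \<partial>\<mu>) \<le> (\<integral>\<^sup>+y\<in>?J. g y \<partial>\<mu>)"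
      using ab(4) p q by (intro nn_integral_mono) (auto simp: indicator_def)
    also have "\<dots> \<le> ?R * emeasure \<mu> ?J"
    proof (cases "emeasure \<mu> ?J = 0")
      case True
      then have "?J \<in> null_sets \<mu>" using sets by auto
      then have "(\<integral>\<^sup>+y\<in>?J. g y \<partial>\<mu>) = 0" by (rule nn_integral_null_set)
      then show ?thesis by simp
    next
      case False
      have "(\<integral>\<^sup>+y\<in>?J. g y \<partial>\<mu>) / emeasure \<mu> ?J \<le> ?R"
        unfolding rational_maximal_def using xJ p q by (intro SUP_upper2[of "(p, q)"]) auto
      then have "(\<integral>\<^sup>+y\<in>?J. g y \<partial>\<mu>) / emeasure \<mu> ?J * emeasure \<mu> ?J \<le> ?R * emeasure \<mu> ?J"
        by (rule mult_right_mono) simp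
      then show ?thesis
        using False fin[of p q] by (simp add: ennreal_divide_times ennreal_divide_self)
    qed
    also have "\<dots> \<le> ?R * emeasure \<mu> (K n)"
      using p q sets by (intro mult_left_mono emeasure_mono) (auto simp: K_def)
    finally show ?thesis .
  qed
  have "(\<lambda>n. emeasure \<mu> (K n)) \<longlonglongrightarrow> emeasure \<mu> (\<Inter>n. K n)"
  proof (rule Lim_emeasure_decseq)
    show "range K \<subseteq> sets \<mu>" using sets by (auto simp: K_def)
    show "decseq K" unfolding decseq_def K_def
    proof (intro allI impI)
      fix m n :: nat assume "m \<le> n"
      then have "1 / real (Suc n) \<le> 1 / real (Suc m)" by (intro divide_left_mono) auto
      then show "{a - 1 / real (Suc n)<..<b + 1 / real (Suc n)} \<subseteq> {a - 1 / real (Suc m)<..<b + 1 / real (Suc m)}"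
        by auto
    qed
    show "emeasure \<mu> (K n) \<noteq> \<infinity>" for n using fin[of "a - 1 / real (Suc n)" "b + 1 / real (Suc n)"] by (simp add: K_def)
  qed
  moreover have "(\<Inter>n. K n) = {a..b}"
  proof (intro equalityI subsetI)
    fix y assume y: "y \<in> (\<Inter>n. K n)"
    have yn: "a - 1 / real (Suc n) \<le> y" "y \<le> b + 1 / real (Suc n)" for n
      using y unfolding K_def by (auto simp: less_imp_le)
    have lim0: "(\<lambda>n. 1 / real (Suc n)) \<longlonglongrightarrow> 0"
      by (rule LIMSEQ_Suc[OF lim_1_over_n])
    have "a - 0 \<le> y"
      by (rule LIMSEQ_le_const2[OF tendsto_diff[OF tendsto_const lim0]]) (use yn in blast)
    moreover have "y \<le> b + 0"
      by (rule LIMSEQ_le_const[OF tendsto_add[OF tendsto_const lim0]]) (use yn in blast)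
    ultimately show "y \<in> {a..b}" by simp
  next
    fix y assume y: "y \<in> {a..b}"
    have "y \<in> K n" for n
    proof -
      have "0 < 1 / real (Suc n)" by simp
      then have "a - 1 / real (Suc n) < y" "y < b + 1 / real (Suc n)"
        using y unfolding atLeastAtMost_iff by linarith+
      then show ?thesis unfolding K_def by simp
    qed
    then show "y \<in> (\<Inter>n. K n)" by blast
  qed
  moreover have "emeasure \<mu> {a..b} = emeasure \<mu> I"
  proof (rule antisym)
    have "emeasure \<mu> {a..b} \<le> emeasure \<mu> (I \<union> {a} \<union> {b})"
    proof (rule emeasure_mono)
      have "{a..b} \<subseteq> {a<..<b} \<union> {a} \<union> {b}" by auto
      then show "{a..b} \<subseteq> I \<union> {a} \<union> {b}" using ab(3) by blast
      show "I \<union> {a} \<union> {b} \<in> sets \<mu>" using ab sets by auto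
    qed
    also have "\<dots> \<le> emeasure \<mu> I + emeasure \<mu> {a} + emeasure \<mu> {b}"
      using ab sets by (intro order_trans[OF emeasure_subadditive] add_mono) auto
    finally show "emeasure \<mu> {a..b} \<le> emeasure \<mu> I" by (simp add: atomless)
    show "emeasure \<mu> I \<le> emeasure \<mu> {a..b}" using ab sets by (intro emeasure_mono) auto
  qed
  ultimately have lim: "(\<lambda>n. emeasure \<mu> (K n)) \<longlonglongrightarrow> emeasure \<mu> I" by simp
  show ?thesis
  proof (cases "?R = \<infinity>")
    case False
    have "(\<lambda>n. ?R * emeasure \<mu> (K n)) \<longlonglongrightarrow> ?R * emeasure \<mu> I"
      using lim False by (intro ennreal_tendsto_cmult) (auto simp: less_top)
    then show ?thesis by (rule LIMSEQ_le_const) (use step in auto)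
  next
    case True
    show ?thesis
    proof (cases "emeasure \<mu> I = 0")
      case True
      then have "I \<in> null_sets \<mu>" using sets ab by auto
      then have "(\<integral>\<^sup>+y\<in>I. g y \<partial>\<mu>) = 0" by (rule nn_integral_null_set)
      then show ?thesis by simp
    qed (use \<open>?R = \<infinity>\<close> in \<open>simp add: ennreal_top_mult\<close>)
  qed
qed

lemma emeasure_lborel_Ioo_finite: "emeasure lborel {a<..<b::real} < \<infinity>"
  by (cases "a \<le> b") auto

lemma interval_maximal_le_rational_maximal:
  assumes "F \<in> borel_measurable borel"
  shows "interval_maximal F x \<le> rational_maximal lborel F x"
  unfolding interval_maximal_def
proof (rule SUP_least)
  fix I assume I: "I \<in> intervals_at x"
  obtain a b where ab: "a < b" "emeasure lborel I = ennreal (b - a)" "emeasure lebesgue I = ennreal (b - a)"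
    using I by (elim intervals_atE)
  have "(\<integral>\<^sup>+y\<in>I. F y \<partial>lborel) \<le> rational_maximal lborel F x * ennreal (b - a)"
    using interval_integral_le_rational_maximal[OF _ assms emeasure_lborel_Ioo_finite _ I] ab by simp
  then have "(\<integral>\<^sup>+y\<in>I. F y \<partial>lborel) / ennreal (b - a) \<le> rational_maximal lborel F x * ennreal (b - a) / ennreal (b - a)"
    by (rule divide_right_mono_ennreal)
  also have "\<dots> = rational_maximal lborel F x" using ab by (intro ennreal_mult_divide_eq) auto
  finally show "(\<integral>\<^sup>+y\<in>I. F y \<partial>lebesgue) / emeasure lebesgue I \<le> rational_maximal lborel F x"
    by (simp add: nn_integral_completion ab(3))
qed

lemma interval_maximal_cong_AE:
  assumes "AE y in lborel. F y = G y"
  shows "interval_maximal F x = interval_maximal G x"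
  unfolding interval_maximal_def nn_integral_completion
  by (intro SUP_cong refl arg_cong2[where f = "(/)"] nn_integral_cong_AE) (use assms in auto)

text \<open>
  The level set of \<open>interval_maximal F\<close> is enclosed in a Borel set, namely a level set of
  \<open>rational_maximal\<close>, so that its own measurability never comes up.
\<close>
lemma interval_maximal_weak_type:
  assumes F: "F \<in> borel_measurable lebesgue" and t: "0 < t"
  obtains B where "B \<in> sets borel" "{x. ennreal t < interval_maximal F x} \<subseteq> B"
    "emeasure lborel B \<le> ennreal (2 / t) * (\<integral>\<^sup>+x. F x \<partial>lborel)"
proof -
  obtain G where G: "G \<in> borel_measurable lborel" "AE x in lborel. F x = G x"
    using completion_ex_borel_measurable[OF F] by auto
  have G' [measurable]: "G \<in> borel_measurable borel" using G(1) by simp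
  let ?B = "{x. ennreal t < rational_maximal lborel G x}"
  have "interval_maximal F x \<le> rational_maximal lborel G x" for x
    using interval_maximal_cong_AE[OF G(2)] interval_maximal_le_rational_maximal[OF G'] by simp
  then have sub: "{x. ennreal t < interval_maximal F x} \<subseteq> ?B" by (auto intro: less_le_trans)
  have "ennreal t * emeasure lborel ?B \<le> 2 * (\<integral>\<^sup>+x. G x \<partial>lborel)"
    by (rule rational_maximal_weak_type) (use emeasure_lborel_Ioo_finite in auto)
  then have "ennreal (1 / t) * (ennreal t * emeasure lborel ?B) \<le> ennreal (1 / t) * (2 * (\<integral>\<^sup>+x. G x \<partial>lborel))"
    by (rule mult_left_mono) simp
  moreover have "ennreal (1 / t) * ennreal t = 1" using t by (simp flip: ennreal_mult)
  moreover have "ennreal (1 / t) * 2 = ennreal (2 / t)"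
    using t by (simp flip: ennreal_mult ennreal_numeral)
  moreover have "(\<integral>\<^sup>+x. G x \<partial>lborel) = (\<integral>\<^sup>+x. F x \<partial>lborel)"
    by (rule nn_integral_cong_AE) (use G(2) in auto)
  ultimately have "emeasure lborel ?B \<le> ennreal (2 / t) * (\<integral>\<^sup>+x. F x \<partial>lborel)"
    by (simp add: mult.assoc[symmetric])
  then show ?thesis using sub by (intro that[of ?B]) auto
qed

lemma interval_maximal_mono:
  assumes "\<And>y. F y \<le> G y" shows "interval_maximal F x \<le> interval_maximal G x"
  unfolding interval_maximal_def
  by (intro SUP_mono') (intro divide_right_mono_ennreal nn_integral_mono mult_right_mono assms, auto)

lemma interval_maximal_add_le:
  assumes [measurable]: "F \<in> borel_measurable lebesgue" "G \<in> borel_measurable lebesgue"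
  shows "interval_maximal (\<lambda>y. F y + G y) x \<le> interval_maximal F x + interval_maximal G x"
  unfolding interval_maximal_def
proof (rule SUP_least)
  fix I assume I: "I \<in> intervals_at x"
  have [measurable]: "I \<in> sets lebesgue" using intervals_at_sets[OF I] by auto
  have "(\<integral>\<^sup>+y\<in>I. (F y + G y) \<partial>lebesgue) = (\<integral>\<^sup>+y\<in>I. F y \<partial>lebesgue) + (\<integral>\<^sup>+y\<in>I. G y \<partial>lebesgue)"
    by (simp add: distrib_right nn_integral_add)
  then have "(\<integral>\<^sup>+y\<in>I. (F y + G y) \<partial>lebesgue) / emeasure lebesgue I
     = (\<integral>\<^sup>+y\<in>I. F y \<partial>lebesgue) / emeasure lebesgue I + (\<integral>\<^sup>+y\<in>I. G y \<partial>lebesgue) / emeasure lebesgue I"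
    by (simp add: add_divide_distrib_ennreal)
  also have "\<dots> \<le> (SUP I\<in>intervals_at x. (\<integral>\<^sup>+y\<in>I. F y \<partial>lebesgue) / emeasure lebesgue I)
      + (SUP I\<in>intervals_at x. (\<integral>\<^sup>+y\<in>I. G y \<partial>lebesgue) / emeasure lebesgue I)"
    by (intro add_mono SUP_upper I)
  finally show "(\<integral>\<^sup>+y\<in>I. (F y + G y) \<partial>lebesgue) / emeasure lebesgue I \<le> \<dots>" .
qed

lemma interval_average_const:
  "I \<in> intervals_at x \<Longrightarrow> (\<integral>\<^sup>+y\<in>I. c \<partial>lebesgue) / emeasure lebesgue I = c"
proof -
  assume I: "I \<in> intervals_at x"
  then obtain a b where ab: "a < b" "I \<in> sets borel" "emeasure lebesgue I = ennreal (b - a)"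
    by (elim intervals_atE)
  have "(\<integral>\<^sup>+y\<in>I. c \<partial>lebesgue) = c * emeasure lebesgue I"
    using ab(2) by (intro nn_integral_cmult_indicator) auto
  then show ?thesis unfolding ab(3) using ab(1) by (simp add: ennreal_mult_divide_eq)
qed

lemma interval_maximal_le_bound:
  assumes "\<And>y. F y \<le> c" shows "interval_maximal F x \<le> c"
  unfolding interval_maximal_def
proof (rule SUP_least)
  fix I assume I: "I \<in> intervals_at x"
  have "(\<integral>\<^sup>+y\<in>I. F y \<partial>lebesgue) / emeasure lebesgue I \<le> (\<integral>\<^sup>+y\<in>I. c \<partial>lebesgue) / emeasure lebesgue I"
    by (intro divide_right_mono_ennreal nn_integral_mono mult_right_mono assms) auto
  then show "(\<integral>\<^sup>+y\<in>I. F y \<partial>lebesgue) / emeasure lebesgue I \<le> c"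
    using interval_average_const[OF I] by simp
qed

lemma atLeastAtMost_in_intervals_at:
  fixes a b :: real assumes "a < b" "x \<in> {a..b}" shows "{a..b} \<in> intervals_at x"
  using assms by (simp add: is_interval_cc)

lemma interval_maximal_ge_average:
  assumes "a < b" "x \<in> {a..b}"
  shows "(\<integral>\<^sup>+y\<in>{a..b}. F y \<partial>lebesgue) / ennreal (b - a) \<le> interval_maximal F x"
  unfolding interval_maximal_def
  by (rule SUP_upper2[OF atLeastAtMost_in_intervals_at[OF assms]]) (use assms in simp)

text \<open>
  Translating an interval through \<open>x\<close> by \<open>y - x\<close> gives one through \<open>y\<close> of the same length and changes
  the average by at most \<open>L * \<bar>x - y\<bar>\<close>.
\<close>
lemma interval_maximal_Lipschitz:
  fixes F :: "real \<Rightarrow> real"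
  assumes [measurable]: "F \<in> borel_measurable borel"
    and lip: "\<And>u v. \<bar>F u - F v\<bar> \<le> L * \<bar>u - v\<bar>"
  shows "interval_maximal (\<lambda>u. ennreal (F u)) x \<le> interval_maximal (\<lambda>u. ennreal (F u)) y + ennreal (L * \<bar>x - y\<bar>)"
  unfolding interval_maximal_def
proof (rule SUP_least)
  fix I assume I: "I \<in> intervals_at x"
  define d where "d = y - x"
  define J where "J = (+) d ` I"
  have [measurable]: "I \<in> sets borel" using I by (rule intervals_at_sets)
  have Jeq: "J = (\<lambda>u. u - d) -` I" unfolding J_def by (auto simp: image_iff intro!: bexI[of _ "_ - d"])
  then have [measurable]: "J \<in> sets borel" using measurable_sets[of "\<lambda>u. u - d" borel borel I] by simp
  have indJ: "indicator J (d + 1 * u) = indicator I u" for u unfolding Jeq by (simp add: indicator_def)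
  have emJ: "emeasure lborel J = emeasure lborel I"
    using nn_integral_real_affine[of "indicator J" 1 d] unfolding indJ by simp
  have em: "emeasure lebesgue I = emeasure lborel I" "emeasure lebesgue J = emeasure lborel I"
    using emJ by (simp_all add: emeasure_completion)
  have Jin: "J \<in> intervals_at y"
  proof -
    have "is_interval J" using I unfolding J_def by simp
    moreover have "bounded J" unfolding J_def using I bounded_translation[of I d] by simp
    moreover have "y \<in> J" using I by (auto simp: J_def d_def image_iff intro!: bexI[of _ x])
    ultimately show ?thesis using I em by simp
  qed
  have "(\<integral>\<^sup>+u\<in>I. ennreal (F u) \<partial>lborel) \<le> (\<integral>\<^sup>+u\<in>I. (ennreal (F (d + 1 * u)) + ennreal (L * \<bar>x - y\<bar>)) \<partial>lborel)"
  proof (intro nn_integral_mono mult_right_mono)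
    fix u
    have "F u \<le> F (d + 1 * u) + L * \<bar>x - y\<bar>" using lip[of u "d + 1 * u"] by (simp add: d_def abs_minus_commute)
    moreover have "0 \<le> L * \<bar>x - y\<bar>" using lip[of x y] by simp
    ultimately show "ennreal (F u) \<le> ennreal (F (d + 1 * u)) + ennreal (L * \<bar>x - y\<bar>)"
      by (cases "0 \<le> F (d + 1 * u)") (auto simp: ennreal_plus[symmetric] ennreal_neg intro!: ennreal_leI simp del: ennreal_plus)
  qed simp
  also have "\<dots> = (\<integral>\<^sup>+u. ennreal (F (d + 1 * u)) * indicator J (d + 1 * u) \<partial>lborel) + (\<integral>\<^sup>+u\<in>I. ennreal (L * \<bar>x - y\<bar>) \<partial>lborel)"
    unfolding indJ by (simp add: distrib_right nn_integral_add)
  also have "(\<integral>\<^sup>+u. ennreal (F (d + 1 * u)) * indicator J (d + 1 * u) \<partial>lborel) = (\<integral>\<^sup>+u\<in>J. ennreal (F u) \<partial>lborel)"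
    using nn_integral_real_affine[of "\<lambda>u. ennreal (F u) * indicator J u" 1 d] by simp
  finally have "(\<integral>\<^sup>+u\<in>I. ennreal (F u) \<partial>lebesgue) \<le> (\<integral>\<^sup>+u\<in>J. ennreal (F u) \<partial>lebesgue) + (\<integral>\<^sup>+u\<in>I. ennreal (L * \<bar>x - y\<bar>) \<partial>lebesgue)"
    by (simp add: nn_integral_completion)
  then have "(\<integral>\<^sup>+u\<in>I. ennreal (F u) \<partial>lebesgue) / emeasure lebesgue I
     \<le> ((\<integral>\<^sup>+u\<in>J. ennreal (F u) \<partial>lebesgue) + (\<integral>\<^sup>+u\<in>I. ennreal (L * \<bar>x - y\<bar>) \<partial>lebesgue)) / emeasure lebesgue I"
    by (rule divide_right_mono_ennreal)
  also have "\<dots> = (\<integral>\<^sup>+u\<in>J. ennreal (F u) \<partial>lebesgue) / emeasure lebesgue J + ennreal (L * \<bar>x - y\<bar>)"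
    using interval_average_const[OF I] em by (simp add: add_divide_distrib_ennreal)
  also have "\<dots> \<le> (SUP I\<in>intervals_at y. (\<integral>\<^sup>+y\<in>I. ennreal (F y) \<partial>lebesgue) / emeasure lebesgue I) + ennreal (L * \<bar>x - y\<bar>)"
    by (intro add_right_mono SUP_upper Jin)
  finally show "(\<integral>\<^sup>+u\<in>I. ennreal (F u) \<partial>lebesgue) / emeasure lebesgue I \<le> \<dots>" .
qed

section \<open>Principal values and measurability of the Hilbert transform\<close>

definition truncated_hilbert :: "real \<Rightarrow> (real \<Rightarrow> real) \<Rightarrow> real \<Rightarrow> real" where
  "truncated_hilbert \<epsilon> f x = 1 / pi * (LINT y:{y. \<epsilon> < \<bar>x - y\<bar>}|lebesgue. f y / (x - y))"

definition has_pv :: "(real \<Rightarrow> real) \<Rightarrow> real \<Rightarrow> bool" where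
  "has_pv f x \<longleftrightarrow> (\<exists>l. ((\<lambda>\<epsilon>. truncated_hilbert \<epsilon> f x) \<longlongrightarrow> l) (at_right 0))"

text \<open>
  The value of \<open>Lim\<close> where there is no limit. That it is the same for all functions and all points is
  used in \<open>has_pv_AE_or_no_pv_value_eq_0\<close>.
\<close>
definition no_pv_value :: real where
  "no_pv_value = (THE l. False)"

lemma hilbert_eqI:
  "((\<lambda>\<epsilon>. truncated_hilbert \<epsilon> f x) \<longlongrightarrow> l) (at_right 0) \<Longrightarrow> hilbert f x = l"
  unfolding hilbert_def truncated_hilbert_def by (rule tendsto_Lim) auto

lemma tendsto_hilbert:
  "has_pv f x \<Longrightarrow> ((\<lambda>\<epsilon>. truncated_hilbert \<epsilon> f x) \<longlongrightarrow> hilbert f x) (at_right 0)"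
  using hilbert_eqI unfolding has_pv_def by blast

lemma hilbert_no_pv: "\<not> has_pv f x \<Longrightarrow> hilbert f x = no_pv_value"
  unfolding hilbert_def has_pv_def truncated_hilbert_def t2_space_class.Lim_def no_pv_value_def by simp

lemma borel_measurable_lebesgue_ident: "(\<lambda>y::real. y) \<in> borel_measurable lebesgue"
  by (rule measurable_completion) simp

lemma truncated_hilbert_integrable:
  fixes f :: "real \<Rightarrow> real"
  assumes "0 < \<epsilon>" "integrable lebesgue f"
  shows "integrable lebesgue (\<lambda>y. indicator {y. \<epsilon> < \<bar>x - y\<bar>} y *\<^sub>R (f y / (x - y)))"
proof (rule Bochner_Integration.integrable_bound)
  show "integrable lebesgue (\<lambda>y. 1 / \<epsilon> * \<bar>f y\<bar>)" using assms(2) by auto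
  note borel_measurable_lebesgue_ident [measurable]
  have [measurable]: "f \<in> borel_measurable lebesgue" using assms(2) by auto
  show "(\<lambda>y. indicator {y. \<epsilon> < \<bar>x - y\<bar>} y *\<^sub>R (f y / (x - y))) \<in> borel_measurable lebesgue" by measurable
  show "AE y in lebesgue. norm (indicator {y. \<epsilon> < \<bar>x - y\<bar>} y *\<^sub>R (f y / (x - y))) \<le> norm (1 / \<epsilon> * \<bar>f y\<bar>)"
  proof (rule AE_I2)
    fix y
    show "norm (indicator {y. \<epsilon> < \<bar>x - y\<bar>} y *\<^sub>R (f y / (x - y))) \<le> norm (1 / \<epsilon> * \<bar>f y\<bar>)"
    proof (cases "\<epsilon> < \<bar>x - y\<bar>")
      case True
      then have "\<bar>f y\<bar> / \<bar>x - y\<bar> \<le> \<bar>f y\<bar> / \<epsilon>" using assms(1) by (intro divide_left_mono) auto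
      then show ?thesis using True assms(1) by (simp add: abs_mult)
    qed simp
  qed
qed

lemma truncated_hilbert_diff:
  assumes "0 < \<epsilon>" "integrable lebesgue f" "integrable lebesgue g"
  shows "truncated_hilbert \<epsilon> (\<lambda>y. f y - g y) x = truncated_hilbert \<epsilon> f x - truncated_hilbert \<epsilon> g x"
proof -
  have "(LINT y:{y. \<epsilon> < \<bar>x - y\<bar>}|lebesgue. (f y - g y) / (x - y))
      = (LINT y:{y. \<epsilon> < \<bar>x - y\<bar>}|lebesgue. f y / (x - y)) - (LINT y:{y. \<epsilon> < \<bar>x - y\<bar>}|lebesgue. g y / (x - y))"
    unfolding diff_divide_distrib
    by (rule set_integral_diff(2)) (unfold set_integrable_def, (rule truncated_hilbert_integrable assms)+)
  then show ?thesis unfolding truncated_hilbert_def by (simp add: right_diff_distrib)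
qed

lemma truncated_hilbert_cmult:
  "truncated_hilbert \<epsilon> (\<lambda>y. c * f y) x = c * truncated_hilbert \<epsilon> f x"
proof -
  have "indicator A y *\<^sub>R (c * f y / (x - y)) = c * (indicator A y *\<^sub>R (f y / (x - y)))" for A y
    by simp
  then show ?thesis unfolding truncated_hilbert_def set_lebesgue_integral_def
    by (simp only: integral_mult_right_zero mult.left_commute)
qed

lemma truncated_hilbert_cong_AE:
  assumes [measurable]: "f \<in> borel_measurable lebesgue" "g \<in> borel_measurable lebesgue"
    and "AE y in lebesgue. f y = g y"
  shows "truncated_hilbert \<epsilon> f x = truncated_hilbert \<epsilon> g x"
proof -
  note borel_measurable_lebesgue_ident [measurable]
  show ?thesis unfolding truncated_hilbert_def set_lebesgue_integral_def
    by (intro arg_cong2[where f = "(*)"] refl integral_cong_AE) (measurable, use assms(3) in auto)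
qed

lemma hilbert_diff:
  assumes "integrable lebesgue f" "integrable lebesgue g" "has_pv f x" "has_pv g x"
  shows "hilbert (\<lambda>y. f y - g y) x = hilbert f x - hilbert g x"
proof (rule hilbert_eqI)
  have "((\<lambda>\<epsilon>. truncated_hilbert \<epsilon> f x - truncated_hilbert \<epsilon> g x) \<longlongrightarrow> hilbert f x - hilbert g x) (at_right 0)"
    using assms by (intro tendsto_diff tendsto_hilbert)
  moreover have "\<forall>\<^sub>F \<epsilon> in at_right 0. truncated_hilbert \<epsilon> f x - truncated_hilbert \<epsilon> g x
     = truncated_hilbert \<epsilon> (\<lambda>y. f y - g y) x"
    using eventually_at_right_less[of "0::real"] by eventually_elim (simp add: truncated_hilbert_diff assms)
  ultimately show "((\<lambda>\<epsilon>. truncated_hilbert \<epsilon> (\<lambda>y. f y - g y) x) \<longlongrightarrow> hilbert f x - hilbert g x) (at_right 0)"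
    by (rule Lim_transform_eventually)
qed

lemma has_pv_cmultD:
  assumes "has_pv (\<lambda>y. c * f y) x" "c \<noteq> 0" shows "has_pv f x"
proof -
  obtain l where "((\<lambda>\<epsilon>. c * truncated_hilbert \<epsilon> f x) \<longlongrightarrow> l) (at_right 0)"
    using assms(1) unfolding has_pv_def truncated_hilbert_cmult by blast
  then have "((\<lambda>\<epsilon>. 1 / c * (c * truncated_hilbert \<epsilon> f x)) \<longlongrightarrow> 1 / c * l) (at_right 0)"
    by (intro tendsto_mult tendsto_const)
  then show ?thesis using assms(2) unfolding has_pv_def by auto
qed

lemma truncated_hilbert_borel:
  assumes [measurable]: "f \<in> borel_measurable borel"
  shows "truncated_hilbert \<epsilon> f x = 1 / pi * (\<integral>y. indicator {y. \<epsilon> < \<bar>x - y\<bar>} y * (f y / (x - y)) \<partial>lborel)"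
  unfolding truncated_hilbert_def set_lebesgue_integral_def real_scaleR_def
  by (subst integral_completion) auto

lemma truncated_hilbert_measurable_borel:
  assumes [measurable]: "f \<in> borel_measurable borel"
  shows "truncated_hilbert \<epsilon> f \<in> borel_measurable borel"
proof -
  have "(\<lambda>x. 1 / pi * (\<integral>y. indicator {y. \<epsilon> < \<bar>x - y\<bar>} y * (f y / (x - y)) \<partial>lborel)) \<in> borel_measurable borel"
    by measurable
  moreover have "truncated_hilbert \<epsilon> f
      = (\<lambda>x. 1 / pi * (\<integral>y. indicator {y. \<epsilon> < \<bar>x - y\<bar>} y * (f y / (x - y)) \<partial>lborel))"
    by (intro ext truncated_hilbert_borel assms)
  ultimately show ?thesis by simp
qed

lemma truncated_hilbert_measurable:
  assumes f: "f \<in> borel_measurable lebesgue"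
  shows "truncated_hilbert \<epsilon> f \<in> borel_measurable borel"
proof -
  obtain g where g: "g \<in> borel_measurable lborel" "AE y in lborel. f y = g y"
    using completion_ex_borel_measurable_real[OF f] by auto
  then have g': "g \<in> borel_measurable borel" by simp
  have "truncated_hilbert \<epsilon> f = truncated_hilbert \<epsilon> g"
    using f g by (intro ext truncated_hilbert_cong_AE) (auto simp: measurable_completion AE_completion)
  then show ?thesis using truncated_hilbert_measurable_borel[OF g'] by simp
qed

lemma truncated_hilbert_right_continuous:
  assumes e: "0 < e" and f: "integrable lebesgue f"
    and s: "\<And>n. e \<le> s n" "s \<longlonglongrightarrow> e"
  shows "(\<lambda>n. truncated_hilbert (s n) f x) \<longlonglongrightarrow> truncated_hilbert e f x"
  unfolding truncated_hilbert_def set_lebesgue_integral_def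
proof (intro tendsto_mult tendsto_const integral_dominated_convergence[where w = "\<lambda>y. 1 / e * \<bar>f y\<bar>"])
  note borel_measurable_lebesgue_ident [measurable]
  have [measurable]: "f \<in> borel_measurable lebesgue" using f by auto
  show "(\<lambda>y. indicator {y. e < \<bar>x - y\<bar>} y *\<^sub>R (f y / (x - y))) \<in> borel_measurable lebesgue" by measurable
  show "(\<lambda>y. indicator {y. s n < \<bar>x - y\<bar>} y *\<^sub>R (f y / (x - y))) \<in> borel_measurable lebesgue" for n by measurable
  show "integrable lebesgue (\<lambda>y. 1 / e * \<bar>f y\<bar>)" using f by auto
  show "AE y in lebesgue. (\<lambda>n. indicator {y. s n < \<bar>x - y\<bar>} y *\<^sub>R (f y / (x - y)))
      \<longlonglongrightarrow> indicator {y. e < \<bar>x - y\<bar>} y *\<^sub>R (f y / (x - y))"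
  proof (rule AE_I2)
    fix y
    have "\<forall>\<^sub>F n in sequentially. indicator {y. s n < \<bar>x - y\<bar>} y = (indicator {y. e < \<bar>x - y\<bar>} y :: real)"
    proof (cases "e < \<bar>x - y\<bar>")
      case True
      then have "\<forall>\<^sub>F n in sequentially. s n < \<bar>x - y\<bar>" using s(2) by (rule order_tendstoD(2)[rotated])
      then show ?thesis by eventually_elim (use True in simp)
    next
      case False
      then have "\<not> s n < \<bar>x - y\<bar>" for n using s(1)[of n] by linarith
      then show ?thesis using False by simp
    qed
    then have "\<forall>\<^sub>F n in sequentially. indicator {y. e < \<bar>x - y\<bar>} y *\<^sub>R (f y / (x - y))
       = indicator {y. s n < \<bar>x - y\<bar>} y *\<^sub>R (f y / (x - y))"
      by eventually_elim simp
    then show "(\<lambda>n. indicator {y. s n < \<bar>x - y\<bar>} y *\<^sub>R (f y / (x - y)))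
      \<longlonglongrightarrow> indicator {y. e < \<bar>x - y\<bar>} y *\<^sub>R (f y / (x - y))"
      by (rule Lim_transform_eventually[OF tendsto_const])
  qed
  show "AE y in lebesgue. norm (indicator {y. s n < \<bar>x - y\<bar>} y *\<^sub>R (f y / (x - y))) \<le> 1 / e * \<bar>f y\<bar>" for n
  proof (rule AE_I2)
    fix y
    show "norm (indicator {y. s n < \<bar>x - y\<bar>} y *\<^sub>R (f y / (x - y))) \<le> 1 / e * \<bar>f y\<bar>"
    proof (cases "s n < \<bar>x - y\<bar>")
      case True
      then have "\<bar>f y\<bar> / \<bar>x - y\<bar> \<le> \<bar>f y\<bar> / e" using e s(1)[of n] by (intro divide_left_mono) auto
      then show ?thesis using True by simp
    qed (use e in simp)
  qed
qed

text \<open>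
  The truncated transform is right-continuous in the truncation parameter, so the Cauchy criterion can
  be tested on rational parameters. This exhibits the set of points with a principal value as a
  countable combination of measurable sets.
\<close>
lemma has_pv_iff_rational_Cauchy:
  assumes f: "integrable lebesgue f"
  shows "has_pv f x \<longleftrightarrow> (\<forall>k::nat. \<exists>m::nat. \<forall>p q::rat.
    0 < p \<and> of_rat p < 1 / real (Suc m) \<and> 0 < q \<and> of_rat q < 1 / real (Suc m) \<longrightarrow>
    \<bar>truncated_hilbert (of_rat p) f x - truncated_hilbert (of_rat q) f x\<bar> \<le> 1 / real (Suc k))"
    (is "_ \<longleftrightarrow> ?C")
proof
  assume "has_pv f x"
  then obtain l where l: "((\<lambda>\<epsilon>. truncated_hilbert \<epsilon> f x) \<longlongrightarrow> l) (at_right 0)" unfolding has_pv_def by blast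
  show ?C
  proof
    fix k :: nat
    have "0 < 1 / (2 * real (Suc k))" by simp
    then have "\<forall>\<^sub>F \<epsilon> in at_right 0. dist (truncated_hilbert \<epsilon> f x) l < 1 / (2 * real (Suc k))"
      using l by (rule tendstoD[rotated])
    then obtain b where b: "0 < b" "\<And>\<epsilon>. 0 < \<epsilon> \<Longrightarrow> \<epsilon> < b \<Longrightarrow> dist (truncated_hilbert \<epsilon> f x) l < 1 / (2 * real (Suc k))"
      unfolding eventually_at_right_field by auto
    obtain m where m: "1 / real (Suc m) < b" using reals_Archimedean[OF b(1)] by (auto simp: inverse_eq_divide)
    have close: "\<bar>truncated_hilbert p f x - truncated_hilbert q f x\<bar> \<le> 1 / real (Suc k)"
      if "0 < p" "p < 1 / real (Suc m)" "0 < q" "q < 1 / real (Suc m)" for p q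
    proof -
      have "\<bar>truncated_hilbert p f x - truncated_hilbert q f x\<bar> < 1 / (2 * real (Suc k)) + 1 / (2 * real (Suc k))"
        using b(2)[of p] b(2)[of q] that m unfolding dist_real_def by linarith
      then show ?thesis by (simp add: field_simps)
    qed
    then show "\<exists>m::nat. \<forall>p q::rat.
      0 < p \<and> of_rat p < 1 / real (Suc m) \<and> 0 < q \<and> of_rat q < 1 / real (Suc m) \<longrightarrow>
      \<bar>truncated_hilbert (of_rat p) f x - truncated_hilbert (of_rat q) f x\<bar> \<le> 1 / real (Suc k)"
      by (intro exI[of _ m] allI impI close) (simp_all del: of_nat_Suc)
  qed
next
  assume C: ?C
  let ?T = "\<lambda>e. truncated_hilbert e f x"
  have real: "\<exists>m::nat. \<forall>p q::real. 0 < p \<and> p < 1 / real (Suc m) \<and> 0 < q \<and> q < 1 / real (Suc m)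
      \<longrightarrow> \<bar>?T p - ?T q\<bar> \<le> 1 / real (Suc k)" for k
  proof -
    obtain m where m: "\<And>p q::rat. 0 < p \<Longrightarrow> of_rat p < 1 / real (Suc m) \<Longrightarrow> 0 < q
      \<Longrightarrow> of_rat q < 1 / real (Suc m) \<Longrightarrow> \<bar>?T (of_rat p) - ?T (of_rat q)\<bar> \<le> 1 / real (Suc k)"
      using C by blast
    have approx: "\<exists>s::nat \<Rightarrow> rat. (\<forall>n. p \<le> of_rat (s n) \<and> of_rat (s n) < 1 / real (Suc m)) \<and> (\<lambda>n. of_rat (s n) :: real) \<longlonglongrightarrow> p"
      if p: "0 < p" "p < 1 / real (Suc m)" for p :: real
    proof -
      have "\<exists>s. p < of_rat s \<and> of_rat s < min (1 / real (Suc m)) (p + 1 / real (Suc n))" for n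
        using p by (intro of_rat_dense) auto
      then obtain s where s: "\<And>n. p < of_rat (s n) \<and> of_rat (s n) < min (1 / real (Suc m)) (p + 1 / real (Suc n))"
        by metis
      then have s1: "p \<le> of_rat (s n)" and s2: "of_rat (s n) \<le> p + 1 / real (Suc n)"
        and s3: "of_rat (s n) < 1 / real (Suc m)" for n
        by (simp_all add: less_imp_le del: of_nat_Suc)
      have "(\<lambda>n. p + 1 / real (Suc n)) \<longlonglongrightarrow> p + 0"
        by (intro tendsto_add tendsto_const LIMSEQ_Suc[OF lim_1_over_n])
      then have "(\<lambda>n. p + 1 / real (Suc n)) \<longlonglongrightarrow> p" by simp
      then have "(\<lambda>n. of_rat (s n) :: real) \<longlonglongrightarrow> p"
        by (rule real_tendsto_sandwich[OF always_eventually[OF allI[OF s1]] always_eventually[OF allI[OF s2]] tendsto_const])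
      then show ?thesis using s1 s3 by blast
    qed
    have "\<bar>?T p - ?T q\<bar> \<le> 1 / real (Suc k)"
      if pq: "0 < p" "p < 1 / real (Suc m)" "0 < q" "q < 1 / real (Suc m)" for p q
    proof -
      obtain s where s: "\<And>n. p \<le> of_rat (s n) \<and> of_rat (s n) < 1 / real (Suc m)" "(\<lambda>n. of_rat (s n) :: real) \<longlonglongrightarrow> p"
        using approx[OF pq(1,2)] by blast
      obtain t where t: "\<And>n. q \<le> of_rat (t n) \<and> of_rat (t n) < 1 / real (Suc m)" "(\<lambda>n. of_rat (t n) :: real) \<longlonglongrightarrow> q"
        using approx[OF pq(3,4)] by blast
      have "(\<lambda>n. \<bar>?T (of_rat (s n)) - ?T (of_rat (t n))\<bar>) \<longlonglongrightarrow> \<bar>?T p - ?T q\<bar>"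
        using s t pq by (intro tendsto_rabs tendsto_diff truncated_hilbert_right_continuous f) auto
      moreover have "\<bar>?T (of_rat (s n)) - ?T (of_rat (t n))\<bar> \<le> 1 / real (Suc k)" for n
      proof (rule m)
        have "0 < (of_rat (s n) :: real)" "0 < (of_rat (t n) :: real)"
          using s(1)[of n] t(1)[of n] pq by linarith+
        then show "0 < s n" "0 < t n" by simp_all
      qed (use s(1)[of n] t(1)[of n] in auto)
      ultimately show ?thesis by (intro LIMSEQ_le_const2) auto
    qed
    then show ?thesis by blast
  qed
  define u where "u = (\<lambda>n. ?T (1 / real (n + 2)))"
  have small: "\<exists>N. \<forall>n\<ge>N. 1 / real (n + 2) < 1 / real (Suc m)" for m
    by (rule exI[of _ m]) (auto intro!: divide_strict_left_mono)
  have arch: "\<exists>k. 1 / real (Suc k) < r" if "0 < r" for r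
    using reals_Archimedean[OF that] by (auto simp: inverse_eq_divide)
  have "Cauchy u"
  proof (rule CauchyI)
    fix r :: real assume "0 < r"
    then obtain k where k: "1 / real (Suc k) < r" using arch by blast
    obtain m where m: "\<And>p q::real. 0 < p \<and> p < 1 / real (Suc m) \<and> 0 < q \<and> q < 1 / real (Suc m)
      \<Longrightarrow> \<bar>?T p - ?T q\<bar> \<le> 1 / real (Suc k)" using real[of k] by blast
    obtain N where N: "\<And>n. n \<ge> N \<Longrightarrow> 1 / real (n + 2) < 1 / real (Suc m)" using small by blast
    show "\<exists>M. \<forall>i\<ge>M. \<forall>j\<ge>M. norm (u i - u j) < r"
    proof (intro exI allI impI)
      fix i j assume "N \<le> i" "N \<le> j"
      then have "\<bar>u i - u j\<bar> \<le> 1 / real (Suc k)" unfolding u_def using N by (intro m) auto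
      then show "norm (u i - u j) < r" using k by simp
    qed
  qed
  then obtain l where l: "u \<longlonglongrightarrow> l" using Cauchy_convergent convergent_def by blast
  have "(?T \<longlongrightarrow> l) (at_right 0)"
  proof (rule tendstoI)
    fix r :: real assume "0 < r"
    then obtain k where k: "1 / real (Suc k) < r" using arch by blast
    obtain m where m: "\<And>p q::real. 0 < p \<and> p < 1 / real (Suc m) \<and> 0 < q \<and> q < 1 / real (Suc m)
      \<Longrightarrow> \<bar>?T p - ?T q\<bar> \<le> 1 / real (Suc k)" using real[of k] by blast
    obtain N where N: "\<And>n. n \<ge> N \<Longrightarrow> 1 / real (n + 2) < 1 / real (Suc m)" using small by blast
    have "\<bar>?T e - l\<bar> \<le> 1 / real (Suc k)" if e: "0 < e" "e < 1 / real (Suc m)" for e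
    proof (rule LIMSEQ_le_const2)
      show "(\<lambda>n. \<bar>?T e - u n\<bar>) \<longlonglongrightarrow> \<bar>?T e - l\<bar>" by (intro tendsto_intros l)
      show "\<exists>N. \<forall>n\<ge>N. \<bar>?T e - u n\<bar> \<le> 1 / real (Suc k)"
        unfolding u_def using N e by (intro exI[of _ N] allI impI m) auto
    qed
    then have "\<And>e. 0 < e \<Longrightarrow> e < 1 / real (Suc m) \<Longrightarrow> dist (?T e) l < r"
      using k unfolding dist_real_def by (meson le_less_trans)
    then show "\<forall>\<^sub>F e in at_right 0. dist (?T e) l < r"
      unfolding eventually_at_right_field by (intro exI[of _ "1 / real (Suc m)"]) auto
  qed
  then show "has_pv f x" unfolding has_pv_def by blast
qed

lemma sets_has_pv:
  assumes f: "integrable lebesgue f"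
  shows "{x. has_pv f x} \<in> sets borel"
proof -
  have [measurable]: "truncated_hilbert e f \<in> borel_measurable borel" for e
    using f by (intro truncated_hilbert_measurable) auto
  show ?thesis by (subst Collect_cong[OF has_pv_iff_rational_Cauchy[OF f]]) measurable
qed

lemma borel_measurable_hilbert:
  assumes f: "integrable lebesgue f"
  shows "hilbert f \<in> borel_measurable borel"
proof -
  have [measurable]: "truncated_hilbert e f \<in> borel_measurable borel" for e
    using f by (intro truncated_hilbert_measurable) auto
  have [measurable]: "Measurable.pred borel (has_pv f)"
    using sets_has_pv[OF f] by (simp add: pred_def)
  have "hilbert f x = (if has_pv f x then lim (\<lambda>n. truncated_hilbert (1 / real (Suc n)) f x) else no_pv_value)" for x
  proof (cases "has_pv f x")
    case True
    have "filterlim (\<lambda>n. 1 / real (Suc n)) (at_right 0) sequentially"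
      unfolding filterlim_at using LIMSEQ_Suc[OF lim_1_over_n[where 'a = real]] by (auto simp del: of_nat_Suc)
    from filterlim_compose[OF tendsto_hilbert[OF True] this] True show ?thesis by (simp add: limI)
  qed (simp add: hilbert_no_pv)
  moreover have "(\<lambda>x. if has_pv f x then lim (\<lambda>n. truncated_hilbert (1 / real (Suc n)) f x) else no_pv_value)
      \<in> borel_measurable borel" by measurable
  ultimately show ?thesis by (simp cong: measurable_cong)
qed

section \<open>The Hilbert transform of Lipschitz functions\<close>

text \<open>
  The interval \<open>[-1, 2]\<close> leaves room around \<open>[0, 1]\<close> to cut off approximations of a weight that
  lives on \<open>[0, 1]\<close>.
\<close>
definition test_function :: "(real \<Rightarrow> real) \<Rightarrow> bool" where
  "test_function f \<longleftrightarrow> (\<exists>L. L-lipschitz_on UNIV f) \<and> (\<forall>x. x \<notin> {-1..2} \<longrightarrow> f x = 0)"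

lemma test_functionE:
  assumes "test_function f"
  obtains L where "0 \<le> L" "\<And>x y. \<bar>f x - f y\<bar> \<le> L * \<bar>x - y\<bar>"
proof -
  obtain L where "L-lipschitz_on UNIV f" using assms unfolding test_function_def by blast
  then show ?thesis using that[of L] by (auto simp: lipschitz_on_def dist_real_def)
qed

lemma test_function_zero: "test_function f \<Longrightarrow> x \<notin> {-1..2} \<Longrightarrow> f x = 0"
  unfolding test_function_def by blast

lemma test_functionI:
  assumes "\<And>x y. \<bar>f x - f y\<bar> \<le> L * \<bar>x - y\<bar>" "\<And>x. x \<notin> {-1..2} \<Longrightarrow> f x = 0"
  shows "test_function f"
proof -
  have "\<bar>f x - f y\<bar> \<le> \<bar>L\<bar> * \<bar>x - y\<bar>" for x y
    by (rule order_trans[OF assms(1)]) (intro mult_right_mono, auto)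
  then show ?thesis unfolding test_function_def
    using assms(2) by (auto simp: dist_real_def intro!: exI[of _ "\<bar>L\<bar>"] lipschitz_onI)
qed

lemma test_function_bounded:
  assumes "test_function f"
  obtains B where "0 \<le> B" "\<And>x. \<bar>f x\<bar> \<le> B"
proof -
  obtain L where L: "0 \<le> L" "\<And>x y. \<bar>f x - f y\<bar> \<le> L * \<bar>x - y\<bar>" using assms by (rule test_functionE) blast
  have "\<bar>f x\<bar> \<le> L * 4" for x
  proof (cases "x \<in> {-1..2}")
    case True
    have "\<bar>f x - f 3\<bar> \<le> L * \<bar>x - 3\<bar>" by (rule L)
    also have "\<dots> \<le> L * 4" using True L(1) by (intro mult_left_mono) auto
    finally show ?thesis using test_function_zero[OF assms, of 3] by simp
  qed (use test_function_zero[OF assms] L(1) in auto)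
  then show ?thesis using that[of "L * 4"] L(1) by simp
qed

lemma test_function_continuous: "test_function f \<Longrightarrow> continuous_on UNIV f"
  unfolding test_function_def using lipschitz_on_continuous_on by blast

lemma test_function_measurable: "test_function f \<Longrightarrow> f \<in> borel_measurable borel"
  by (intro borel_measurable_continuous_onI test_function_continuous)

lemma test_function_integrable:
  assumes "test_function f"
  shows "integrable lborel f" "integrable lebesgue f"
proof -
  obtain B where B: "0 \<le> B" "\<And>x. \<bar>f x\<bar> \<le> B" using assms by (rule test_function_bounded) blast
  note [measurable] = test_function_measurable[OF assms]
  show *: "integrable lborel f"
    by (rule integrableI_bounded_set[where A = "{-1..2}" and B = B])
       (use B test_function_zero[OF assms] in auto)
  show "integrable lebesgue f" using * by (subst integrable_completion) auto
qed

lemma test_function_mult: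
  assumes f: "test_function f" and G: "C-lipschitz_on {-1..2} G"
  shows "test_function (\<lambda>x. f x * G x)"
proof -
  obtain L where L: "0 \<le> L" "\<And>x y. \<bar>f x - f y\<bar> \<le> L * \<bar>x - y\<bar>" using f by (rule test_functionE) blast
  obtain B where B: "0 \<le> B" "\<And>x. \<bar>f x\<bar> \<le> B" using f by (rule test_function_bounded) blast
  have C: "0 \<le> C" "\<And>x y. x \<in> {-1..2} \<Longrightarrow> y \<in> {-1..2} \<Longrightarrow> \<bar>G x - G y\<bar> \<le> C * \<bar>x - y\<bar>"
    using G by (auto simp: lipschitz_on_def dist_real_def)
  define D where "D = \<bar>G 0\<bar> + C * 2"
  have D: "\<bar>G x\<bar> \<le> D" if "x \<in> {-1..2}" for x
  proof -
    have "\<bar>G x - G 0\<bar> \<le> C * \<bar>x - 0\<bar>" by (rule C) (use that in auto)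
    also have "\<dots> \<le> C * 2" using that C(1) by (intro mult_left_mono) auto
    finally show ?thesis unfolding D_def by linarith
  qed
  have D0: "0 \<le> D" using C(1) by (simp add: D_def)
  show ?thesis
  proof (rule test_functionI)
    fix x y :: real
    have edge: "\<bar>f x * G x - f y * G y\<bar> \<le> (B * C + D * L) * \<bar>x - y\<bar>"
      if "x \<in> {-1..2}" for x y
    proof (cases "y \<in> {-1..2}")
      case True
      have "f x * G x - f y * G y = f x * (G x - G y) + G y * (f x - f y)" by (simp add: algebra_simps)
      then have "\<bar>f x * G x - f y * G y\<bar> \<le> \<bar>f x\<bar> * \<bar>G x - G y\<bar> + \<bar>G y\<bar> * \<bar>f x - f y\<bar>"
        by (metis abs_mult abs_triangle_ineq)
      also have "\<dots> \<le> B * (C * \<bar>x - y\<bar>) + D * (L * \<bar>x - y\<bar>)"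
        using that True B(1) D0 by (intro add_mono mult_mono B(2) C(2) D L(2)) auto
      finally show ?thesis by (simp add: algebra_simps)
    next
      case False
      have "\<bar>f x * G x - f y * G y\<bar> = \<bar>G x\<bar> * \<bar>f x - f y\<bar>"
        using test_function_zero[OF f False] by (simp add: abs_mult)
      also have "\<dots> \<le> D * (L * \<bar>x - y\<bar>)" using D0 that by (intro mult_mono D L(2)) auto
      also have "\<dots> \<le> (B * C + D * L) * \<bar>x - y\<bar>" using B(1) C(1) by (simp add: algebra_simps)
      finally show ?thesis .
    qed
    show "\<bar>f x * G x - f y * G y\<bar> \<le> (B * C + D * L) * \<bar>x - y\<bar>"
    proof (cases "x \<in> {-1..2}")
      case True then show ?thesis by (rule edge)
    next
      case xo: False
      show ?thesis
      proof (cases "y \<in> {-1..2}")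
        case True
        then show ?thesis using edge[OF True, of x] by (simp add: abs_minus_commute)
      next
        case False
        have "0 \<le> B * C + D * L" using B(1) C(1) D0 L(1) by simp
        then show ?thesis using xo False test_function_zero[OF f] by simp
      qed
    qed
  qed (use test_function_zero[OF f] in simp)
qed

text \<open>
  The kernel is odd, so the integral may be averaged with its reflection at \<open>x\<close>. For a Lipschitz
  function the new integrand stays bounded as \<open>t\<close> tends to 0.
\<close>
lemma truncated_hilbert_symmetrised:
  assumes e: "0 < e" and f: "test_function f"
  shows "truncated_hilbert e f x
     = 1 / (2 * pi) * (\<integral>t. indicator {t. e < \<bar>t\<bar>} t * ((f (x - t) - f (x + t)) / t) \<partial>lborel)"
proof -
  note fm [measurable] = test_function_measurable[OF f]
  define \<phi> where "\<phi> = (\<lambda>y. indicator {y. e < \<bar>x - y\<bar>} y * (f y / (x - y)))"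
  have int: "integrable lborel \<phi>"
  proof -
    have "integrable lebesgue \<phi>"
      unfolding \<phi>_def using truncated_hilbert_integrable[OF e test_function_integrable(2)[OF f]] by simp
    then show ?thesis by (subst (asm) integrable_completion) (simp_all add: \<phi>_def)
  qed
  have int1: "integrable lborel (\<lambda>t. \<phi> (x + (-1) * t))" and int2: "integrable lborel (\<lambda>t. \<phi> (x + 1 * t))"
    by (rule lborel_integrable_real_affine[OF int]; simp)+
  have "(\<integral>y. \<phi> y \<partial>lborel) = (\<integral>t. \<phi> (x + (-1) * t) \<partial>lborel)"
    using lborel_integral_real_affine[of "-1" \<phi> x] by simp
  moreover have "(\<integral>y. \<phi> y \<partial>lborel) = (\<integral>t. \<phi> (x + 1 * t) \<partial>lborel)"
    using lborel_integral_real_affine[of 1 \<phi> x] by simp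
  ultimately have "2 * (\<integral>y. \<phi> y \<partial>lborel) = (\<integral>t. \<phi> (x + (-1) * t) + \<phi> (x + 1 * t) \<partial>lborel)"
    using Bochner_Integration.integral_add[OF int1 int2] by simp
  also have "\<dots> = (\<integral>t. indicator {t. e < \<bar>t\<bar>} t * ((f (x - t) - f (x + t)) / t) \<partial>lborel)"
    by (intro Bochner_Integration.integral_cong refl) (auto simp: \<phi>_def indicator_def diff_divide_distrib)
  finally have *: "2 * (\<integral>y. \<phi> y \<partial>lborel) = (\<integral>t. indicator {t. e < \<bar>t\<bar>} t * ((f (x - t) - f (x + t)) / t) \<partial>lborel)" .
  show ?thesis unfolding truncated_hilbert_borel[OF fm] *[symmetric] \<phi>_def by simp
qed

text \<open>
  The symmetrised integrand is dominated by \<open>2 L\<close> for \<open>\<bar>t\<bar> \<le> 1\<close> and by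
  \<open>\<bar>f (x - t)\<bar> + \<bar>f (x + t)\<bar>\<close> elsewhere. The integral of this majorant does not depend on \<open>x\<close>, which makes the
  bound uniform.
\<close>
lemma test_function_pv:
  assumes f: "test_function f"
  obtains B where "0 \<le> B" "\<And>x e. 0 < e \<Longrightarrow> \<bar>truncated_hilbert e f x\<bar> \<le> B" "\<And>x. has_pv f x"
proof -
  note fm [measurable] = test_function_measurable[OF f]
  obtain L where L: "0 \<le> L" "\<And>x y. \<bar>f x - f y\<bar> \<le> L * \<bar>x - y\<bar>" using f by (rule test_functionE) blast
  define N where "N = (\<integral>y. \<bar>f y\<bar> \<partial>lborel)"
  define W where "W = (\<lambda>x t. 2 * L * indicator {-1..1} t + \<bar>f (x + (-1) * t)\<bar> + \<bar>f (x + 1 * t)\<bar>)"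
  have int0: "integrable lborel (\<lambda>y. \<bar>f y\<bar>)" using test_function_integrable(1)[OF f] by auto
  have ints: "integrable lborel (\<lambda>t. \<bar>f (x + (-1) * t)\<bar>)" "integrable lborel (\<lambda>t. \<bar>f (x + 1 * t)\<bar>)" for x
    by (rule lborel_integrable_real_affine[OF int0]; simp)+
  have ints': "(\<integral>t. \<bar>f (x + (-1) * t)\<bar> \<partial>lborel) = N" "(\<integral>t. \<bar>f (x + 1 * t)\<bar> \<partial>lborel) = N" for x
    using lborel_integral_real_affine[of "-1" "\<lambda>y. \<bar>f y\<bar>" x] lborel_integral_real_affine[of 1 "\<lambda>y. \<bar>f y\<bar>" x]
    unfolding N_def by simp_all
  have int_ind: "integrable lborel (\<lambda>t. 2 * L * indicator {-1..1::real} t)"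
    by (intro integrable_mult_right integrable_real_indicator) auto
  have W: "integrable lborel (W x)" for x unfolding W_def
    by (intro Bochner_Integration.integrable_add int_ind ints)
  have intW: "(\<integral>t. W x t \<partial>lborel) = 4 * L + 2 * N" for x
    unfolding W_def using int_ind ints ints' by simp
  have bound: "\<bar>indicator A t * ((f (x - t) - f (x + t)) / t)\<bar> \<le> W x t" for A t x
  proof (cases "t \<in> A \<and> t \<noteq> 0")
    case True
    show ?thesis
    proof (cases "t \<in> {-1..1}")
      case tin: True
      have "\<bar>f (x - t) - f (x + t)\<bar> \<le> L * \<bar>(x - t) - (x + t)\<bar>" by (rule L)
      also have "\<bar>(x - t) - (x + t)\<bar> = 2 * \<bar>t\<bar>" by linarith
      finally have "\<bar>f (x - t) - f (x + t)\<bar> / \<bar>t\<bar> \<le> 2 * L" using True by (simp add: divide_le_eq mult_ac)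
      then show ?thesis using True tin unfolding W_def by simp
    next
      case tout: False
      have "\<bar>f (x - t) - f (x + t)\<bar> / \<bar>t\<bar> \<le> \<bar>f (x - t) - f (x + t)\<bar> / 1"
        using tout by (intro divide_left_mono) auto
      then show ?thesis using True tout L(1) unfolding W_def by simp
    qed
  next
    case False
    then show ?thesis using L(1) unfolding W_def by auto
  qed
  have bounded: "\<bar>truncated_hilbert e f x\<bar> \<le> 1 / (2 * pi) * (4 * L + 2 * N)" if e: "0 < e" for x e
  proof -
    have "\<bar>\<integral>t. indicator {t. e < \<bar>t\<bar>} t * ((f (x - t) - f (x + t)) / t) \<partial>lborel\<bar> \<le> (\<integral>t. W x t \<partial>lborel)"
      by (rule order_trans[OF integral_abs_bound], rule integral_mono_AE')
         (use W bound in \<open>auto intro: order_trans[OF abs_ge_zero bound]\<close>)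
    then show ?thesis unfolding truncated_hilbert_symmetrised[OF e f] intW abs_mult
      by (intro mult_mono) auto
  qed
  have pv: "has_pv f x" for x
  proof -
    have "((\<lambda>e. truncated_hilbert e f x) \<longlongrightarrow> 1 / (2 * pi) * (\<integral>t. (f (x - t) - f (x + t)) / t \<partial>lborel)) (at_right 0)"
    proof (rule tendsto_at_right_sequentially[of 0 1])
      fix S :: "nat \<Rightarrow> real" assume S: "\<And>n. 0 < S n" "S \<longlonglongrightarrow> 0"
      show "(\<lambda>n. truncated_hilbert (S n) f x) \<longlonglongrightarrow> 1 / (2 * pi) * (\<integral>t. (f (x - t) - f (x + t)) / t \<partial>lborel)"
        unfolding truncated_hilbert_symmetrised[OF S(1) f]
      proof (intro tendsto_mult tendsto_const integral_dominated_convergence[where w = "W x"])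
        show "AE t in lborel. (\<lambda>n. indicator {t. S n < \<bar>t\<bar>} t * ((f (x - t) - f (x + t)) / t))
            \<longlonglongrightarrow> (f (x - t) - f (x + t)) / t"
        proof (rule AE_I2)
          fix t
          show "(\<lambda>n. indicator {t. S n < \<bar>t\<bar>} t * ((f (x - t) - f (x + t)) / t)) \<longlonglongrightarrow> (f (x - t) - f (x + t)) / t"
          proof (cases "t = 0")
            case False
            then have "\<forall>\<^sub>F n in sequentially. S n < \<bar>t\<bar>" using S(2) by (intro order_tendstoD) auto
            then have "\<forall>\<^sub>F n in sequentially. (f (x - t) - f (x + t)) / t
               = indicator {t. S n < \<bar>t\<bar>} t * ((f (x - t) - f (x + t)) / t)" by eventually_elim simp
            then show ?thesis by (rule Lim_transform_eventually[OF tendsto_const])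
          qed simp
        qed
        show "AE t in lborel. norm (indicator {t. S n < \<bar>t\<bar>} t * ((f (x - t) - f (x + t)) / t)) \<le> W x t" for n
          using bound by auto
      qed (use W in auto)
    qed auto
    then show ?thesis unfolding has_pv_def by blast
  qed
  show ?thesis
  proof (rule that[OF _ bounded pv])
    have "0 \<le> N" unfolding N_def by (rule integral_nonneg_AE) auto
    then show "0 \<le> 1 / (2 * pi) * (4 * L + 2 * N)" using L(1) by simp
  qed
qed

lemma test_function_hilbert_bounded:
  assumes "test_function f"
  obtains B where "0 \<le> B" "\<And>x. \<bar>hilbert f x\<bar> \<le> B"
proof -
  obtain B where B: "0 \<le> B" "\<And>x e. 0 < e \<Longrightarrow> \<bar>truncated_hilbert e f x\<bar> \<le> B" "\<And>x. has_pv f x"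
    using assms by (rule test_function_pv) blast
  have "\<bar>hilbert f x\<bar> \<le> B" for x
  proof (rule tendsto_le[OF _ tendsto_const tendsto_rabs[OF tendsto_hilbert[OF B(3)]]])
    show "\<forall>\<^sub>F e in at_right 0. \<bar>truncated_hilbert e f x\<bar> \<le> B"
      using eventually_at_right_less[of "0::real"] by eventually_elim (rule B(2))
  qed simp
  then show ?thesis using that B(1) by blast
qed

text \<open>
  Truncated kernels are bounded and odd, so Fubini applies. The truncations are then removed by dominated
  convergence, using their uniform bound.
\<close>
lemma hilbert_antisymmetric:
  assumes h: "test_function h" and v: "test_function v"
  shows "(\<integral>x. h x * hilbert v x \<partial>lborel) = - (\<integral>x. v x * hilbert h x \<partial>lborel)"
proof -
  note hm [measurable] = test_function_measurable[OF h] and vm [measurable] = test_function_measurable[OF v]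
  have lim: "(\<lambda>n. \<integral>x. f x * truncated_hilbert (1 / real (Suc n)) g x \<partial>lborel) \<longlonglongrightarrow> (\<integral>x. f x * hilbert g x \<partial>lborel)"
    if f: "test_function f" and g: "test_function g" for f g
  proof -
    obtain B where B: "0 \<le> B" "\<And>x e. 0 < e \<Longrightarrow> \<bar>truncated_hilbert e g x\<bar> \<le> B" "\<And>x. has_pv g x"
      using g by (rule test_function_pv) blast
    note [measurable] = test_function_measurable[OF f] borel_measurable_hilbert[OF test_function_integrable(2)[OF g]]
      truncated_hilbert_measurable_borel[OF test_function_measurable[OF g]]
    have seq: "filterlim (\<lambda>n. 1 / real (Suc n)) (at_right 0) sequentially"
      unfolding filterlim_at using LIMSEQ_Suc[OF lim_1_over_n[where 'a = real]] by (auto simp del: of_nat_Suc)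
    show ?thesis
    proof (rule integral_dominated_convergence[where w = "\<lambda>x. \<bar>f x\<bar> * B"])
      show "integrable lborel (\<lambda>x. \<bar>f x\<bar> * B)" using test_function_integrable(1)[OF f] by auto
      show "AE x in lborel. (\<lambda>n. f x * truncated_hilbert (1 / real (Suc n)) g x) \<longlonglongrightarrow> f x * hilbert g x"
        by (intro AE_I2 tendsto_mult tendsto_const filterlim_compose[OF tendsto_hilbert[OF B(3)] seq])
      show "AE x in lborel. norm (f x * truncated_hilbert (1 / real (Suc n)) g x) \<le> \<bar>f x\<bar> * B" for n
        unfolding real_norm_def abs_mult by (intro AE_I2 mult_left_mono B(2)) auto
    qed measurable
  qed
  have swap: "(\<integral>x. h x * truncated_hilbert e v x \<partial>lborel) = - (\<integral>x. v x * truncated_hilbert e h x \<partial>lborel)"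
    if e: "0 < e" for e
  proof -
    define K where "K = (\<lambda>x y. indicator {z. e < \<bar>x - z\<bar>} y * (h x * v y / (x - y)))"
    obtain C where C: "0 \<le> C" "\<And>x. \<bar>h x\<bar> \<le> C" using h by (rule test_function_bounded) blast
    obtain D where D: "0 \<le> D" "\<And>x. \<bar>v x\<bar> \<le> D" using v by (rule test_function_bounded) blast
    have intK: "integrable (lborel \<Otimes>\<^sub>M lborel) (case_prod K)"
    proof (rule integrableI_bounded_set[where A = "{-1..2} \<times> {-1..2}" and B = "C * D / e"])
      show "case_prod K \<in> borel_measurable (lborel \<Otimes>\<^sub>M lborel)" unfolding K_def by measurable
      show "emeasure (lborel \<Otimes>\<^sub>M lborel) ({-1..2::real} \<times> {-1..2::real}) < \<infinity>"
        by (subst lborel.emeasure_pair_measure_Times) (auto simp: ennreal_mult_less_top)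
      show "AE z in lborel \<Otimes>\<^sub>M lborel. z \<in> {-1..2} \<times> {-1..2} \<longrightarrow> norm (case_prod K z) \<le> C * D / e"
      proof (rule AE_I2, rule impI)
        fix z :: "real \<times> real"
        obtain x y where z: "z = (x, y)" by (cases z)
        show "norm (case_prod K z) \<le> C * D / e"
        proof (cases "e < \<bar>x - y\<bar>")
          case True
          have "\<bar>h x\<bar> * \<bar>v y\<bar> / \<bar>x - y\<bar> \<le> C * D / e"
            using True e C D by (intro frac_le mult_mono) auto
          then show ?thesis using True by (simp add: z K_def abs_mult)
        qed (use C D e in \<open>simp add: z K_def\<close>)
      qed
      show "AE z in lborel \<Otimes>\<^sub>M lborel. z \<notin> {-1..2} \<times> {-1..2} \<longrightarrow> case_prod K z = 0"
      proof (rule AE_I2, rule impI)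
        fix z :: "real \<times> real"
        assume "z \<notin> {-1..2} \<times> {-1..2}"
        then have "h (fst z) = 0 \<or> v (snd z) = 0"
          using test_function_zero[OF h, of "fst z"] test_function_zero[OF v, of "snd z"]
          unfolding mem_Times_iff by blast
        then show "case_prod K z = 0" by (auto simp: K_def split_beta)
      qed
    qed measurable
    have "(\<integral>x. h x * truncated_hilbert e v x \<partial>lborel) = (\<integral>x. 1 / pi * (\<integral>y. K x y \<partial>lborel) \<partial>lborel)"
    proof (rule Bochner_Integration.integral_cong[OF refl])
      fix x
      have "(\<integral>y. K x y \<partial>lborel) = (\<integral>y. h x * (indicator {z. e < \<bar>x - z\<bar>} y * (v y / (x - y))) \<partial>lborel)"
        unfolding K_def by (intro Bochner_Integration.integral_cong) auto
      then show "h x * truncated_hilbert e v x = 1 / pi * (\<integral>y. K x y \<partial>lborel)"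
        unfolding truncated_hilbert_borel[OF vm] integral_mult_right_zero by (simp only: mult.left_commute)
    qed
    also have "\<dots> = 1 / pi * (\<integral>x. (\<integral>y. K x y \<partial>lborel) \<partial>lborel)" by simp
    also have "(\<integral>x. (\<integral>y. K x y \<partial>lborel) \<partial>lborel) = (\<integral>y. (\<integral>x. K x y \<partial>lborel) \<partial>lborel)"
      by (rule lborel_pair.Fubini_integral[OF intK, symmetric])
    also have "1 / pi * (\<integral>y. (\<integral>x. K x y \<partial>lborel) \<partial>lborel) = (\<integral>y. - (v y * truncated_hilbert e h y) \<partial>lborel)"
    proof -
      have "1 / pi * (\<integral>x. K x y \<partial>lborel) = - (v y * truncated_hilbert e h y)" for y
      proof -
        have "(\<integral>x. K x y \<partial>lborel) = (\<integral>x. (- v y) * (indicator {z. e < \<bar>y - z\<bar>} x * (h x / (y - x))) \<partial>lborel)"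
          unfolding K_def by (intro Bochner_Integration.integral_cong refl)
            (auto simp: indicator_def abs_minus_commute divide_simps, simp add: algebra_simps)
        then show ?thesis unfolding truncated_hilbert_borel[OF hm] integral_mult_right_zero
          by (simp only: mult.left_commute mult_minus_left mult_minus_right)
      qed
      then show ?thesis by (simp only: integral_mult_right_zero[symmetric])
    qed
    finally show ?thesis by simp
  qed
  have "(\<lambda>n. \<integral>x. h x * truncated_hilbert (1 / real (Suc n)) v x \<partial>lborel) \<longlonglongrightarrow> - (\<integral>x. v x * hilbert h x \<partial>lborel)"
    using tendsto_minus[OF lim[OF v h]] by (simp add: swap)
  with lim[OF h v] show ?thesis by (rule LIMSEQ_unique)
qed

section \<open>Approximation by Lipschitz functions and regularity of maximal functions\<close>

text \<open>
  A measurable function is an almost everywhere limit of continuous functions. These are uniformly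
  close to polynomials on \<open>[-1, 2]\<close>, and clamping the polynomials to \<open>[-B, B]\<close> preserves both the
  Lipschitz property and the limit.
\<close>
lemma bounded_lipschitz_approximation:
  fixes u :: "real \<Rightarrow> real"
  assumes u: "u \<in> borel_measurable lebesgue" and B: "\<And>x. \<bar>u x\<bar> \<le> B"
  obtains q C where "\<And>n::nat. (C n)-lipschitz_on {-1..2} (q n)" "\<And>n x. \<bar>q n x\<bar> \<le> B"
    "AE x in lborel. x \<in> {-1..2} \<longrightarrow> (\<lambda>n. q n x) \<longlonglongrightarrow> u x"
proof -
  have "u measurable_on UNIV" by (rule lebesgue_measurable_imp_measurable_on) (use u in auto)
  then obtain N g where Ng: "negligible N \<and> (\<forall>n. continuous_on UNIV (g n))
      \<and> (\<forall>x. x \<notin> N \<longrightarrow> (\<lambda>n. g n x) \<longlonglongrightarrow> (if x \<in> UNIV then u x else 0))"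
    unfolding measurable_on_def by blast
  then have N: "negligible N" and g: "\<And>n. continuous_on UNIV (g n)"
    and lim: "\<And>x. x \<notin> N \<Longrightarrow> (\<lambda>n. g n x) \<longlonglongrightarrow> u x" by simp_all
  have "\<exists>p. real_polynomial_function p \<and> (\<forall>x\<in>{-1..2}. \<bar>g n x - p x\<bar> < 1 / real (Suc n))" for n
  proof -
    have "compact {-1..2::real}" "continuous_on {-1..2} (g n)" "0 < 1 / real (Suc n)"
      using continuous_on_subset[OF g[of n]] by simp_all
    then obtain p where "real_polynomial_function p" "\<And>x. x \<in> {-1..2} \<Longrightarrow> \<bar>g n x - p x\<bar> < 1 / real (Suc n)"
      by (rule Stone_Weierstrass_real_polynomial_function) blast
    then show ?thesis by blast
  qed
  then obtain p where p: "\<And>n. real_polynomial_function (p n)"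
    "\<And>n x. x \<in> {-1..2} \<Longrightarrow> \<bar>g n x - p n x\<bar> < 1 / real (Suc n)" by metis
  define q where "q = (\<lambda>n x. max (- B) (min B (p n x)))"
  have B0: "0 \<le> B" using B[of 0] by linarith
  have "\<exists>C. C-lipschitz_on {-1..2} (q n)" for n
  proof -
    obtain p' where p': "real_polynomial_function p'" "\<And>x. (p n has_real_derivative p' x) (at x)"
      using has_real_derivative_polynomial_function[OF p(1)] by blast
    have "continuous_on {-1..2} p'" using p'(1) by (intro continuous_on_polymonial_function) (simp add: real_polynomial_function_eq)
    then have "bounded (p' ` {-1..2})" by (intro compact_imp_bounded compact_continuous_image) auto
    then obtain C where "\<forall>z\<in>p' ` {-1..2}. norm z \<le> C" unfolding bounded_iff by blast
    then have C: "\<bar>p' x\<bar> \<le> C" if "x \<in> {-1..2}" for x using that by auto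
    have C0: "0 \<le> C" using C[of 0] by auto
    have lip: "C-lipschitz_on {-1..2} (p n)"
    proof (rule bounded_derivative_imp_lipschitz)
      show "(p n has_derivative (*) (p' x)) (at x within {-1..2})" for x
        using p'(2)[of x] unfolding has_field_derivative_def by (rule has_derivative_at_withinI)
      show "onorm ((*) (p' x)) \<le> C" if "x \<in> {-1..2}" for x
        using C[OF that] by (intro onorm_bound C0) (auto simp: abs_mult intro: mult_right_mono)
    qed (use C0 in auto)
    have "C-lipschitz_on {-1..2} (q n)"
    proof (rule lipschitz_onI)
      fix x y :: real assume "x \<in> {-1..2}" "y \<in> {-1..2}"
      then have "\<bar>p n x - p n y\<bar> \<le> C * dist x y" using lipschitz_onD[OF lip] by (simp add: dist_real_def)
      moreover have "\<bar>q n x - q n y\<bar> \<le> \<bar>p n x - p n y\<bar>" unfolding q_def by linarith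
      ultimately show "dist (q n x) (q n y) \<le> C * dist x y" by (simp add: dist_real_def)
    qed (rule C0)
    then show ?thesis by blast
  qed
  then obtain C where "\<And>n. (C n)-lipschitz_on {-1..2} (q n)" by metis
  moreover have "\<bar>q n x\<bar> \<le> B" for n x unfolding q_def using B0 by linarith
  moreover have "AE x in lborel. x \<in> {-1..2} \<longrightarrow> (\<lambda>n. q n x) \<longlonglongrightarrow> u x"
  proof -
    have "AE x in lebesgue. x \<notin> N" using N unfolding negligible_iff_null_sets by (rule AE_not_in)
    then have "AE x in lborel. x \<notin> N" by (simp add: AE_completion_iff)
    then show ?thesis
    proof eventually_elim
      case (elim x)
      show ?case
      proof
        assume x: "x \<in> {-1..2}"
        have "(\<lambda>n. g n x - p n x) \<longlonglongrightarrow> 0"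
          by (rule Lim_null_comparison[OF _ LIMSEQ_Suc[OF lim_1_over_n]])
             (use p(2)[OF x] in \<open>auto intro!: always_eventually less_imp_le simp del: of_nat_Suc\<close>)
        from tendsto_diff[OF lim[OF elim] this] have "(\<lambda>n. p n x) \<longlonglongrightarrow> u x" by simp
        then have "(\<lambda>n. q n x) \<longlonglongrightarrow> max (- B) (min B (u x))" unfolding q_def by (intro tendsto_intros)
        moreover have "max (- B) (min B (u x)) = u x" using B[of x] by linarith
        ultimately show "(\<lambda>n. q n x) \<longlonglongrightarrow> u x" by simp
      qed
    qed
  qed
  ultimately show ?thesis by (rule that)
qed

lemma powr_Lipschitz_bounded:
  fixes a b :: real
  assumes \<alpha>: "1 \<le> \<alpha>" and ab: "0 \<le> a" "a \<le> B" "0 \<le> b" "b \<le> B"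
  shows "\<bar>a powr \<alpha> - b powr \<alpha>\<bar> \<le> \<alpha> * B powr (\<alpha> - 1) * \<bar>a - b\<bar>"
proof -
  have *: "\<bar>b powr \<alpha> - a powr \<alpha>\<bar> \<le> \<alpha> * B powr (\<alpha> - 1) * (b - a)" if ab: "0 \<le> a" "a < b" "b \<le> B" for a b
  proof -
    obtain z where z: "a < z" "z < b" "b powr \<alpha> - a powr \<alpha> = \<alpha> * z powr (\<alpha> - 1) * (b - a)"
    proof (rule mvt[OF ab(2), of "\<lambda>x. x powr \<alpha>" "\<lambda>z. (*) (\<alpha> * z powr (\<alpha> - 1))"])
      show "continuous_on {a..b} (\<lambda>x. x powr \<alpha>)" using ab \<alpha> by (intro continuous_on_powr') (auto intro: continuous_intros)
      show "((\<lambda>x. x powr \<alpha>) has_derivative (*) (\<alpha> * x powr (\<alpha> - 1))) (at x)" if "a < x" for x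
        unfolding has_field_derivative_def[symmetric]
        using has_real_derivative_powr[of x \<alpha>] that ab by simp
    qed blast
    have "z powr (\<alpha> - 1) \<le> B powr (\<alpha> - 1)" using z ab \<alpha> by (intro powr_mono2) auto
    then show ?thesis unfolding z(3) abs_mult using ab \<alpha> by (auto intro!: mult_right_mono mult_left_mono)
  qed
  show ?thesis
    using *[of a b] *[of b a] ab by (cases a b rule: linorder_cases) (auto simp: abs_minus_commute)
qed

lemma powr_neg_Lipschitz:
  fixes a b :: real
  assumes s: "0 < s" and ab: "0 < m" "m \<le> a" "m \<le> b"
  shows "\<bar>a powr (- s) - b powr (- s)\<bar> \<le> s * m powr (- s - 1) * \<bar>a - b\<bar>"
proof -
  have *: "\<bar>b powr (- s) - a powr (- s)\<bar> \<le> s * m powr (- s - 1) * (b - a)" if ab: "m \<le> a" "a < b" for a b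
  proof -
    have "((\<lambda>x. x powr (- s)) has_real_derivative (- s * z powr (- s - 1))) (at z)" if "a \<le> z" for z
      using has_real_derivative_powr[of z "- s"] that ab \<open>0 < m\<close> by simp
    then have "\<exists>z. a < z \<and> z < b \<and> b powr (- s) - a powr (- s) = (b - a) * (- s * z powr (- s - 1))"
      by (intro MVT2 ab(2))
    then obtain z where z: "a < z" "z < b" "b powr (- s) - a powr (- s) = (b - a) * (- s * z powr (- s - 1))"
      by blast
    have "z powr (- s - 1) \<le> m powr (- s - 1)" using z ab \<open>0 < m\<close> s by (intro powr_mono2') auto
    then show ?thesis unfolding z(3) abs_mult using ab s by (auto simp: mult_ac intro!: mult_right_mono mult_left_mono)
  qed
  show ?thesis
    using *[of a b] *[of b a] ab by (cases a b rule: linorder_cases) (auto simp: abs_minus_commute)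
qed

lemma test_function_powr:
  assumes v: "test_function v" "\<And>x. 0 \<le> v x" and \<alpha>: "1 \<le> \<alpha>"
  shows "test_function (\<lambda>x. v x powr \<alpha>)"
proof -
  obtain B where B: "0 \<le> B" "\<And>x. \<bar>v x\<bar> \<le> B" using v(1) by (rule test_function_bounded) blast
  obtain L where L: "0 \<le> L" "\<And>x y. \<bar>v x - v y\<bar> \<le> L * \<bar>x - y\<bar>" using v(1) by (rule test_functionE) blast
  show ?thesis
  proof (rule test_functionI)
    fix x y
    have "\<bar>v x powr \<alpha> - v y powr \<alpha>\<bar> \<le> \<alpha> * B powr (\<alpha> - 1) * \<bar>v x - v y\<bar>"
      using B(2)[of x] B(2)[of y] v(2) by (intro powr_Lipschitz_bounded \<alpha>) auto
    also have "\<dots> \<le> \<alpha> * B powr (\<alpha> - 1) * (L * \<bar>x - y\<bar>)" using \<alpha> by (intro mult_left_mono L) auto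
    finally show "\<bar>v x powr \<alpha> - v y powr \<alpha>\<bar> \<le> \<alpha> * B powr (\<alpha> - 1) * L * \<bar>x - y\<bar>" by (simp add: mult.assoc)
  qed (use test_function_zero[OF v(1)] in auto)
qed

lemma test_function_interval_maximal_Lipschitz:
  assumes F: "test_function F" "\<And>x. 0 \<le> F x"
  obtains S L where "\<And>x. interval_maximal (\<lambda>y. ennreal (F y)) x = ennreal (S x)"
    "\<And>x. 0 \<le> S x" "0 \<le> L" "\<And>x y. \<bar>S x - S y\<bar> \<le> L * \<bar>x - y\<bar>"
proof -
  obtain B where B: "0 \<le> B" "\<And>x. \<bar>F x\<bar> \<le> B" using F(1) by (rule test_function_bounded) blast
  obtain L where L: "0 \<le> L" "\<And>x y. \<bar>F x - F y\<bar> \<le> L * \<bar>x - y\<bar>" using F(1) by (rule test_functionE) blast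
  let ?I = "interval_maximal (\<lambda>y. ennreal (F y))"
  define S where "S = (\<lambda>x. enn2real (?I x))"
  have "?I x \<le> ennreal B" for x
    by (rule interval_maximal_le_bound) (use B(2) in \<open>auto intro!: ennreal_leI intro: order_trans[OF abs_ge_self]\<close>)
  then have S: "?I x = ennreal (S x)" for x
    unfolding S_def by (metis ennreal_enn2real ennreal_less_top le_less_trans)
  have S0: "0 \<le> S x" for x by (simp add: S_def)
  have SL: "\<bar>S x - S y\<bar> \<le> L * \<bar>x - y\<bar>" for x y
  proof -
    have "S x \<le> S y + L * \<bar>x - y\<bar>" for x y
    proof -
      have "ennreal (S x) \<le> ennreal (S y) + ennreal (L * \<bar>x - y\<bar>)"
        unfolding S[symmetric] by (rule interval_maximal_Lipschitz[OF test_function_measurable[OF F(1)] L(2)])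
      also have "\<dots> = ennreal (S y + L * \<bar>x - y\<bar>)" using S0 L(1) by (simp add: ennreal_plus)
      finally show ?thesis using S0 L(1) by (subst (asm) ennreal_le_iff) auto
    qed
    from this[of x y] this[of y x] show ?thesis by (simp add: abs_minus_commute abs_le_iff)
  qed
  then show ?thesis using that S S0 L(1) by blast
qed

text \<open>
  On \<open>[-1, 2]\<close> the average of \<open>F\<close> over \<open>[-1, 2]\<close> bounds \<open>S\<close> away from 0, and there negative powers are
  Lipschitz. This keeps the dual function \<open>h\<close> of the duality argument a test function.
\<close>
lemma test_function_interval_maximal:
  assumes F: "test_function F" "\<And>x. 0 \<le> F x" and pos: "(\<integral>x. F x \<partial>lborel) > 0"
  obtains S m where "\<And>x. interval_maximal (\<lambda>y. ennreal (F y)) x = ennreal (S x)" "0 < m"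
    "\<And>x. x \<in> {-1..2} \<Longrightarrow> m \<le> S x" "\<And>x. 0 \<le> S x"
    "\<And>s. 0 < s \<Longrightarrow> \<exists>C. C-lipschitz_on {-1..2} (\<lambda>x. S x powr (- s))"
proof -
  obtain S L where S: "\<And>x. interval_maximal (\<lambda>y. ennreal (F y)) x = ennreal (S x)"
    and S0: "\<And>x. 0 \<le> S x" and L: "0 \<le> L" and SL: "\<And>x y. \<bar>S x - S y\<bar> \<le> L * \<bar>x - y\<bar>"
    using F by (rule test_function_interval_maximal_Lipschitz) blast
  let ?I = "interval_maximal (\<lambda>y. ennreal (F y))"
  define m where "m = (\<integral>x. F x \<partial>lborel) / 3"
  have m: "0 < m" using pos by (simp add: m_def)
  have mS: "m \<le> S x" if x: "x \<in> {-1..2}" for x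
  proof -
    have "(\<integral>\<^sup>+y\<in>{-1..2}. ennreal (F y) \<partial>lebesgue) / ennreal (2 - (-1)) \<le> ?I x"
      by (rule interval_maximal_ge_average) (use x in auto)
    moreover have "(\<integral>\<^sup>+y\<in>{-1..2}. ennreal (F y) \<partial>lebesgue) = (\<integral>\<^sup>+y. ennreal (F y) \<partial>lborel)"
      unfolding nn_integral_completion using test_function_zero[OF F(1)]
      by (intro nn_integral_cong) (auto simp: indicator_def)
    moreover have "\<dots> = ennreal (\<integral>x. F x \<partial>lborel)"
      using F(2) by (intro nn_integral_eq_integral test_function_integrable F) auto
    ultimately have "ennreal (\<integral>x. F x \<partial>lborel) / ennreal 3 \<le> ennreal (S x)" by (simp add: S)
    moreover have "ennreal (\<integral>x. F x \<partial>lborel) / ennreal 3 = ennreal m"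
      unfolding m_def using pos by (intro divide_ennreal) auto
    ultimately have "ennreal m \<le> ennreal (S x)" by simp
    then show ?thesis using S0 by simp
  qed
  have "\<exists>C. C-lipschitz_on {-1..2} (\<lambda>x. S x powr (- s))" if s: "0 < s" for s
  proof (intro exI lipschitz_onI)
    fix x y :: real assume x: "x \<in> {-1..2}" and y: "y \<in> {-1..2}"
    have "\<bar>S x powr (- s) - S y powr (- s)\<bar> \<le> s * m powr (- s - 1) * \<bar>S x - S y\<bar>"
      by (intro powr_neg_Lipschitz s m mS x y)
    also have "\<dots> \<le> s * m powr (- s - 1) * (L * \<bar>x - y\<bar>)" using s by (intro mult_left_mono SL) auto
    finally show "dist (S x powr (- s)) (S y powr (- s)) \<le> (s * m powr (- s - 1) * L) * dist x y"
      by (simp add: dist_real_def mult.assoc)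
  qed (use s L in simp)
  then show ?thesis using that S m mS S0 by blast
qed

section \<open>Level sets of the Hilbert transform\<close>

text \<open>
  The weak type inequality assumed in the theorem, for a single exponent. Separating the exponents
  allows \<open>4/3\<close> and \<open>r\<close> to enter with constants from different sources.
\<close>
definition weak_type_bound :: "real \<Rightarrow> real \<Rightarrow> bool" where
  "weak_type_bound r A \<longleftrightarrow> (\<forall>w f. weight w \<and> f \<in> L1_space (maximal r w) \<longrightarrow>
     weak_L1_norm (\<lambda>x. ennreal (w x)) (hilbert f) \<le> ennreal A * L1_norm (maximal r w) f)"

lemma weak_type_boundD:
  assumes "weak_type_bound r A" "weight w" "f \<in> borel_measurable lebesgue" "0 < t"
    and fin: "(\<integral>\<^sup>+x. ennreal \<bar>f x\<bar> * maximal r w x \<partial>lborel) < \<infinity>"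
  shows "ennreal t * (\<integral>\<^sup>+x\<in>{x. t < \<bar>hilbert f x\<bar>}. ennreal (w x) \<partial>lborel)
     \<le> ennreal A * (\<integral>\<^sup>+x. ennreal \<bar>f x\<bar> * maximal r w x \<partial>lborel)"
proof -
  have "f \<in> L1_space (maximal r w)"
    using assms unfolding L1_space_def L1_norm_def nn_integral_completion by simp
  then have "weak_L1_norm (\<lambda>x. ennreal (w x)) (hilbert f) \<le> ennreal A * L1_norm (maximal r w) f"
    using assms(1,2) unfolding weak_type_bound_def by blast
  moreover have "ennreal t * (\<integral>\<^sup>+x\<in>{x. t < \<bar>hilbert f x\<bar>}. ennreal (w x) \<partial>lebesgue)
      \<le> weak_L1_norm (\<lambda>x. ennreal (w x)) (hilbert f)"
    unfolding weak_L1_norm_def by (rule SUP_upper) (use assms(4) in simp)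
  ultimately show ?thesis unfolding L1_norm_def nn_integral_completion by (rule order_trans[rotated])
qed

lemma maximal_le_bound:
  assumes s: "0 < s" and B: "\<And>y. \<bar>f y\<bar> \<le> B" shows "maximal s f x \<le> ennreal B"
proof -
  have B0: "0 \<le> B" using B[of 0] by linarith
  have "interval_maximal (\<lambda>y. ennreal (\<bar>f y\<bar> powr s)) x \<le> ennreal (B powr s)"
    using s by (intro interval_maximal_le_bound ennreal_leI powr_mono2 B) auto
  also have "ennreal (B powr s) = ennpowr (ennreal B) s" using B0 by (simp add: ennpowr_ennreal)
  finally show ?thesis using s ennpowr_le_iff[of "1 / s"] unfolding maximal_eq[OF s] by simp
qed

text \<open>
  Writing \<open>v\<^sup>r = v\<^sup>\<alpha> * v powr (r - \<alpha>)\<close>, the average of \<open>(v 1\<^sub>E)\<^sup>r\<close> over an interval \<open>I\<close> is the average of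
  \<open>v\<^sup>\<alpha>\<close> over \<open>I\<close> times the average of \<open>v powr (r - \<alpha>) 1\<^sub>E\<close> over \<open>I\<close> with respect to \<open>v\<^sup>\<alpha> dx\<close>.
\<close>
lemma maximal_indicator_le:
  fixes v :: "real \<Rightarrow> real" and E :: "real set"
  assumes v: "test_function v" "\<And>x. 0 \<le> v x" and \<alpha>: "1 \<le> \<alpha>" and r: "0 < r" and [measurable]: "E \<in> sets borel"
  shows "maximal r (\<lambda>x. v x * indicator E x) x
     \<le> ennpowr (interval_maximal (\<lambda>y. ennreal (v y powr \<alpha>)) x *
         rational_maximal (density lborel (\<lambda>y. ennreal (v y powr \<alpha>)))
           (\<lambda>y. ennreal (v y powr (r - \<alpha>) * indicator E y)) x) (1 / r)"
proof -
  note [measurable] = test_function_measurable[OF v(1)]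
  define \<mu> where "\<mu> = density lborel (\<lambda>y. ennreal (v y powr \<alpha>))"
  let ?g = "\<lambda>y. ennreal (v y powr (r - \<alpha>) * indicator E y)"
  let ?N = "rational_maximal \<mu> ?g x"
  have fin: "emeasure \<mu> {a<..<b} < \<infinity>" for a b
  proof -
    have "emeasure \<mu> {a<..<b} \<le> (\<integral>\<^sup>+y. ennreal (v y powr \<alpha>) \<partial>lborel)"
      unfolding \<mu>_def by (subst emeasure_density) (auto intro!: nn_integral_mono simp: indicator_def)
    also have "\<dots> = ennreal (\<integral>y. v y powr \<alpha> \<partial>lborel)"
      by (intro nn_integral_eq_integral test_function_integrable test_function_powr v \<alpha>) auto
    finally show ?thesis by (rule le_less_trans) simp
  qed
  have atomless: "emeasure \<mu> {c} = 0" for c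
  proof -
    have "absolutely_continuous lborel \<mu>" unfolding \<mu>_def by (rule absolutely_continuousI_density) simp
    moreover have "{c} \<in> null_sets lborel" by (rule finite_imp_null_set_lborel) simp
    ultimately show ?thesis unfolding absolutely_continuous_def by blast
  qed
  have "interval_maximal (\<lambda>y. ennreal (\<bar>v y * indicator E y\<bar> powr r)) x
     \<le> interval_maximal (\<lambda>y. ennreal (v y powr \<alpha>)) x * ?N"
    unfolding interval_maximal_def
  proof (rule SUP_least)
    fix I assume I: "I \<in> intervals_at x"
    have [measurable]: "I \<in> sets borel" using I by (rule intervals_at_sets)
    have "(\<integral>\<^sup>+y\<in>I. ennreal (\<bar>v y * indicator E y\<bar> powr r) \<partial>lborel) = (\<integral>\<^sup>+y\<in>I. ?g y \<partial>\<mu>)"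
      unfolding \<mu>_def
    proof (subst nn_integral_density, measurable, rule nn_integral_cong)
      fix y
      have "v y powr \<alpha> * v y powr (r - \<alpha>) = v y powr r" by (simp flip: powr_add)
      then show "ennreal (\<bar>v y * indicator E y\<bar> powr r) * indicator I y = ennreal (v y powr \<alpha>) * (?g y * indicator I y)"
        using v(2)[of y] by (auto simp: indicator_def simp flip: ennreal_mult)
    qed
    also have "\<dots> \<le> ?N * emeasure \<mu> I"
      by (rule interval_integral_le_rational_maximal[OF _ _ fin atomless I]) (auto simp: \<mu>_def)
    also have "emeasure \<mu> I = (\<integral>\<^sup>+y\<in>I. ennreal (v y powr \<alpha>) \<partial>lborel)"
      unfolding \<mu>_def by (subst emeasure_density) auto
    finally have "(\<integral>\<^sup>+y\<in>I. ennreal (\<bar>v y * indicator E y\<bar> powr r) \<partial>lborel) / emeasure lebesgue I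
        \<le> (?N * (\<integral>\<^sup>+y\<in>I. ennreal (v y powr \<alpha>) \<partial>lborel)) / emeasure lebesgue I"
      by (rule divide_right_mono_ennreal)
    also have "\<dots> = ?N * ((\<integral>\<^sup>+y\<in>I. ennreal (v y powr \<alpha>) \<partial>lborel) / emeasure lebesgue I)"
      by (simp add: ennreal_times_divide)
    also have "\<dots> \<le> ?N * (SUP I\<in>intervals_at x. (\<integral>\<^sup>+y\<in>I. ennreal (v y powr \<alpha>) \<partial>lebesgue) / emeasure lebesgue I)"
      unfolding nn_integral_completion by (intro mult_left_mono SUP_upper I) simp
    finally show "(\<integral>\<^sup>+y\<in>I. ennreal (\<bar>v y * indicator E y\<bar> powr r) \<partial>lebesgue) / emeasure lebesgue I
      \<le> (SUP I\<in>intervals_at x. (\<integral>\<^sup>+y\<in>I. ennreal (v y powr \<alpha>) \<partial>lebesgue) / emeasure lebesgue I) * ?N"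
      by (simp add: nn_integral_completion mult.commute)
  qed
  then show ?thesis unfolding maximal_eq[OF r] \<mu>_def[symmetric] using r by (intro ennpowr_mono) auto
qed

text \<open>
  Kolmogorov's inequality: in the integral over the levels, use the total mass up to height \<open>t\<close> and the
  decay \<open>K / s\<^sup>2\<close> above it.
\<close>
lemma nn_integral_le_of_quadratic_decay:
  fixes \<phi> :: "real \<Rightarrow> real"
  assumes "sigma_finite_measure \<mu>" and [measurable]: "\<phi> \<in> borel_measurable \<mu>"
    and total: "emeasure \<mu> (space \<mu>) \<le> ennreal V" and t: "0 < t" and V: "0 \<le> V" "0 \<le> K"
    and decay: "\<And>s. 0 < s \<Longrightarrow> emeasure \<mu> {x \<in> space \<mu>. s < \<phi> x} \<le> ennreal (K / s\<^sup>2)"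
  shows "(\<integral>\<^sup>+x. ennreal (\<phi> x) \<partial>\<mu>) \<le> ennreal (t * V + K / t)"
proof -
  have "(\<integral>\<^sup>+x. ennreal (\<phi> x) \<partial>\<mu>)
      = (\<integral>\<^sup>+s\<in>{0<..}. emeasure \<mu> {x \<in> space \<mu>. ennreal s < ennreal (\<phi> x)} \<partial>lborel)"
    by (rule nn_integral_layer_cake[OF assms(1)]) measurable
  also have "\<dots> \<le> (\<integral>\<^sup>+s. ennreal V * indicator {0..t} s + ennreal (K / s\<^sup>2) * indicator {t..} s \<partial>lborel)"
  proof (rule nn_integral_mono)
    fix s :: real
    show "emeasure \<mu> {x \<in> space \<mu>. ennreal s < ennreal (\<phi> x)} * indicator {0<..} s
        \<le> ennreal V * indicator {0..t} s + ennreal (K / s\<^sup>2) * indicator {t..} s"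
    proof (cases "0 < s")
      case True
      then have eq: "{x \<in> space \<mu>. ennreal s < ennreal (\<phi> x)} = {x \<in> space \<mu>. s < \<phi> x}"
        by (auto simp: ennreal_less_iff)
      show ?thesis
      proof (cases "s \<le> t")
        case le: True
        have "emeasure \<mu> {x \<in> space \<mu>. s < \<phi> x} \<le> emeasure \<mu> (space \<mu>)" by (intro emeasure_mono) auto
        then show ?thesis using total True le unfolding eq by (auto intro: order_trans add_increasing2)
      next
        case False
        then show ?thesis using decay[OF True] True unfolding eq by simp
      qed
    qed simp
  qed
  also have "\<dots> = (\<integral>\<^sup>+s. ennreal V * indicator {0..t} s \<partial>lborel) + (\<integral>\<^sup>+s. ennreal (K / s\<^sup>2) * indicator {t..} s \<partial>lborel)"
    by (rule nn_integral_add) auto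
  also have "(\<integral>\<^sup>+s. ennreal V * indicator {0..t} s \<partial>lborel) = ennreal (t * V)"
    using t V by (simp add: nn_integral_cmult_indicator ennreal_mult mult.commute)
  also have "(\<integral>\<^sup>+s. ennreal (K / s\<^sup>2) * indicator {t..} s \<partial>lborel) = ennreal (0 - (- K / t))"
  proof (rule nn_integral_FTC_atLeast)
    show "((\<lambda>s. - K / s) has_real_derivative K / s\<^sup>2) (at s)" if "t \<le> s" for s
      using that t by (auto intro!: derivative_eq_intros simp: power2_eq_square)
    show "((\<lambda>s. - K / s) \<longlongrightarrow> 0) at_top"
      by (intro tendsto_divide_0[OF tendsto_const] filterlim_at_top_imp_at_infinity filterlim_ident)
  qed (use V in auto)
  also have "ennreal (t * V) + ennreal (0 - (- K / t)) = ennreal (t * V + K / t)"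
    using t V by (simp add: ennreal_plus)
  finally show ?thesis .
qed

lemma ennpowr_two: "ennpowr b 2 = b * b"
  by (cases b) (auto simp: ennpowr_ennreal power2_eq_square ennreal_mult ennreal_top_mult powr_numeral)

text \<open>
  Here \<open>K\<close> is the weight \<open>\<sigma>\<close> of the duality argument and \<open>K q\<close> its dual function. The weak type inequality with
  the weight \<open>v 1\<^sub>E\<close>, where \<open>E\<close> is the level set itself, bounds \<open>t v(E)\<close> by an integral that Cauchy-Schwarz
  and the maximal inequality control by the square root of \<open>v(E)\<close>. Solving for \<open>v(E)\<close> gives the quadratic
  decay. The assumption \<open>r \<le> 4/3\<close> keeps the exponent \<open>2 / r\<close> away from 1.
\<close>
lemma hilbert_level_set_bound:
  fixes A r :: real and v q S :: "real \<Rightarrow> real"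
  defines "\<alpha> \<equiv> r / (2 - r)"
  defines "K \<equiv> \<lambda>x. v x powr \<alpha> * S x powr (- (2 / r))"
  assumes hyp: "weak_type_bound r A" and A: "0 < A" and r: "1 < r" "r \<le> 4/3"
    and v: "test_function v" "\<And>x. 0 \<le> v x"
    and S: "\<And>x. interval_maximal (\<lambda>y. ennreal (v y powr \<alpha>)) x = ennreal (S x)" "\<And>x. 0 \<le> S x"
    and h: "test_function (\<lambda>x. K x * q x)" and Q: "integrable lborel (\<lambda>x. K x * (q x)\<^sup>2)"
    and t: "0 < t"
  shows "(\<integral>\<^sup>+x\<in>{x. t < \<bar>hilbert (\<lambda>x. K x * q x) x\<bar>}. ennreal (v x) \<partial>lborel)
     \<le> ennreal (24 * A\<^sup>2 * (\<integral>x. K x * (q x)\<^sup>2 \<partial>lborel) / t\<^sup>2)"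
proof -
  note vm [measurable] = test_function_measurable[OF v(1)]
  define h' where "h' = (\<lambda>x. K x * q x)"
  have h': "test_function h'" using h by (simp add: h'_def)
  note [measurable] = test_function_measurable[OF h'] borel_measurable_hilbert[OF test_function_integrable(2)[OF h']]
  define E where "E = {x. t < \<bar>hilbert h' x\<bar>}"
  have E [measurable]: "E \<in> sets borel" unfolding E_def by measurable
  define w where "w = (\<lambda>x. v x * indicator E x)"
  define QQ where "QQ = (\<integral>x. K x * (q x)\<^sup>2 \<partial>lborel)"
  have K0: "0 \<le> K x" for x by (simp add: K_def)
  have \<alpha>1: "1 \<le> \<alpha>" using r by (simp add: \<alpha>_def field_simps)
  have QQ0: "0 \<le> QQ" unfolding QQ_def using K0 by (intro integral_nonneg_AE) auto
  define \<mu> where "\<mu> = density lborel (\<lambda>y. ennreal (v y powr \<alpha>))"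
  define N where "N = rational_maximal \<mu> (\<lambda>y. ennreal (v y powr (r - \<alpha>) * indicator E y))"
  have sets_\<mu> [measurable_cong]: "sets \<mu> = sets borel" by (simp add: \<mu>_def)
  have [measurable]: "N \<in> borel_measurable borel" unfolding N_def by measurable
  \<comment> \<open>This \<open>\<tau>\<close> makes the term \<open>A * 24 * y / (2 * \<tau>)\<close> below equal to \<open>t * y / 2\<close>, which the left-hand side absorbs.\<close>
  define \<tau> where "\<tau> = 24 * A / t"
  have \<tau>: "\<tau> = 24 * A / t" "0 < \<tau>" using A t by (simp_all add: \<tau>_def)
  have "weight w" unfolding weight_def w_def
    using v(2) by (auto intro!: measurable_completion)
  have pointwise: "ennreal \<bar>h' x\<bar> * maximal r w x
     \<le> ennreal (\<tau> / 2) * ennreal (K x * (q x)\<^sup>2) + ennreal (1 / (2 * \<tau>)) * (ennreal (v x powr \<alpha>) * ennpowr (N x) (2 / r))" for x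
  proof (cases "v x powr \<alpha> = 0")
    case True
    then show ?thesis by (simp add: h'_def K_def)
  next
    case False
    then have vx: "0 < v x" using v(2)[of x] by (cases "v x = 0") auto
    define b where "b = ennpowr (N x) (1 / r)"
    have b2: "ennpowr (N x) (2 / r) = b * b" unfolding b_def ennpowr_two[symmetric] ennpowr_powr by simp
    have "maximal r w x \<le> ennpowr (ennreal (S x) * N x) (1 / r)"
      unfolding w_def N_def \<mu>_def S(1)[symmetric] using r by (intro maximal_indicator_le v \<alpha>1 E) simp
    also have "\<dots> = ennreal (S x powr (1 / r)) * b"
      using r S(2)[of x] by (simp add: ennpowr_mult ennpowr_ennreal b_def)
    finally have "ennreal \<bar>h' x\<bar> * maximal r w x \<le> ennreal \<bar>h' x\<bar> * (ennreal (S x powr (1 / r)) * b)"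
      by (rule mult_left_mono) simp
    also have "\<dots> \<le> ennreal (\<tau> / 2) * ennreal (K x * (q x)\<^sup>2) + ennreal (1 / (2 * \<tau>)) * (ennreal (v x powr \<alpha>) * (b * b))"
    proof (cases b)
      case top
      have "ennreal (1 / (2 * \<tau>)) * (ennreal (v x powr \<alpha>) * (b * b)) = top"
        using \<tau>(2) vx unfolding top by (simp add: ennreal_mult_top)
      then show ?thesis by simp
    next
      case (real c)
      define a where "a = S x powr (- (1 / r)) * \<bar>q x\<bar>"
      have a2: "a * a = S x powr (- (2 / r)) * (q x)\<^sup>2"
      proof -
        have "S x powr (- (1 / r)) * S x powr (- (1 / r)) = S x powr (- (2 / r))" by (simp flip: powr_add)
        then show ?thesis unfolding a_def by (simp add: power2_eq_square mult_ac)
      qed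
      have "\<bar>h' x\<bar> * S x powr (1 / r) = v x powr \<alpha> * a"
      proof -
        have "S x powr (- (2 / r)) * S x powr (1 / r) = S x powr (- (1 / r))" by (simp flip: powr_add)
        then show ?thesis unfolding h'_def K_def a_def abs_mult by (simp add: mult_ac)
      qed
      then have "\<bar>h' x\<bar> * (S x powr (1 / r) * c) = v x powr \<alpha> * (a * c)" by (metis mult.assoc)
      also have "\<dots> \<le> v x powr \<alpha> * (\<tau> / 2 * (a * a) + 1 / (2 * \<tau>) * (c * c))"
      proof (rule mult_left_mono)
        \<comment> \<open>Cauchy-Schwarz in the form of Young's inequality with the parameter \<open>\<tau>\<close>.\<close>
        have "0 \<le> (\<tau> * a - c)\<^sup>2 / (2 * \<tau>)" using \<tau>(2) by simp
        also have "\<dots> = \<tau> / 2 * (a * a) + 1 / (2 * \<tau>) * (c * c) - a * c"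
          using \<tau>(2) by (simp add: field_simps power2_eq_square)
        finally show "a * c \<le> \<tau> / 2 * (a * a) + 1 / (2 * \<tau>) * (c * c)" by simp
      qed simp
      also have "\<dots> = \<tau> / 2 * (K x * (q x)\<^sup>2) + 1 / (2 * \<tau>) * (v x powr \<alpha> * (c * c))"
        unfolding a2 K_def by (simp add: algebra_simps)
      finally have "ennreal (\<bar>h' x\<bar> * (S x powr (1 / r) * c))
          \<le> ennreal (\<tau> / 2 * (K x * (q x)\<^sup>2) + 1 / (2 * \<tau>) * (v x powr \<alpha> * (c * c)))" by (rule ennreal_leI)
      then show ?thesis using real \<tau>(2) K0[of x] unfolding real(2)
        by (simp add: ennreal_mult[symmetric] ennreal_plus[symmetric] del: ennreal_plus)
    qed
    finally show ?thesis unfolding b2 .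
  qed
  define y where "y = enn2real (\<integral>\<^sup>+x. ennreal (w x) \<partial>lborel)"
  have w_fin: "(\<integral>\<^sup>+x. ennreal (w x) \<partial>lborel) = ennreal y"
  proof -
    have "(\<integral>\<^sup>+x. ennreal (w x) \<partial>lborel) \<le> (\<integral>\<^sup>+x. ennreal (v x) \<partial>lborel)"
      unfolding w_def using v(2) by (intro nn_integral_mono ennreal_leI) (auto simp: indicator_def)
    also have "\<dots> = ennreal (\<integral>x. v x \<partial>lborel)"
      using v by (intro nn_integral_eq_integral test_function_integrable) auto
    finally have "(\<integral>\<^sup>+x. ennreal (w x) \<partial>lborel) < \<infinity>" by (rule le_less_trans) simp
    then show ?thesis unfolding y_def by (simp add: less_top)
  qed
  have y0: "0 \<le> y" by (simp add: y_def)
  have strong: "(\<integral>\<^sup>+x. ennreal (v x powr \<alpha>) * ennpowr (N x) (2 / r) \<partial>lborel) \<le> ennreal (24 * y)"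
  proof -
    define p where "p = 2 / r"
    have p: "1 < p" using r by (simp add: p_def)
    have fin\<mu>: "finite_measure \<mu>"
    proof
      have "emeasure \<mu> (space \<mu>) = (\<integral>\<^sup>+y. ennreal (v y powr \<alpha>) \<partial>lborel)"
        unfolding \<mu>_def by (subst emeasure_density) auto
      also have "\<dots> = ennreal (\<integral>y. v y powr \<alpha> \<partial>lborel)"
        by (intro nn_integral_eq_integral test_function_integrable test_function_powr v \<alpha>1) auto
      finally show "emeasure \<mu> (space \<mu>) \<noteq> \<infinity>" by simp
    qed
    interpret finite_measure \<mu> by fact
    have "(\<integral>\<^sup>+x. ennreal (v x powr \<alpha>) * ennpowr (N x) p \<partial>lborel) = (\<integral>\<^sup>+x. ennpowr (N x) p \<partial>\<mu>)"
      unfolding \<mu>_def by (subst nn_integral_density) auto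
    also have "\<dots> \<le> ennreal (2 powr (p + 1) * p / (p - 1)) * (\<integral>\<^sup>+x. ennreal ((v x powr (r - \<alpha>) * indicator E x) powr p) \<partial>\<mu>)"
      unfolding N_def
    proof (rule rational_maximal_strong_type)
      show "sigma_finite_measure \<mu>" by unfold_locales
      show "emeasure \<mu> {a<..<b} < \<infinity>" for a b
        using emeasure_finite[of "{a<..<b}"] by (simp only: less_top infinity_ennreal_def)
    qed (use p v(2) sets_\<mu> in auto)
    also have "(\<integral>\<^sup>+x. ennreal ((v x powr (r - \<alpha>) * indicator E x) powr p) \<partial>\<mu>) = (\<integral>\<^sup>+x. ennreal (w x) \<partial>lborel)"
      unfolding \<mu>_def
    proof (subst nn_integral_density, measurable, rule nn_integral_cong)
      fix x
      \<comment> \<open>The exponents add up to 1 exactly for \<open>\<alpha> = r / (2 - r)\<close>.\<close>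
      have e: "\<alpha> * (2 - r) = r" "r * p = 2" using r by (simp_all add: \<alpha>_def p_def)
      have "r * (\<alpha> + (r - \<alpha>) * p) = r * \<alpha> + (r - \<alpha>) * (r * p)" by (simp add: algebra_simps)
      also have "\<dots> = 2 * r - \<alpha> * (2 - r)" unfolding e(2) by (simp add: algebra_simps)
      also have "\<dots> = r * 1" unfolding e(1) by simp
      finally have "\<alpha> + (r - \<alpha>) * p = 1" using r by simp
      then have "v x powr \<alpha> * (v x powr (r - \<alpha>)) powr p = v x"
        using v(2)[of x] by (cases "v x = 0") (auto simp: powr_powr simp flip: powr_add)
      then show "ennreal (v x powr \<alpha>) * ennreal ((v x powr (r - \<alpha>) * indicator E x) powr p) = ennreal (w x)"
        unfolding w_def by (auto simp: indicator_def simp flip: ennreal_mult)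
    qed
    also have "ennreal (2 powr (p + 1) * p / (p - 1)) * (\<integral>\<^sup>+x. ennreal (w x) \<partial>lborel) \<le> ennreal 24 * ennreal y"
      unfolding w_fin
    proof (intro mult_right_mono ennreal_leI)
      \<comment> \<open>The constant 24 is \<open>2\<^sup>3 * 3\<close>: \<open>r \<le> 4/3\<close> gives \<open>p / (p - 1) = 2 / (2 - r) \<le> 3\<close>.\<close>
      have "p + 1 \<le> 3" using r by (simp add: p_def field_simps)
      then have "2 powr (p + 1) \<le> 2 powr (3::real)" by (intro powr_mono) auto
      then have "2 powr (p + 1) \<le> (8::real)" by simp
      moreover have "p / (p - 1) \<le> 3" using r by (simp add: p_def field_simps)
      ultimately have "2 powr (p + 1) * (p / (p - 1)) \<le> 8 * 3" using p by (intro mult_mono) auto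
      then show "2 powr (p + 1) * p / (p - 1) \<le> 24" by simp
    qed simp
    finally show ?thesis unfolding p_def using y0 by (simp add: ennreal_mult)
  qed
  have "(\<integral>\<^sup>+x. ennreal \<bar>h' x\<bar> * maximal r w x \<partial>lborel)
     \<le> (\<integral>\<^sup>+x. ennreal (\<tau> / 2) * ennreal (K x * (q x)\<^sup>2) + ennreal (1 / (2 * \<tau>)) * (ennreal (v x powr \<alpha>) * ennpowr (N x) (2 / r)) \<partial>lborel)"
    by (rule nn_integral_mono) (rule pointwise)
  also have "\<dots> = ennreal (\<tau> / 2) * (\<integral>\<^sup>+x. ennreal (K x * (q x)\<^sup>2) \<partial>lborel)
      + ennreal (1 / (2 * \<tau>)) * (\<integral>\<^sup>+x. ennreal (v x powr \<alpha>) * ennpowr (N x) (2 / r) \<partial>lborel)"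
    using borel_measurable_integrable[OF Q] by (simp add: nn_integral_add nn_integral_cmult)
  also have "(\<integral>\<^sup>+x. ennreal (K x * (q x)\<^sup>2) \<partial>lborel) = ennreal QQ"
    unfolding QQ_def using K0 by (intro nn_integral_eq_integral Q) auto
  also have "ennreal (\<tau> / 2) * ennreal QQ + ennreal (1 / (2 * \<tau>)) * (\<integral>\<^sup>+x. ennreal (v x powr \<alpha>) * ennpowr (N x) (2 / r) \<partial>lborel)
     \<le> ennreal (\<tau> / 2) * ennreal QQ + ennreal (1 / (2 * \<tau>)) * ennreal (24 * y)"
    by (intro add_left_mono mult_left_mono strong) simp
  also have "\<dots> = ennreal (\<tau> / 2 * QQ + 1 / (2 * \<tau>) * (24 * y))"
    using \<tau>(2) QQ0 y0 by (simp add: ennreal_mult[symmetric] ennreal_plus[symmetric] del: ennreal_plus)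
  finally have rhs: "(\<integral>\<^sup>+x. ennreal \<bar>h' x\<bar> * maximal r w x \<partial>lborel) \<le> ennreal (\<tau> / 2 * QQ + 1 / (2 * \<tau>) * (24 * y))" .
  have "ennreal t * (\<integral>\<^sup>+x\<in>{x. t < \<bar>hilbert h' x\<bar>}. ennreal (w x) \<partial>lborel)
      \<le> ennreal A * (\<integral>\<^sup>+x. ennreal \<bar>h' x\<bar> * maximal r w x \<partial>lborel)"
  proof (rule weak_type_boundD[OF hyp \<open>weight w\<close> _ t])
    show "h' \<in> borel_measurable lebesgue" by (intro measurable_completion) simp
    show "(\<integral>\<^sup>+x. ennreal \<bar>h' x\<bar> * maximal r w x \<partial>lborel) < \<infinity>"
      using rhs by (rule le_less_trans) simp
  qed
  also have "(\<integral>\<^sup>+x\<in>{x. t < \<bar>hilbert h' x\<bar>}. ennreal (w x) \<partial>lborel) = ennreal y"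
    unfolding w_fin[symmetric] by (intro nn_integral_cong) (auto simp: w_def E_def indicator_def)
  also have "ennreal A * (\<integral>\<^sup>+x. ennreal \<bar>h' x\<bar> * maximal r w x \<partial>lborel)
      \<le> ennreal A * ennreal (\<tau> / 2 * QQ + 1 / (2 * \<tau>) * (24 * y))"
    by (intro mult_left_mono rhs) simp
  finally have "ennreal (t * y) \<le> ennreal (A * (\<tau> / 2 * QQ + 1 / (2 * \<tau>) * (24 * y)))"
    using t A y0 QQ0 \<tau>(2) by (simp add: ennreal_mult)
  then have "t * y \<le> A * (\<tau> / 2 * QQ + 1 / (2 * \<tau>) * (24 * y))"
    using A y0 QQ0 \<tau>(2) by (subst (asm) ennreal_le_iff) auto
  also have "\<dots> = 12 * A\<^sup>2 * QQ / t + t * y / 2"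
    unfolding \<tau>(1) using A t by (simp add: field_simps power2_eq_square)
  finally have "t * y \<le> 24 * A\<^sup>2 * QQ / t" by (simp add: field_simps)
  then have "y \<le> 24 * A\<^sup>2 * QQ / t\<^sup>2" using t by (simp add: field_simps power2_eq_square)
  moreover have "(\<integral>\<^sup>+x\<in>{x. t < \<bar>hilbert h' x\<bar>}. ennreal (v x) \<partial>lborel) = ennreal y"
    unfolding w_fin[symmetric] by (intro nn_integral_cong) (auto simp: w_def E_def indicator_def)
  ultimately show ?thesis unfolding h'_def QQ_def by (simp add: ennreal_leI)
qed

section \<open>The estimate for Lipschitz weights and small exponents\<close>

text \<open>
  The integrand of the theorem, with \<open>(M\<^sub>\<alpha> w) powr (\<alpha> / r)\<close> rewritten as the power \<open>1 / r\<close> of the maximal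
  function of \<open>w\<^sup>\<alpha>\<close>.
\<close>
definition hilbert_density :: "real \<Rightarrow> (real \<Rightarrow> real) \<Rightarrow> real \<Rightarrow> ennreal" where
  "hilbert_density r w x =
     (ennreal \<bar>hilbert w x\<bar> / ennpowr (interval_maximal (\<lambda>y. ennreal (w y powr (r / (2 - r)))) x) (1 / r))\<^sup>2
       * ennreal (w x powr (r / (2 - r)))"

lemma hilbert_density_eq_0: "w x = 0 \<Longrightarrow> hilbert_density r w x = 0"
  by (simp add: hilbert_density_def)

lemma hilbert_quotient_eq:
  assumes "0 < s" "0 \<le> b"
  shows "(ennreal \<bar>a\<bar> / ennpowr (ennreal s) (1 / r))\<^sup>2 * ennreal b = ennreal (b * s powr (- (2 / r)) * a\<^sup>2)"
proof -
  have "s powr (1 / r) * s powr (1 / r) = s powr (2 / r)" by (simp flip: powr_add)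
  then have "(\<bar>a\<bar> / s powr (1 / r))\<^sup>2 = s powr (- (2 / r)) * a\<^sup>2"
    by (simp add: power_divide power2_eq_square powr_minus_divide)
  moreover have "ennreal \<bar>a\<bar> / ennpowr (ennreal s) (1 / r) = ennreal (\<bar>a\<bar> / s powr (1 / r))"
    using assms(1) by (simp add: ennpowr_ennreal divide_ennreal)
  ultimately show ?thesis
    using assms(2) by (simp add: ennreal_power ennreal_mult[symmetric] mult_ac)
qed

lemma hilbert_density_eq_ennreal:
  assumes "interval_maximal (\<lambda>y. ennreal (w y powr (r / (2 - r)))) x = ennreal s" "0 < s"
  shows "hilbert_density r w x = ennreal (w x powr (r / (2 - r)) * s powr (- (2 / r)) * (hilbert w x)\<^sup>2)"
  unfolding hilbert_density_def assms(1) using assms(2) by (intro hilbert_quotient_eq) auto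

text \<open>
  With \<open>T = \<integral> K |Hv|\<^sup>2\<close> the duality argument gives \<open>T \<le> t V + 24 A\<^sup>2 T / t\<close> for all \<open>t > 0\<close>. Since \<open>T\<close> is finite,
  the choice \<open>t = 48 A\<^sup>2\<close> lets half of \<open>T\<close> be absorbed. The factor \<open>q = Hv\<close> of the dual function is merely
  bounded and measurable, so it is replaced by Lipschitz approximations \<open>q\<^sub>n\<close>.
\<close>
lemma test_function_estimate_small_exponent:
  assumes hyp: "weak_type_bound r A" and A: "0 < A" and r: "1 < r" "r \<le> 4/3"
    and v: "test_function v" "\<And>x. 0 \<le> v x"
  shows "(\<integral>\<^sup>+x. hilbert_density r v x \<partial>lborel) \<le> ennreal (96 * A\<^sup>2) * (\<integral>\<^sup>+x. ennreal (v x) \<partial>lborel)"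
proof -
  define \<alpha> where "\<alpha> = r / (2 - r)"
  have \<alpha>1: "1 \<le> \<alpha>" using r by (simp add: \<alpha>_def field_simps)
  have va: "test_function (\<lambda>x. v x powr \<alpha>)" by (intro test_function_powr v \<alpha>1)
  note [measurable] = test_function_measurable[OF v(1)]
  define V where "V = (\<integral>x. v x \<partial>lborel)"
  have V: "(\<integral>\<^sup>+x. ennreal (v x) \<partial>lborel) = ennreal V"
    unfolding V_def using v by (intro nn_integral_eq_integral test_function_integrable) auto
  have V0: "0 \<le> V" unfolding V_def using v(2) by (intro integral_nonneg_AE) auto
  show ?thesis
  proof (cases "(\<integral>x. v x powr \<alpha> \<partial>lborel) = 0")
    case True
    then have "AE x in lborel. v x powr \<alpha> = 0"
      using integral_nonneg_eq_0_iff_AE[OF test_function_integrable(1)[OF va]] by auto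
    then have "AE x in lborel. hilbert_density r v x = 0"
      by eventually_elim (auto simp: hilbert_density_eq_0)
    from nn_integral_cong_AE[OF this]
    have "(\<integral>\<^sup>+x. hilbert_density r v x \<partial>lborel) = (\<integral>\<^sup>+x. 0 \<partial>(lborel :: real measure))" .
    then show ?thesis by simp
  next
    case False
    moreover have "0 \<le> (\<integral>x. v x powr \<alpha> \<partial>lborel)" by (intro integral_nonneg_AE) auto
    ultimately have pos: "0 < (\<integral>x. v x powr \<alpha> \<partial>lborel)" by linarith
    obtain S m where S: "\<And>x. interval_maximal (\<lambda>y. ennreal (v y powr \<alpha>)) x = ennreal (S x)" and m: "0 < m"
      and mS: "\<And>x. x \<in> {-1..2} \<Longrightarrow> m \<le> S x" and S0: "\<And>x. 0 \<le> S x"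
      and Slip: "\<And>s. 0 < s \<Longrightarrow> \<exists>C. C-lipschitz_on {-1..2} (\<lambda>x. S x powr (- s))"
      by (rule test_function_interval_maximal[OF va _ pos]) (simp, blast)
    have Spos: "0 < S x" if "x \<in> {-1..2}" for x using mS[OF that] m by linarith
    define K where "K = (\<lambda>x. v x powr \<alpha> * S x powr (- (2 / r)))"
    have K: "test_function K"
    proof -
      obtain C where "C-lipschitz_on {-1..2} (\<lambda>x. S x powr (- (2 / r)))" using Slip[of "2 / r"] r by auto
      then show ?thesis unfolding K_def by (intro test_function_mult[OF va])
    qed
    have K0: "0 \<le> K x" for x by (simp add: K_def)
    note [measurable] = test_function_measurable[OF K] borel_measurable_hilbert[OF test_function_integrable(2)[OF v(1)]]
    obtain B where B: "0 \<le> B" "\<And>x. \<bar>hilbert v x\<bar> \<le> B" using v(1) by (rule test_function_hilbert_bounded) blast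
    have "hilbert v \<in> borel_measurable lebesgue" by (intro measurable_completion) simp
    then obtain q C where q: "\<And>n::nat. (C n)-lipschitz_on {-1..2} (q n)" "\<And>n x. \<bar>q n x\<bar> \<le> B"
      "AE x in lborel. x \<in> {-1..2} \<longrightarrow> (\<lambda>n. q n x) \<longlonglongrightarrow> hilbert v x"
      using B(2) by (rule bounded_lipschitz_approximation) blast
    have Kq: "test_function (\<lambda>x. K x * q n x)" for n by (rule test_function_mult[OF K q(1)])
    have Kq2: "test_function (\<lambda>x. K x * (q n x)\<^sup>2)" for n
      using test_function_mult[OF Kq q(1)] by (simp add: power2_eq_square mult.assoc)
    note [measurable] = test_function_measurable[OF Kq] test_function_measurable[OF Kq2]
    define T where "T = (\<integral>x. K x * (hilbert v x)\<^sup>2 \<partial>lborel)"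
    have intB: "integrable lborel (\<lambda>x. K x * B\<^sup>2)" using test_function_integrable(1)[OF K] by auto
    have AEq: "AE x in lborel. K x = 0 \<or> (\<lambda>n. q n x) \<longlonglongrightarrow> hilbert v x"
      using q(3) by eventually_elim (use test_function_zero[OF K] in blast)
    have lim1: "(\<lambda>n. \<integral>x. (K x * q n x) * hilbert v x \<partial>lborel) \<longlonglongrightarrow> T" unfolding T_def
    proof (rule integral_dominated_convergence[where w = "\<lambda>x. K x * B\<^sup>2"])
      show "AE x in lborel. (\<lambda>n. K x * q n x * hilbert v x) \<longlonglongrightarrow> K x * (hilbert v x)\<^sup>2"
        using AEq
      proof eventually_elim
        case (elim x)
        then show ?case
          by (cases "K x = 0") (auto simp: power2_eq_square mult.assoc intro!: tendsto_intros)
      qed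
      show "AE x in lborel. norm (K x * q n x * hilbert v x) \<le> K x * B\<^sup>2" for n
      proof (rule AE_I2)
        fix x
        have "\<bar>q n x\<bar> * \<bar>hilbert v x\<bar> \<le> B * B" using B q(2) by (intro mult_mono) auto
        then show "norm (K x * q n x * hilbert v x) \<le> K x * B\<^sup>2"
          using K0[of x] by (simp add: abs_mult power2_eq_square mult.assoc mult_left_mono)
      qed
    qed (use intB in auto)
    have lim2: "(\<lambda>n. \<integral>x. K x * (q n x)\<^sup>2 \<partial>lborel) \<longlonglongrightarrow> T" unfolding T_def
    proof (rule integral_dominated_convergence[where w = "\<lambda>x. K x * B\<^sup>2"])
      show "AE x in lborel. (\<lambda>n. K x * (q n x)\<^sup>2) \<longlonglongrightarrow> K x * (hilbert v x)\<^sup>2"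
        using AEq
      proof eventually_elim
        case (elim x)
        then show ?case by (cases "K x = 0") (auto intro!: tendsto_intros)
      qed
      show "AE x in lborel. norm (K x * (q n x)\<^sup>2) \<le> K x * B\<^sup>2" for n
      proof (rule AE_I2)
        fix x
        have "\<bar>q n x\<bar>\<^sup>2 \<le> B\<^sup>2" using q(2) by (intro power_mono) auto
        then show "norm (K x * (q n x)\<^sup>2) \<le> K x * B\<^sup>2"
          using K0[of x] by (simp add: abs_mult mult_left_mono)
      qed
    qed (use intB in auto)
    have step: "(\<integral>x. (K x * q n x) * hilbert v x \<partial>lborel) \<le> t * V + 24 * A\<^sup>2 * (\<integral>x. K x * (q n x)\<^sup>2 \<partial>lborel) / t"
      if t: "0 < t" for n t
    proof -
      let ?h = "\<lambda>x. K x * q n x" and ?Q = "\<integral>x. K x * (q n x)\<^sup>2 \<partial>lborel"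
      have Q0: "0 \<le> ?Q" using K0 by (intro integral_nonneg_AE) auto
      note [measurable] = borel_measurable_hilbert[OF test_function_integrable(2)[OF Kq]]
      define \<mu> where "\<mu> = density lborel (\<lambda>x. ennreal (v x))"
      have space: "space \<mu> = UNIV" by (simp add: \<mu>_def)
      have total: "emeasure \<mu> (space \<mu>) = ennreal V"
        unfolding \<mu>_def V[symmetric] by (subst emeasure_density) auto
      have "finite_measure \<mu>" by (rule finite_measureI) (simp add: total)
      then have sf: "sigma_finite_measure \<mu>" by (rule finite_measure.axioms(1))
      have "(\<integral>\<^sup>+x. ennreal \<bar>hilbert ?h x\<bar> \<partial>\<mu>) \<le> ennreal (t * V + 24 * A\<^sup>2 * ?Q / t)"
      proof (rule nn_integral_le_of_quadratic_decay[OF sf _ _ t V0])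
        show "(\<lambda>x. \<bar>hilbert ?h x\<bar>) \<in> borel_measurable \<mu>" unfolding \<mu>_def by measurable
        show "emeasure \<mu> {x \<in> space \<mu>. s < \<bar>hilbert ?h x\<bar>} \<le> ennreal (24 * A\<^sup>2 * ?Q / s\<^sup>2)" if s: "0 < s" for s
        proof -
          have "emeasure \<mu> {x \<in> space \<mu>. s < \<bar>hilbert ?h x\<bar>} = (\<integral>\<^sup>+x\<in>{x. s < \<bar>hilbert ?h x\<bar>}. ennreal (v x) \<partial>lborel)"
            unfolding space unfolding \<mu>_def by (subst emeasure_density) auto
          also have "\<dots> \<le> ennreal (24 * A\<^sup>2 * ?Q / s\<^sup>2)"
            unfolding K_def \<alpha>_def
            by (rule hilbert_level_set_bound[OF hyp A r v])
               (use S S0 Kq test_function_integrable(1)[OF Kq2] s in \<open>simp_all add: K_def \<alpha>_def\<close>)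
          finally show ?thesis .
        qed
      qed (use total Q0 in auto)
      moreover have "(\<integral>\<^sup>+x. ennreal \<bar>hilbert ?h x\<bar> \<partial>\<mu>) = (\<integral>\<^sup>+x. ennreal (norm (v x * hilbert ?h x)) \<partial>lborel)"
        unfolding \<mu>_def using v(2) by (subst nn_integral_density) (auto simp: abs_mult ennreal_mult intro!: nn_integral_cong)
      moreover have "ennreal (norm (\<integral>x. v x * hilbert ?h x \<partial>lborel)) \<le> (\<integral>\<^sup>+x. ennreal (norm (v x * hilbert ?h x)) \<partial>lborel)"
      proof (rule integral_norm_bound_ennreal)
        obtain B' where B': "0 \<le> B'" "\<And>x. \<bar>hilbert ?h x\<bar> \<le> B'" using Kq by (rule test_function_hilbert_bounded) blast
        show "integrable lborel (\<lambda>x. v x * hilbert ?h x)"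
        proof (rule Bochner_Integration.integrable_bound)
          show "integrable lborel (\<lambda>x. v x * B')" using test_function_integrable(1)[OF v(1)] by auto
          show "AE x in lborel. norm (v x * hilbert ?h x) \<le> norm (v x * B')"
            unfolding norm_mult using B' by (intro AE_I2 mult_left_mono) auto
        qed measurable
      qed
      ultimately have "ennreal \<bar>\<integral>x. v x * hilbert ?h x \<partial>lborel\<bar> \<le> ennreal (t * V + 24 * A\<^sup>2 * ?Q / t)" by simp
      then have "\<bar>\<integral>x. v x * hilbert ?h x \<partial>lborel\<bar> \<le> t * V + 24 * A\<^sup>2 * ?Q / t"
        using t V0 Q0 by (subst (asm) ennreal_le_iff) auto
      then show ?thesis unfolding hilbert_antisymmetric[OF Kq v(1)] by linarith
    qed
    have "T \<le> 48 * A\<^sup>2 * V + 24 * A\<^sup>2 * T / (48 * A\<^sup>2)"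
    proof (rule LIMSEQ_le[OF lim1])
      show "(\<lambda>n. 48 * A\<^sup>2 * V + 24 * A\<^sup>2 * (\<integral>x. K x * (q n x)\<^sup>2 \<partial>lborel) / (48 * A\<^sup>2))
         \<longlonglongrightarrow> 48 * A\<^sup>2 * V + 24 * A\<^sup>2 * T / (48 * A\<^sup>2)"
        using A by (intro tendsto_intros lim2) auto
      show "\<exists>N. \<forall>n\<ge>N. (\<integral>x. K x * q n x * hilbert v x \<partial>lborel)
         \<le> 48 * A\<^sup>2 * V + 24 * A\<^sup>2 * (\<integral>x. K x * (q n x)\<^sup>2 \<partial>lborel) / (48 * A\<^sup>2)"
        using A by (intro exI[of _ 0] allI impI step) auto
    qed
    then have T: "T \<le> 96 * A\<^sup>2 * V" using A by (simp add: field_simps)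
    have "hilbert_density r v x = ennreal (K x * (hilbert v x)\<^sup>2)" for x
    proof (cases "v x = 0")
      case False
      then have "x \<in> {-1..2}" using test_function_zero[OF v(1)] by blast
      then show ?thesis using hilbert_density_eq_ennreal[of v r x "S x"] S Spos r by (simp add: K_def \<alpha>_def)
    qed (simp add: hilbert_density_eq_0 K_def)
    then have "(\<integral>\<^sup>+x. hilbert_density r v x \<partial>lborel) = (\<integral>\<^sup>+x. ennreal (K x * (hilbert v x)\<^sup>2) \<partial>lborel)" by simp
    also have "\<dots> = ennreal T" unfolding T_def
    proof (rule nn_integral_eq_integral)
      show "integrable lborel (\<lambda>x. K x * (hilbert v x)\<^sup>2)"
      proof (rule Bochner_Integration.integrable_bound[OF intB])
        show "AE x in lborel. norm (K x * (hilbert v x)\<^sup>2) \<le> norm (K x * B\<^sup>2)"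
        proof (rule AE_I2)
          fix x
          have "\<bar>hilbert v x\<bar>\<^sup>2 \<le> B\<^sup>2" using B by (intro power_mono) auto
          then show "norm (K x * (hilbert v x)\<^sup>2) \<le> norm (K x * B\<^sup>2)"
            using K0[of x] by (simp add: abs_mult mult_left_mono)
        qed
      qed measurable
    qed (use K0 in auto)
    also have "\<dots> \<le> ennreal (96 * A\<^sup>2 * V)" by (rule ennreal_leI[OF T])
    also have "\<dots> = ennreal (96 * A\<^sup>2) * ennreal V" using V0 by (simp add: ennreal_mult)
    finally show ?thesis unfolding V .
  qed
qed

section \<open>The estimate for Lipschitz weights and all exponents\<close>

lemma interval_maximal_cmult:
  assumes "F \<in> borel_measurable lebesgue"
  shows "interval_maximal (\<lambda>y. c * F y) x = c * interval_maximal F x"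
  unfolding interval_maximal_def SUP_mult_left_ennreal
proof (rule SUP_cong[OF refl])
  fix I assume I: "I \<in> intervals_at x"
  have [measurable]: "I \<in> sets lebesgue" using intervals_at_sets[OF I] by auto
  note assms [measurable]
  have "(\<integral>\<^sup>+y\<in>I. (c * F y) \<partial>lebesgue) = c * (\<integral>\<^sup>+y\<in>I. F y \<partial>lebesgue)"
    unfolding mult.assoc by (rule nn_integral_cmult) measurable
  then show "(\<integral>\<^sup>+y\<in>I. (c * F y) \<partial>lebesgue) / emeasure lebesgue I = c * ((\<integral>\<^sup>+y\<in>I. F y \<partial>lebesgue) / emeasure lebesgue I)"
    by (simp add: ennreal_times_divide)
qed

text \<open>
  Averages over short intervals around \<open>x\<close> are close to \<open>F x\<close>.
\<close>
lemma Lipschitz_le_interval_maximal: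
  fixes F :: "real \<Rightarrow> real"
  assumes [measurable]: "F \<in> borel_measurable borel"
    and lip: "\<And>u v. \<bar>F u - F v\<bar> \<le> L * \<bar>u - v\<bar>" and L: "0 \<le> L"
  shows "ennreal (F x) \<le> interval_maximal (\<lambda>y. ennreal (F y)) x"
proof (rule ennreal_le_epsilon)
  fix e :: real assume e: "0 < e"
  define d where "d = e / (L + 1)"
  have d: "0 < d" "L * d \<le> e" using e L by (simp_all add: d_def field_simps)
  let ?I = "{x - d..x + d}"
  have xI: "x - d < x + d" "x \<in> ?I" using d by auto
  have "ennreal (F x - e) = (\<integral>\<^sup>+y\<in>?I. ennreal (F x - e) \<partial>lebesgue) / emeasure lebesgue ?I"
    by (rule interval_average_const[symmetric, OF atLeastAtMost_in_intervals_at[OF xI]])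
  also have "\<dots> \<le> (\<integral>\<^sup>+y\<in>?I. ennreal (F y) \<partial>lebesgue) / emeasure lebesgue ?I"
  proof (intro divide_right_mono_ennreal nn_integral_mono)
    fix y
    have "F x - e \<le> F y" if "y \<in> ?I"
    proof -
      have "L * \<bar>x - y\<bar> \<le> L * d" using that L by (intro mult_left_mono) auto
      then show ?thesis using lip[of x y] d(2) by linarith
    qed
    then show "ennreal (F x - e) * indicator ?I y \<le> ennreal (F y) * indicator ?I y"
      by (auto simp: indicator_def intro: ennreal_leI)
  qed
  also have "\<dots> \<le> interval_maximal (\<lambda>y. ennreal (F y)) x"
    unfolding interval_maximal_def by (rule SUP_upper[OF atLeastAtMost_in_intervals_at[OF xI]])
  finally have *: "ennreal (F x - e) \<le> interval_maximal (\<lambda>y. ennreal (F y)) x" .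
  have "ennreal (F x) \<le> ennreal (F x - e) + ennreal e"
    using e by (cases "0 \<le> F x - e") (auto simp: ennreal_plus[symmetric] ennreal_neg intro!: ennreal_leI simp del: ennreal_plus)
  also have "\<dots> \<le> interval_maximal (\<lambda>y. ennreal (F y)) x + ennreal e" using * by (rule add_right_mono)
  finally show "ennreal (F x) \<le> interval_maximal (\<lambda>y. ennreal (F y)) x + ennreal e" .
qed

text \<open>
  Weighted arithmetic-geometric mean inequality for \<open>u\<^sup>\<alpha>\<close> and \<open>a\<^sup>\<alpha>\<close>, with equality at \<open>u = a\<close>. Averaging it
  with \<open>a\<close> the mean of order \<open>\<alpha>\<close> gives the monotonicity of power means.
\<close>
lemma square_le_powr_mean:
  fixes u a :: real
  assumes \<alpha>: "2 \<le> \<alpha>" and a: "0 < a" and u: "0 \<le> u"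
  shows "u powr 2 \<le> 2 / \<alpha> * a powr (2 - \<alpha>) * u powr \<alpha> + (1 - 2 / \<alpha>) * a\<^sup>2"
proof (cases "u = 0")
  case False
  then have u: "0 < u" using u by simp
  have "(u powr \<alpha>) powr (2 / \<alpha>) * (a powr \<alpha>) powr (1 - 2 / \<alpha>) \<le> 2 / \<alpha> * u powr \<alpha> + (1 - 2 / \<alpha>) * a powr \<alpha>"
    using \<alpha> a u by (intro Youngs_inequality_0) auto
  also have "(u powr \<alpha>) powr (2 / \<alpha>) = u powr 2" using \<alpha> by (simp add: powr_powr)
  also have "(a powr \<alpha>) powr (1 - 2 / \<alpha>) = a powr (\<alpha> - 2)" using \<alpha> by (simp add: powr_powr right_diff_distrib)
  finally have "a powr (2 - \<alpha>) * (u powr 2 * a powr (\<alpha> - 2))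
      \<le> a powr (2 - \<alpha>) * (2 / \<alpha> * u powr \<alpha> + (1 - 2 / \<alpha>) * a powr \<alpha>)"
    by (rule mult_left_mono) simp
  moreover have "a powr (2 - \<alpha>) * a powr (\<alpha> - 2) = 1" using a by (simp flip: powr_add)
  moreover have "a powr (2 - \<alpha>) * a powr \<alpha> = a\<^sup>2" using a by (simp add: powr_numeral flip: powr_add)
  ultimately show ?thesis by (simp add: algebra_simps)
next
  case True
  have "0 \<le> (1 - 2 / \<alpha>) * a\<^sup>2" using \<alpha> by (intro mult_nonneg_nonneg) auto
  then show ?thesis using True by simp
qed

lemma interval_maximal_square_le:
  assumes v: "test_function v" "\<And>x. 0 \<le> v x" and \<alpha>: "2 \<le> \<alpha>" and a: "0 < a"
    and M: "interval_maximal (\<lambda>y. ennreal (v y powr \<alpha>)) x = ennreal (a powr \<alpha>)"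
  shows "interval_maximal (\<lambda>y. ennreal (v y powr 2)) x \<le> ennreal (a\<^sup>2)"
proof -
  note [measurable] = test_function_measurable[OF v(1)]
  have leb: "(\<lambda>y. ennreal (v y powr \<alpha>)) \<in> borel_measurable lebesgue" by (intro measurable_completion) measurable
  define c d where "c = 2 / \<alpha> * a powr (2 - \<alpha>)" and "d = (1 - 2 / \<alpha>) * a\<^sup>2"
  have cd: "0 \<le> c" "0 \<le> d" using \<alpha> by (auto simp: c_def d_def)
  have "interval_maximal (\<lambda>y. ennreal (v y powr 2)) x \<le> interval_maximal (\<lambda>y. ennreal c * ennreal (v y powr \<alpha>) + ennreal d) x"
  proof (rule interval_maximal_mono)
    fix y
    have "ennreal (v y powr 2) \<le> ennreal (c * v y powr \<alpha> + d)"
      unfolding c_def d_def by (intro ennreal_leI square_le_powr_mean \<alpha> a v(2))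
    also have "\<dots> = ennreal c * ennreal (v y powr \<alpha>) + ennreal d"
      using cd by (simp add: ennreal_plus ennreal_mult)
    finally show "ennreal (v y powr 2) \<le> ennreal c * ennreal (v y powr \<alpha>) + ennreal d" .
  qed
  also have "\<dots> \<le> interval_maximal (\<lambda>y. ennreal c * ennreal (v y powr \<alpha>)) x + interval_maximal (\<lambda>y. ennreal d) x"
    by (intro interval_maximal_add_le borel_measurable_times_ennreal leb borel_measurable_const)
  also have "\<dots> \<le> ennreal c * ennreal (a powr \<alpha>) + ennreal d"
    unfolding interval_maximal_cmult[OF leb] M by (intro add_left_mono interval_maximal_le_bound) simp
  also have "\<dots> = ennreal (c * a powr \<alpha> + d)" using cd by (simp add: ennreal_plus ennreal_mult)
  also have "c * a powr \<alpha> + d = a\<^sup>2"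
  proof -
    have "a powr (2 - \<alpha>) * a powr \<alpha> = a\<^sup>2" using a by (simp add: powr_numeral flip: powr_add)
    then have "c * a powr \<alpha> = 2 / \<alpha> * a\<^sup>2" by (simp add: c_def mult.assoc)
    then show ?thesis by (simp add: d_def algebra_simps)
  qed
  finally show ?thesis .
qed

text \<open>
  Let \<open>a = M\<^sub>\<alpha> v (x)\<close> and \<open>b = M\<^sub>2 v (x)\<close>; the exponent \<open>4/3\<close> corresponds to \<open>\<alpha> = 2\<close>. The two densities are
  \<open>v\<^sup>\<alpha> a powr (- \<alpha> - 1)\<close> and \<open>v\<^sup>2 b powr (- 3)\<close> times \<open>|Hv|\<^sup>2\<close>, and they compare because \<open>v \<le> b \<le> a\<close>.
\<close>
lemma hilbert_density_mono_exponent: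
  assumes v: "test_function v" "\<And>x. 0 \<le> v x" and r: "4/3 \<le> r" "r < 2"
  shows "hilbert_density r v x \<le> hilbert_density (4/3) v x"
proof (cases "v x = 0")
  case False
  define \<alpha> where "\<alpha> = r / (2 - r)"
  have \<alpha>: "2 \<le> \<alpha>" using r by (simp add: \<alpha>_def field_simps)
  have vx: "0 < v x" using False v(2)[of x] by simp
  have le_max: "ennreal (v x powr \<beta>) \<le> interval_maximal (\<lambda>y. ennreal (v y powr \<beta>)) x" if \<beta>: "1 \<le> \<beta>" for \<beta>
  proof -
    have "test_function (\<lambda>x. v x powr \<beta>)" by (intro test_function_powr v \<beta>)
    then obtain L where "0 \<le> L" "\<And>x y. \<bar>v x powr \<beta> - v y powr \<beta>\<bar> \<le> L * \<bar>x - y\<bar>"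
      by (rule test_functionE) blast
    then show ?thesis using test_function_measurable[OF \<open>test_function (\<lambda>x. v x powr \<beta>)\<close>]
      by (intro Lipschitz_le_interval_maximal) auto
  qed
  have fin: "\<exists>s. interval_maximal (\<lambda>y. ennreal (v y powr \<beta>)) x = ennreal s \<and> v x powr \<beta> \<le> s" if \<beta>: "1 \<le> \<beta>" for \<beta>
  proof -
    have "test_function (\<lambda>x. v x powr \<beta>)" by (intro test_function_powr v \<beta>)
    then obtain S where S: "\<And>x. interval_maximal (\<lambda>y. ennreal (v y powr \<beta>)) x = ennreal (S x)" "\<And>x. 0 \<le> S x"
      by (rule test_function_interval_maximal_Lipschitz) auto
    then show ?thesis using le_max[OF \<beta>] by (intro exI[of _ "S x"]) auto
  qed
  obtain s where s: "interval_maximal (\<lambda>y. ennreal (v y powr \<alpha>)) x = ennreal s" "v x powr \<alpha> \<le> s"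
    using fin[of \<alpha>] \<alpha> by auto
  obtain s2 where s2: "interval_maximal (\<lambda>y. ennreal (v y powr 2)) x = ennreal s2" "v x powr 2 \<le> s2"
    using fin[of 2] by auto
  have s0: "0 < s" "0 < s2" using s(2) s2(2) vx by (auto intro: less_le_trans[rotated])
  define a b where "a = s powr (1 / \<alpha>)" and "b = s2 powr (1 / 2)"
  have ab0: "0 < a" "0 < b" using s0 by (auto simp: a_def b_def)
  have sa: "s = a powr \<alpha>" and sb: "s2 = b\<^sup>2"
    using s0 \<alpha> by (simp_all add: a_def b_def powr_powr flip: powr_numeral)
  have "ennreal s2 \<le> ennreal (a\<^sup>2)"
    unfolding s2(1)[symmetric] by (rule interval_maximal_square_le[OF v \<alpha> ab0(1)]) (simp add: s(1) sa)
  then have "b\<^sup>2 \<le> a\<^sup>2" unfolding sb by (subst (asm) ennreal_le_iff) auto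
  then have ba: "b \<le> a" using ab0 by (simp add: power2_le_iff_abs_le)
  have "(v x)\<^sup>2 \<le> b\<^sup>2" using s2(2) vx unfolding sb by simp
  then have vb: "v x \<le> b" using ab0 vx by (simp add: power2_le_iff_abs_le)
  have e: "2 / r * \<alpha> = \<alpha> + 1" using r by (simp add: \<alpha>_def field_simps)
  have "s powr (- (2 / r)) = a powr (- (\<alpha> + 1))" unfolding sa powr_powr using e by (simp add: mult.commute)
  moreover have "v x powr \<alpha> * a powr (- (\<alpha> + 1)) \<le> v x powr 2 * s2 powr (- (3 / 2))"
  proof -
    have "v x powr \<alpha> * a powr (- (\<alpha> + 1)) \<le> v x powr \<alpha> * b powr (- (\<alpha> + 1))"
      using ba ab0 \<alpha> by (intro mult_left_mono powr_mono2') auto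
    also have "v x powr \<alpha> * b powr (- (\<alpha> + 1)) = v x powr 2 * v x powr (\<alpha> - 2) * b powr (- (\<alpha> + 1))"
      by (simp flip: powr_add)
    also have "v x powr 2 * v x powr (\<alpha> - 2) * b powr (- (\<alpha> + 1)) \<le> v x powr 2 * b powr (\<alpha> - 2) * b powr (- (\<alpha> + 1))"
      using vb vx \<alpha> by (intro mult_right_mono mult_left_mono powr_mono2) auto
    also have "\<dots> = v x powr 2 * b powr (- 3)" by (simp add: mult.assoc flip: powr_add)
    also have "b powr (- 3) = s2 powr (- (3 / 2))" unfolding b_def by (simp add: powr_powr)
    finally show ?thesis .
  qed
  ultimately have "v x powr \<alpha> * s powr (- (2 / r)) * (hilbert v x)\<^sup>2 \<le> v x powr 2 * s2 powr (- (3 / 2)) * (hilbert v x)\<^sup>2"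
    by (intro mult_right_mono) auto
  moreover have "hilbert_density r v x = ennreal (v x powr \<alpha> * s powr (- (2 / r)) * (hilbert v x)\<^sup>2)"
    using hilbert_density_eq_ennreal[of v r x s] s(1) s0(1) r by (simp add: \<alpha>_def)
  moreover have "hilbert_density (4/3) v x = ennreal (v x powr 2 * s2 powr (- (3 / 2)) * (hilbert v x)\<^sup>2)"
    using hilbert_density_eq_ennreal[of v "4/3" x s2] s2(1) s0(2) by simp
  ultimately show ?thesis by (simp add: ennreal_leI)
qed (simp add: hilbert_density_eq_0)

text \<open>
  Take for \<open>f\<close> the indicator of \<open>[0, 1]\<close> and for \<open>w\<close> that of \<open>[2, 3]\<close>. On \<open>[2, 3]\<close> the transform of \<open>f\<close> is at
  least \<open>1 / (3 * pi)\<close>, which exceeds \<open>1/12\<close>, and the maximal function of \<open>w\<close> is at most 1.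
\<close>
lemma weak_type_bound_ge:
  assumes hyp: "weak_type_bound r A" and r: "0 < r"
  shows "1 / 12 \<le> A"
proof -
  define f w :: "real \<Rightarrow> real" where "f = indicator {0..1}" and "w = indicator {2..3}"
  have fm [measurable]: "f \<in> borel_measurable borel" and [measurable]: "w \<in> borel_measurable borel"
    by (simp_all add: f_def w_def)
  have fint: "integrable lebesgue f" unfolding f_def by (intro integrable_real_indicator) auto
  have H: "1 / 12 < \<bar>hilbert f x\<bar>" if x: "x \<in> {2..3}" for x
  proof -
    define c where "c = (\<integral>y. indicator {0..1} y * (1 / (x - y)) \<partial>lborel)"
    have T: "truncated_hilbert e f x = 1 / pi * c" if e: "e < 1" for e
    proof -
      have "indicator {y. e < \<bar>x - y\<bar>} y * (f y / (x - y)) = indicator {0..1} y * (1 / (x - y))" for y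
        using e x by (auto simp: f_def indicator_def)
      then show ?thesis unfolding truncated_hilbert_borel[OF fm] c_def by (simp only:)
    qed
    have "hilbert f x = 1 / pi * c"
    proof (rule hilbert_eqI, rule tendsto_eventually)
      show "\<forall>\<^sub>F e in at_right 0. truncated_hilbert e f x = 1 / pi * c"
        unfolding eventually_at_right_field by (intro exI[of _ 1]) (auto simp: T)
    qed
    moreover have "1 / 3 \<le> c"
    proof -
      have "(1 / 3 :: real) = (\<integral>y. indicator {0..1::real} y * (1 / 3) \<partial>lborel)" by simp
      also have "\<dots> \<le> c" unfolding c_def
      proof (rule integral_mono)
        show "integrable lborel (\<lambda>y. indicator {0..1} y * (1 / (x - y)))"
        proof (rule integrableI_bounded_set[where A = "{0..1}" and B = 1])
          show "AE y in lborel. y \<in> {0..1} \<longrightarrow> norm (indicator {0..1} y * (1 / (x - y))) \<le> 1"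
            using x by (intro AE_I2) auto
        qed auto
        show "indicator {0..1} y * (1 / 3) \<le> indicator {0..1} y * (1 / (x - y))" for y
        proof (cases "y \<in> {0..1}")
          case True
          then have "1 / 3 \<le> 1 / (x - y)" using x by (intro divide_left_mono) auto
          then show ?thesis using True by simp
        qed simp
      qed (auto intro!: integrable_mult_left integrable_real_indicator)
      finally show ?thesis .
    qed
    moreover have "1 / 12 < 1 / pi * (1 / 3)" using pi_less_4 pi_gt_zero by (simp add: field_simps)
    moreover have "1 / pi * (1 / 3) \<le> 1 / pi * c" using calculation(2) pi_gt_zero by (intro mult_left_mono) auto
    ultimately show ?thesis by linarith
  qed
  have "weight w" unfolding weight_def by (auto simp: w_def intro!: measurable_completion)
  have M: "maximal r w x \<le> 1" for x
    using maximal_le_bound[OF r, of w 1 x] by (simp add: w_def indicator_def)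
  have rhs: "(\<integral>\<^sup>+x. ennreal \<bar>f x\<bar> * maximal r w x \<partial>lborel) \<le> 1"
  proof -
    have "(\<integral>\<^sup>+x. ennreal \<bar>f x\<bar> * maximal r w x \<partial>lborel) \<le> (\<integral>\<^sup>+x. indicator {0..1::real} x \<partial>lborel)"
      using M by (intro nn_integral_mono) (auto simp: f_def indicator_def)
    then show ?thesis by simp
  qed
  have "ennreal (1 / 12) * (\<integral>\<^sup>+x\<in>{x. 1 / 12 < \<bar>hilbert f x\<bar>}. ennreal (w x) \<partial>lborel)
      \<le> ennreal A * (\<integral>\<^sup>+x. ennreal \<bar>f x\<bar> * maximal r w x \<partial>lborel)"
    by (rule weak_type_boundD[OF hyp \<open>weight w\<close>])
       (use rhs in \<open>auto intro!: measurable_completion intro: le_less_trans\<close>)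
  also have "\<dots> \<le> ennreal A * 1" by (intro mult_left_mono rhs) simp
  also have "(\<integral>\<^sup>+x\<in>{x. 1 / 12 < \<bar>hilbert f x\<bar>}. ennreal (w x) \<partial>lborel) = (\<integral>\<^sup>+x. indicator {2..3::real} x \<partial>lborel)"
    using H by (intro nn_integral_cong) (auto simp: w_def indicator_def)
  finally have "ennreal (1 / 12) \<le> ennreal A" by simp
  then show ?thesis by (subst (asm) ennreal_le_iff2) auto
qed

text \<open>
  The factor \<open>13824\<close> is \<open>96 * 144\<close>, where \<open>1 \<le> 144 * A\<^sup>2\<close> serves to bring \<open>A\<close> into an estimate that involves
  \<open>A0\<close> only.
\<close>
lemma test_function_estimate:
  assumes hyp: "weak_type_bound r A" and hyp0: "weak_type_bound (4/3) A0" and A: "0 < A" "0 < A0"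
    and r: "1 < r" "r < 2" and v: "test_function v" "\<And>x. 0 \<le> v x"
  shows "(\<integral>\<^sup>+x. hilbert_density r v x \<partial>lborel)
     \<le> ennreal (max 96 (13824 * A0\<^sup>2) * A\<^sup>2) * (\<integral>\<^sup>+x. ennreal (v x) \<partial>lborel)"
proof (cases "r \<le> 4/3")
  case True
  have "(\<integral>\<^sup>+x. hilbert_density r v x \<partial>lborel) \<le> ennreal (96 * A\<^sup>2) * (\<integral>\<^sup>+x. ennreal (v x) \<partial>lborel)"
    by (rule test_function_estimate_small_exponent[OF hyp A(1) r(1) True v])
  also have "\<dots> \<le> ennreal (max 96 (13824 * A0\<^sup>2) * A\<^sup>2) * (\<integral>\<^sup>+x. ennreal (v x) \<partial>lborel)"
    by (intro mult_right_mono ennreal_leI) auto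
  finally show ?thesis .
next
  case False
  have "(\<integral>\<^sup>+x. hilbert_density r v x \<partial>lborel) \<le> (\<integral>\<^sup>+x. hilbert_density (4/3) v x \<partial>lborel)"
    by (rule nn_integral_mono, rule hilbert_density_mono_exponent[OF v]) (use False r in auto)
  also have "\<dots> \<le> ennreal (96 * A0\<^sup>2) * (\<integral>\<^sup>+x. ennreal (v x) \<partial>lborel)"
    by (rule test_function_estimate_small_exponent[OF hyp0 A(2) _ _ v]) auto
  also have "\<dots> \<le> ennreal (max 96 (13824 * A0\<^sup>2) * A\<^sup>2) * (\<integral>\<^sup>+x. ennreal (v x) \<partial>lborel)"
  proof (intro mult_right_mono ennreal_leI)
    have "1 \<le> 12 * A" using weak_type_bound_ge[OF hyp] r by simp
    then have "1\<^sup>2 \<le> (12 * A)\<^sup>2" by (intro power_mono) auto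
    then have "1 \<le> 144 * A\<^sup>2" by (simp add: power_mult_distrib)
    then have "96 * A0\<^sup>2 * 1 \<le> 96 * A0\<^sup>2 * (144 * A\<^sup>2)" by (intro mult_left_mono) auto
    also have "\<dots> = 13824 * A0\<^sup>2 * A\<^sup>2" by simp
    also have "\<dots> \<le> max 96 (13824 * A0\<^sup>2) * A\<^sup>2" by (intro mult_right_mono) auto
    finally show "96 * A0\<^sup>2 \<le> max 96 (13824 * A0\<^sup>2) * A\<^sup>2" by simp
  qed simp
  finally show ?thesis .
qed

section \<open>Existence of principal values\<close>

lemma weak_type_bound_lebesgue:
  assumes hyp: "weak_type_bound r A" and r: "0 < r" and A: "0 \<le> A" and f: "integrable lebesgue f" and t: "0 < t"
  shows "ennreal t * emeasure lborel {x. t < \<bar>hilbert f x\<bar>} \<le> ennreal A * (\<integral>\<^sup>+x. ennreal \<bar>f x\<bar> \<partial>lborel)"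
proof -
  note [measurable] = borel_measurable_hilbert[OF f]
  have "weight (\<lambda>x. 1)" by (simp add: weight_def)
  have M: "maximal r (\<lambda>x. 1) x \<le> 1" for x
    using maximal_le_bound[OF r, of "\<lambda>x. 1" 1 x] by simp
  have le: "(\<integral>\<^sup>+x. ennreal \<bar>f x\<bar> * maximal r (\<lambda>x. 1) x \<partial>lborel) \<le> (\<integral>\<^sup>+x. ennreal \<bar>f x\<bar> \<partial>lborel)"
    using mult_left_mono[OF M, of "ennreal \<bar>f _\<bar>"] by (intro nn_integral_mono) simp
  have fin: "(\<integral>\<^sup>+x. ennreal \<bar>f x\<bar> \<partial>lborel) < \<infinity>"
    using f unfolding integrable_iff_bounded nn_integral_completion by simp
  have "ennreal t * (\<integral>\<^sup>+x\<in>{x. t < \<bar>hilbert f x\<bar>}. ennreal 1 \<partial>lborel)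
      \<le> ennreal A * (\<integral>\<^sup>+x. ennreal \<bar>f x\<bar> * maximal r (\<lambda>x. 1) x \<partial>lborel)"
    by (rule weak_type_boundD[OF hyp \<open>weight (\<lambda>x. 1)\<close> _ t])
       (use f le_less_trans[OF le fin] in auto)
  also have "\<dots> \<le> ennreal A * (\<integral>\<^sup>+x. ennreal \<bar>f x\<bar> \<partial>lborel)" by (intro mult_left_mono le) simp
  finally show ?thesis by simp
qed

text \<open>
  If \<open>f\<close> has no principal value at \<open>x\<close>, neither has \<open>c f\<close> for \<open>c > 0\<close>, so \<open>hilbert (c f) x\<close> is the default
  value for every such \<open>c\<close>. If this value is not 0, the weak type inequality bounds the measure of the set
  of these points by a constant times \<open>c\<close>, for all \<open>c > 0\<close>.
\<close>
lemma has_pv_AE_or_no_pv_value_eq_0: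
  assumes hyp: "weak_type_bound r A" and r: "0 < r" and A: "0 \<le> A" and f: "integrable lebesgue f"
  shows "no_pv_value = 0 \<or> (AE x in lborel. has_pv f x)"
proof (cases "no_pv_value = 0")
  case False
  define D where "D = {x. \<not> has_pv f x}"
  have D: "D \<in> sets borel" using sets_has_pv[OF f] unfolding D_def
    by (metis Collect_neg_eq borel_comp)
  define t where "t = \<bar>no_pv_value\<bar> / 2"
  have t: "0 < t" "t < \<bar>no_pv_value\<bar>" using False by (auto simp: t_def)
  obtain m where m: "0 \<le> m" "(\<integral>\<^sup>+x. ennreal \<bar>f x\<bar> \<partial>lborel) = ennreal m"
  proof -
    have "(\<integral>\<^sup>+x. ennreal \<bar>f x\<bar> \<partial>lborel) < \<infinity>"
      using f unfolding integrable_iff_bounded nn_integral_completion by simp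
    then show ?thesis using that[of "enn2real (\<integral>\<^sup>+x. ennreal \<bar>f x\<bar> \<partial>lborel)"] by (simp add: less_top)
  qed
  have "ennreal t * emeasure lborel D \<le> 0"
  proof (rule ennreal_le_epsilon)
    fix e :: real assume e: "0 < e"
    define c where "c = e / (A * m + 1)"
    have Am: "0 \<le> A * m" using A m by simp
    have c: "0 < c" using e Am by (simp add: c_def)
    have cf: "integrable lebesgue (\<lambda>y. c * f y)" using f by simp
    note [measurable] = borel_measurable_hilbert[OF cf]
    have "D \<subseteq> {x. t < \<bar>hilbert (\<lambda>y. c * f y) x\<bar>}"
    proof
      fix x assume "x \<in> D"
      then have "\<not> has_pv (\<lambda>y. c * f y) x" using has_pv_cmultD[of c f x] c unfolding D_def by auto
      then show "x \<in> {x. t < \<bar>hilbert (\<lambda>y. c * f y) x\<bar>}" using t(2) by (simp add: hilbert_no_pv)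
    qed
    then have "ennreal t * emeasure lborel D \<le> ennreal t * emeasure lborel {x. t < \<bar>hilbert (\<lambda>y. c * f y) x\<bar>}"
      by (intro mult_left_mono emeasure_mono) auto
    also have "\<dots> \<le> ennreal A * (\<integral>\<^sup>+x. ennreal \<bar>c * f x\<bar> \<partial>lborel)"
      by (rule weak_type_bound_lebesgue[OF hyp r A cf t(1)])
    also have "(\<integral>\<^sup>+x. ennreal \<bar>c * f x\<bar> \<partial>lborel) = ennreal c * ennreal m"
    proof -
      have "(\<integral>\<^sup>+x. ennreal \<bar>c * f x\<bar> \<partial>lebesgue) = ennreal c * (\<integral>\<^sup>+x. ennreal \<bar>f x\<bar> \<partial>lebesgue)"
        using f c by (subst nn_integral_cmult[symmetric]) (auto simp: abs_mult ennreal_mult)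
      then show ?thesis by (simp add: nn_integral_completion m(2))
    qed
    also have "ennreal A * (ennreal c * ennreal m) = ennreal (A * m * c)"
      using A c m by (simp add: ennreal_mult mult_ac)
    also have "\<dots> \<le> ennreal e"
    proof (rule ennreal_leI)
      have "A * m * c \<le> (A * m + 1) * c" using c by simp
      then show "A * m * c \<le> e" unfolding c_def using Am by simp
    qed
    finally show "ennreal t * emeasure lborel D \<le> 0 + ennreal e" by simp
  qed
  then have "emeasure lborel D = 0" using t by simp
  then have "D \<in> null_sets lborel" using D by auto
  then have "AE x in lborel. x \<notin> D" by (rule AE_not_in)
  then show ?thesis unfolding D_def by simp
qed simp

section \<open>Approximation of weights\<close>

lemma AE_eventually_not_in_of_geometric_measure:
  fixes C :: real
  assumes "\<And>n. B n \<in> sets M" "\<And>n. emeasure M (B n) \<le> ennreal (C * (1/2) ^ n)"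
  shows "AE x in M. \<forall>\<^sub>F n in sequentially. x \<notin> B n"
proof -
  have C: "measure M (B n) \<le> \<bar>C\<bar> * (1/2) ^ n" for n
  proof -
    have "emeasure M (B n) \<le> ennreal (\<bar>C\<bar> * (1/2) ^ n)"
      by (rule order_trans[OF assms(2)]) (intro ennreal_leI mult_right_mono, auto)
    then show ?thesis unfolding measure_def by (intro enn2real_leI) auto
  qed
  have "AE x in M. \<forall>\<^sub>F n in sequentially. x \<in> space M - B n"
  proof (rule borel_cantelli_AE1[OF assms(1)])
    show "emeasure M (B n) < \<infinity>" for n using assms(2)[of n] by (rule le_less_trans) simp
    show "summable (\<lambda>n. measure M (B n))"
    proof (rule summable_comparison_test)
      show "summable (\<lambda>n. \<bar>C\<bar> * (1/2) ^ n)" by (intro summable_mult summable_geometric) simp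
      show "\<exists>N. \<forall>n\<ge>N. norm (measure M (B n)) \<le> \<bar>C\<bar> * (1/2) ^ n" using C by auto
    qed
  qed
  then show ?thesis by eventually_elim (auto elim: eventually_mono)
qed

lemma hat_test_function:
  "test_function (\<lambda>x::real. max 0 (min 1 (min (x + 1) (2 - x))))"
proof (rule test_functionI[where L = 1])
  fix x y :: real
  show "\<bar>max 0 (min 1 (min (x + 1) (2 - x))) - max 0 (min 1 (min (y + 1) (2 - y)))\<bar> \<le> 1 * \<bar>x - y\<bar>"
    by (auto simp: min_def max_def abs_if)
qed auto

lemma test_function_approximation_bounded:
  assumes u: "u \<in> borel_measurable lebesgue" "\<And>x. 0 \<le> u x" "\<And>x. u x \<le> N"
    and supp: "\<And>x. x \<notin> {0..1} \<Longrightarrow> u x = 0" and \<alpha>: "1 \<le> \<alpha>" and e: "0 < e"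
  obtains v where "test_function v" "\<And>x. 0 \<le> v x" "(\<integral>\<^sup>+x. ennreal \<bar>u x - v x\<bar> \<partial>lborel) < ennreal e"
    "(\<integral>\<^sup>+x. ennreal \<bar>u x powr \<alpha> - v x powr \<alpha>\<bar> \<partial>lborel) < ennreal e"
proof -
  define h where "h = (\<lambda>x::real. max 0 (min 1 (min (x + 1) (2 - x))))"
  have h: "test_function h" "\<And>x. 0 \<le> h x" "\<And>x. h x \<le> 1" "\<And>x. x \<in> {0..1} \<Longrightarrow> h x = 1"
    unfolding h_def using hat_test_function by auto
  have N0: "0 \<le> N" using u(2,3) order_trans by blast
  have "\<bar>u x\<bar> \<le> N" for x using u(2,3)[of x] by simp
  with u(1) obtain q C where q: "\<And>n::nat. (C n)-lipschitz_on {-1..2} (q n)" "\<And>n x. \<bar>q n x\<bar> \<le> N"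
      "AE x in lborel. x \<in> {-1..2} \<longrightarrow> (\<lambda>n. q n x) \<longlonglongrightarrow> u x"
    by (rule bounded_lipschitz_approximation) blast
  define v where "v = (\<lambda>n x. h x * max 0 (q n x))"
  have v: "test_function (v n)" for n unfolding v_def
  proof (rule test_function_mult[OF h(1)])
    show "(C n)-lipschitz_on {-1..2} (\<lambda>x. max 0 (q n x))"
    proof (rule lipschitz_onI)
      fix x y :: real assume xy: "x \<in> {-1..2}" "y \<in> {-1..2}"
      have "dist (max 0 (q n x)) (max 0 (q n y)) \<le> dist (q n x) (q n y)" unfolding dist_real_def by linarith
      also have "\<dots> \<le> C n * dist x y" by (rule lipschitz_onD[OF q(1) xy])
      finally show "dist (max 0 (q n x)) (max 0 (q n y)) \<le> C n * dist x y" .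
    qed (rule lipschitz_on_nonneg[OF q(1)])
  qed
  have v0: "0 \<le> v n x" for n x using h(2) by (simp add: v_def)
  have vN: "v n x \<le> N" for n x
  proof -
    have "h x * max 0 (q n x) \<le> 1 * N" using h q(2)[of n x] N0 by (intro mult_mono) auto
    then show ?thesis by (simp add: v_def)
  qed
  have vlim: "AE x in lborel. (\<lambda>n. v n x) \<longlonglongrightarrow> u x"
    using q(3)
  proof eventually_elim
    case (elim x)
    show ?case
    proof (cases "x \<in> {-1..2}")
      case True
      then have "(\<lambda>n. v n x) \<longlonglongrightarrow> h x * max 0 (u x)" unfolding v_def using elim by (intro tendsto_intros) auto
      moreover have "h x * max 0 (u x) = u x" using h(4)[of x] supp[of x] u(2)[of x] by (cases "x \<in> {0..1}") auto
      ultimately show ?thesis by (simp only:)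
    next
      case False
      then have "v n x = 0" for n using test_function_zero[OF v] by blast
      moreover have "u x = 0" using False by (intro supp) auto
      ultimately show ?thesis by simp
    qed
  qed
  have um [measurable]: "u \<in> borel_measurable lebesgue" by fact
  have vm [measurable]: "v n \<in> borel_measurable lebesgue" for n
    by (intro measurable_completion) (simp add: test_function_measurable[OF v])
  have out: "u x = 0" "v n x = 0" if "x \<notin> {-1..2}" for x n
    using that test_function_zero[OF v that] by (auto intro: supp)
  have lim: "(\<lambda>n. \<integral>\<^sup>+x. ennreal \<bar>\<phi> (u x) - \<phi> (v n x)\<bar> \<partial>lebesgue) \<longlonglongrightarrow> (\<integral>\<^sup>+x. 0 \<partial>(lebesgue :: real measure))"
    if \<phi>m: "\<phi> \<in> borel_measurable borel" and \<phi>: "continuous_on {0..} \<phi>" "\<And>s. s \<in> {0..N} \<Longrightarrow> 0 \<le> \<phi> s \<and> \<phi> s \<le> \<phi> N" "\<phi> 0 = 0"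
    for \<phi> :: "real \<Rightarrow> real"
  proof (rule nn_integral_dominated_convergence[where w = "\<lambda>x. ennreal (\<phi> N) * indicator {-1..2} x"])
    note [measurable] = measurable_compose[OF um \<phi>m] measurable_compose[OF vm \<phi>m] borel_measurable_lebesgue_ident
    show "(\<lambda>x. ennreal \<bar>\<phi> (u x) - \<phi> (v n x)\<bar>) \<in> borel_measurable lebesgue" for n by measurable
    show "(\<lambda>x. ennreal (\<phi> N) * indicator {-1..2::real} x) \<in> borel_measurable lebesgue"
      by (intro borel_measurable_times_ennreal borel_measurable_const borel_measurable_indicator) auto
    show "(\<integral>\<^sup>+x. ennreal (\<phi> N) * indicator {-1..2::real} x \<partial>lebesgue) < \<infinity>"
      unfolding nn_integral_completion by (simp add: nn_integral_cmult_indicator ennreal_mult_less_top)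
    show "AE x in lebesgue. ennreal \<bar>\<phi> (u x) - \<phi> (v n x)\<bar> \<le> ennreal (\<phi> N) * indicator {-1..2} x" for n
    proof (rule AE_I2)
      fix x
      show "ennreal \<bar>\<phi> (u x) - \<phi> (v n x)\<bar> \<le> ennreal (\<phi> N) * indicator {-1..2} x"
      proof (cases "x \<in> {-1..2}")
        case True
        have "\<bar>\<phi> (u x) - \<phi> (v n x)\<bar> \<le> \<phi> N"
          using \<phi>(2)[of "u x"] \<phi>(2)[of "v n x"] u(2,3) v0 vN by (auto simp: abs_le_iff)
        then show ?thesis using True by (simp add: ennreal_leI)
      qed (use out[of x] in simp)
    qed
    have "AE x in lebesgue. (\<lambda>n. v n x) \<longlonglongrightarrow> u x" using vlim by (simp add: AE_completion_iff)
    then show "AE x in lebesgue. (\<lambda>n. ennreal \<bar>\<phi> (u x) - \<phi> (v n x)\<bar>) \<longlonglongrightarrow> 0"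
    proof eventually_elim
      case (elim x)
      have "(\<lambda>n. \<phi> (v n x)) \<longlonglongrightarrow> \<phi> (u x)"
        using u(2) v0 by (intro continuous_on_tendsto_compose[OF \<phi>(1) elim]) auto
      from tendsto_rabs[OF tendsto_diff[OF tendsto_const this, of "\<phi> (u x)"]]
      show ?case using tendsto_ennrealI by fastforce
    qed
  qed measurable
  have l1: "(\<lambda>n. \<integral>\<^sup>+x. ennreal \<bar>u x - v n x\<bar> \<partial>lborel) \<longlonglongrightarrow> 0"
    using lim[of "\<lambda>s. s"] N0 by (simp add: nn_integral_completion)
  have l2: "(\<lambda>n. \<integral>\<^sup>+x. ennreal \<bar>u x powr \<alpha> - v n x powr \<alpha>\<bar> \<partial>lborel) \<longlonglongrightarrow> 0"
  proof -
    have "continuous_on {0..} (\<lambda>s::real. s powr \<alpha>)" using \<alpha> by (intro continuous_on_powr' continuous_intros) auto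
    then show ?thesis using lim[of "\<lambda>s. s powr \<alpha>"] \<alpha> by (simp add: nn_integral_completion powr_mono2)
  qed
  have "\<forall>\<^sub>F n in sequentially. (\<integral>\<^sup>+x. ennreal \<bar>u x - v n x\<bar> \<partial>lborel) < ennreal e
     \<and> (\<integral>\<^sup>+x. ennreal \<bar>u x powr \<alpha> - v n x powr \<alpha>\<bar> \<partial>lborel) < ennreal e"
    using order_tendstoD(2)[OF l1, of "ennreal e"] order_tendstoD(2)[OF l2, of "ennreal e"] e
    by (intro eventually_conj) auto
  then obtain n where "(\<integral>\<^sup>+x. ennreal \<bar>u x - v n x\<bar> \<partial>lborel) < ennreal e"
     "(\<integral>\<^sup>+x. ennreal \<bar>u x powr \<alpha> - v n x powr \<alpha>\<bar> \<partial>lborel) < ennreal e"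
    using eventually_happens'[OF sequentially_bot] by blast
  then show ?thesis using that[of "v n"] v v0 by blast
qed

text \<open>
  The weight is first truncated at a height, which is harmless by dominated convergence, and then
  approximated boundedly and almost everywhere. The approximation of \<open>w\<^sup>\<alpha>\<close> is what controls the maximal
  function in the limit.
\<close>
lemma test_function_approximation:
  assumes w: "weight w" and supp: "\<And>x. x \<notin> {0..1} \<Longrightarrow> w x = 0" and \<alpha>: "1 \<le> \<alpha>"
    and fin: "(\<integral>\<^sup>+x. ennreal (w x powr \<alpha>) \<partial>lborel) < \<infinity>" "(\<integral>\<^sup>+x. ennreal (w x) \<partial>lborel) < \<infinity>" and e: "0 < e"
  obtains v where "test_function v" "\<And>x. 0 \<le> v x" "(\<integral>\<^sup>+x. ennreal \<bar>w x - v x\<bar> \<partial>lborel) \<le> ennreal e"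
    "(\<integral>\<^sup>+x. ennreal \<bar>w x powr \<alpha> - v x powr \<alpha>\<bar> \<partial>lborel) \<le> ennreal e"
proof -
  have wm [measurable]: "w \<in> borel_measurable lebesgue" and w0: "\<And>x. 0 \<le> w x"
    using w by (auto simp: weight_def)
  define u where "u = (\<lambda>(n::nat) x. min (w x) (real n))"
  have um [measurable]: "u n \<in> borel_measurable lebesgue" for n unfolding u_def by measurable
  have u: "0 \<le> u n x" "u n x \<le> w x" "u n x \<le> real n" for n x using w0 by (auto simp: u_def)
  have ulim: "(\<lambda>n. u n x) \<longlonglongrightarrow> w x" for x
  proof (rule tendsto_eventually)
    obtain k where "w x \<le> real k" using real_arch_simple by blast
    then show "\<forall>\<^sub>F n in sequentially. u n x = w x"
      unfolding u_def eventually_sequentially by (intro exI[of _ k]) auto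
  qed
  have l1: "(\<lambda>n. \<integral>\<^sup>+x. ennreal \<bar>w x - u n x\<bar> \<partial>lebesgue) \<longlonglongrightarrow> (\<integral>\<^sup>+x. 0 \<partial>(lebesgue :: real measure))"
  proof (rule nn_integral_dominated_convergence[where w = "\<lambda>x. ennreal (w x)"])
    show "(\<integral>\<^sup>+x. ennreal (w x) \<partial>lebesgue) < \<infinity>" using fin(2) by (simp add: nn_integral_completion)
    show "AE x in lebesgue. ennreal \<bar>w x - u n x\<bar> \<le> ennreal (w x)" for n
      using u w0 by (intro AE_I2 ennreal_leI) (simp add: abs_le_iff)
    show "AE x in lebesgue. (\<lambda>n. ennreal \<bar>w x - u n x\<bar>) \<longlonglongrightarrow> 0"
    proof (rule AE_I2)
      fix x
      show "(\<lambda>n. ennreal \<bar>w x - u n x\<bar>) \<longlonglongrightarrow> 0"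
        using tendsto_ennrealI[OF tendsto_rabs[OF tendsto_diff[OF tendsto_const ulim[of x], of "w x"]]] by simp
    qed
  qed measurable
  have l2: "(\<lambda>n. \<integral>\<^sup>+x. ennreal \<bar>w x powr \<alpha> - u n x powr \<alpha>\<bar> \<partial>lebesgue) \<longlonglongrightarrow> (\<integral>\<^sup>+x. 0 \<partial>(lebesgue :: real measure))"
  proof (rule nn_integral_dominated_convergence[where w = "\<lambda>x. ennreal (w x powr \<alpha>)"])
    show "(\<integral>\<^sup>+x. ennreal (w x powr \<alpha>) \<partial>lebesgue) < \<infinity>" using fin(1) by (simp add: nn_integral_completion)
    show "AE x in lebesgue. ennreal \<bar>w x powr \<alpha> - u n x powr \<alpha>\<bar> \<le> ennreal (w x powr \<alpha>)" for n
    proof (intro AE_I2 ennreal_leI)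
      fix x
      have "u n x powr \<alpha> \<le> w x powr \<alpha>" using u \<alpha> by (intro powr_mono2) auto
      then show "\<bar>w x powr \<alpha> - u n x powr \<alpha>\<bar> \<le> w x powr \<alpha>" by simp
    qed
    show "AE x in lebesgue. (\<lambda>n. ennreal \<bar>w x powr \<alpha> - u n x powr \<alpha>\<bar>) \<longlonglongrightarrow> 0"
    proof (rule AE_I2)
      fix x
      have "(\<lambda>n. u n x powr \<alpha>) \<longlonglongrightarrow> w x powr \<alpha>"
        using \<alpha> u by (intro tendsto_powr' ulim tendsto_const) (auto intro: always_eventually)
      from tendsto_ennrealI[OF tendsto_rabs[OF tendsto_diff[OF tendsto_const this, of "w x powr \<alpha>"]]]
      show "(\<lambda>n. ennreal \<bar>w x powr \<alpha> - u n x powr \<alpha>\<bar>) \<longlonglongrightarrow> 0" by simp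
    qed
  qed measurable
  have e2: "0 < ennreal (e / 2)" using e by simp
  have "\<forall>\<^sub>F n in sequentially. (\<integral>\<^sup>+x. ennreal \<bar>w x - u n x\<bar> \<partial>lebesgue) < ennreal (e / 2)
     \<and> (\<integral>\<^sup>+x. ennreal \<bar>w x powr \<alpha> - u n x powr \<alpha>\<bar> \<partial>lebesgue) < ennreal (e / 2)"
    using order_tendstoD(2)[OF l1, of "ennreal (e / 2)"] order_tendstoD(2)[OF l2, of "ennreal (e / 2)"] e2
    by (intro eventually_conj) auto
  then obtain n where n: "(\<integral>\<^sup>+x. ennreal \<bar>w x - u n x\<bar> \<partial>lebesgue) < ennreal (e / 2)"
     "(\<integral>\<^sup>+x. ennreal \<bar>w x powr \<alpha> - u n x powr \<alpha>\<bar> \<partial>lebesgue) < ennreal (e / 2)"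
    using eventually_happens'[OF sequentially_bot] by blast
  have u_supp: "u n x = 0" if "x \<notin> {0..1}" for x using supp[OF that] by (simp add: u_def)
  have e_half: "0 < e / 2" using e by simp
  obtain v where v: "test_function v" "\<And>x. 0 \<le> v x"
     "(\<integral>\<^sup>+x. ennreal \<bar>u n x - v x\<bar> \<partial>lborel) < ennreal (e / 2)"
     "(\<integral>\<^sup>+x. ennreal \<bar>u n x powr \<alpha> - v x powr \<alpha>\<bar> \<partial>lborel) < ennreal (e / 2)"
    by (rule test_function_approximation_bounded[OF um u(1) u(3) u_supp \<alpha> e_half]) (assumption | blast)+
  have [measurable]: "v \<in> borel_measurable lebesgue"
    by (intro measurable_completion) (simp add: test_function_measurable[OF v(1)])
  have tri: "(\<integral>\<^sup>+x. ennreal \<bar>f x - h x\<bar> \<partial>lborel) \<le> ennreal e"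
    if [measurable]: "f \<in> borel_measurable lebesgue" "g \<in> borel_measurable lebesgue" "h \<in> borel_measurable lebesgue"
      and "(\<integral>\<^sup>+x. ennreal \<bar>f x - g x\<bar> \<partial>lebesgue) < ennreal (e / 2)" "(\<integral>\<^sup>+x. ennreal \<bar>g x - h x\<bar> \<partial>lborel) < ennreal (e / 2)"
    for f g h :: "real \<Rightarrow> real"
  proof -
    have "(\<integral>\<^sup>+x. ennreal \<bar>f x - h x\<bar> \<partial>lebesgue) \<le> (\<integral>\<^sup>+x. ennreal \<bar>f x - g x\<bar> + ennreal \<bar>g x - h x\<bar> \<partial>lebesgue)"
      by (intro nn_integral_mono) (auto simp: ennreal_plus[symmetric] intro!: ennreal_leI simp del: ennreal_plus)
    also have "\<dots> = (\<integral>\<^sup>+x. ennreal \<bar>f x - g x\<bar> \<partial>lebesgue) + (\<integral>\<^sup>+x. ennreal \<bar>g x - h x\<bar> \<partial>lebesgue)"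
      by (rule nn_integral_add) measurable
    also have "\<dots> \<le> ennreal (e / 2) + ennreal (e / 2)"
      using that(4,5) by (intro add_mono less_imp_le) (simp_all add: nn_integral_completion)
    also have "\<dots> = ennreal e" using e by (simp add: ennreal_plus[symmetric] del: ennreal_plus)
    finally show ?thesis by (simp add: nn_integral_completion)
  qed
  have "(\<integral>\<^sup>+x. ennreal \<bar>w x - v x\<bar> \<partial>lborel) \<le> ennreal e"
    by (rule tri[OF _ _ _ n(1) v(3)]) measurable
  moreover have "(\<integral>\<^sup>+x. ennreal \<bar>w x powr \<alpha> - v x powr \<alpha>\<bar> \<partial>lborel) \<le> ennreal e"
    by (rule tri[OF _ _ _ n(2) v(4)]) measurable
  ultimately show ?thesis using that v by blast
qed

section \<open>The estimate for general weights\<close>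

lemma ennreal_inverse_antimono: "a \<le> b \<Longrightarrow> inverse b \<le> inverse a" for a b :: ennreal
proof (cases a; cases b)
  fix x y :: real assume "a \<le> b" "0 \<le> x" "a = ennreal x" "0 \<le> y" "b = ennreal y"
  then show ?thesis by (cases "x = 0") (auto simp: inverse_ennreal intro!: ennreal_leI le_imp_inverse_le)
qed (auto simp: top_unique)

lemma hilbert_density_ge:
  assumes "interval_maximal (\<lambda>y. ennreal (w y powr (r / (2 - r)))) x \<le> ennreal s" "0 < s" "0 < r"
  shows "ennreal (w x powr (r / (2 - r)) * s powr (- (2 / r)) * (hilbert w x)\<^sup>2) \<le> hilbert_density r w x"
proof -
  have "ennreal (w x powr (r / (2 - r)) * s powr (- (2 / r)) * (hilbert w x)\<^sup>2)
     = (ennreal \<bar>hilbert w x\<bar> / ennpowr (ennreal s) (1 / r))\<^sup>2 * ennreal (w x powr (r / (2 - r)))"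
    using assms(2) by (intro hilbert_quotient_eq[symmetric]) auto
  also have "\<dots> \<le> hilbert_density r w x"
    unfolding hilbert_density_def divide_ennreal_def using assms
    by (intro mult_right_mono power_mono mult_left_mono ennreal_inverse_antimono ennpowr_mono) auto
  finally show ?thesis .
qed

lemma borel_measurable_hilbert_density:
  assumes v: "test_function v" "\<And>x. 0 \<le> v x" and r: "1 < r" "r < 2"
  shows "hilbert_density r v \<in> borel_measurable borel"
proof -
  define \<alpha> where "\<alpha> = r / (2 - r)"
  have "1 \<le> \<alpha>" using r by (simp add: \<alpha>_def field_simps)
  then have "test_function (\<lambda>x. v x powr \<alpha>)" by (intro test_function_powr v)
  then obtain S L where S: "\<And>x. interval_maximal (\<lambda>y. ennreal (v y powr \<alpha>)) x = ennreal (S x)"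
    and L: "0 \<le> L" "\<And>x y. \<bar>S x - S y\<bar> \<le> L * \<bar>x - y\<bar>"
    by (rule test_function_interval_maximal_Lipschitz) (auto)
  have "L-lipschitz_on UNIV S" using L by (intro lipschitz_onI) (auto simp: dist_real_def)
  then have [measurable]: "S \<in> borel_measurable borel"
    by (intro borel_measurable_continuous_onI lipschitz_on_continuous_on)
  note [measurable] = test_function_measurable[OF v(1)] borel_measurable_hilbert[OF test_function_integrable(2)[OF v(1)]]
  have "hilbert_density r v = (\<lambda>x. (ennreal \<bar>hilbert v x\<bar> / ennpowr (ennreal (S x)) (1 / r))\<^sup>2 * ennreal (v x powr \<alpha>))"
    unfolding hilbert_density_def[abs_def] \<alpha>_def[symmetric] S ..
  also have "\<dots> \<in> borel_measurable borel" by measurable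
  finally show ?thesis .
qed

text \<open>
  At a point where the transforms of \<open>w - v n\<close> and the maximal functions of \<open>\<bar>w\<^sup>\<alpha> - (v n)\<^sup>\<alpha>\<bar>\<close> tend to 0,
  \<open>H(v n)\<close> tends to \<open>Hw\<close>, and the maximal functions of \<open>(v n)\<^sup>\<alpha>\<close> exceed that of \<open>w\<^sup>\<alpha>\<close> by at most a null sequence.
  The density of \<open>w\<close> vanishes at the remaining points: those without a principal value, with \<open>w x = 0\<close>, or with
  an infinite maximal function.
\<close>
lemma hilbert_density_le_liminf:
  fixes v :: "nat \<Rightarrow> real \<Rightarrow> real"
  assumes r: "1 < r" "r < 2" and w: "integrable lebesgue w" and v: "\<And>n. test_function (v n)" "\<And>n x. 0 \<le> v n x"
    and meas: "w \<in> borel_measurable lebesgue" and w0: "\<And>x. 0 \<le> w x"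
    and pos: "0 < w x \<Longrightarrow> 0 < interval_maximal (\<lambda>y. ennreal (w y powr (r / (2 - r)))) x"
    and H: "\<forall>\<^sub>F n in sequentially. \<bar>hilbert (\<lambda>y. w y - v n y) x\<bar> \<le> (1/2) ^ n"
    and M: "\<forall>\<^sub>F n in sequentially. interval_maximal (\<lambda>y. ennreal \<bar>w y powr (r / (2 - r)) - v n y powr (r / (2 - r))\<bar>) x \<le> ennreal ((1/2) ^ n)"
    and W: "\<forall>\<^sub>F n in sequentially. \<bar>w x - v n x\<bar> \<le> (1/2) ^ n"
    and pv: "no_pv_value = 0 \<or> has_pv w x"
  shows "hilbert_density r w x \<le> liminf (\<lambda>n. hilbert_density r (v n) x)"
proof -
  define \<alpha> where "\<alpha> = r / (2 - r)"
  have \<alpha>: "1 \<le> \<alpha>" using r by (simp add: \<alpha>_def field_simps)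
  let ?M = "\<lambda>u. interval_maximal (\<lambda>y. ennreal (u y powr \<alpha>)) x"
  have geo: "(\<lambda>n. (1/2::real) ^ n) \<longlonglongrightarrow> 0" by (rule LIMSEQ_realpow_zero) auto
  consider "\<not> has_pv w x" | "w x = 0" | "?M w = top" | s where "has_pv w x" "0 < w x" "0 < s" "?M w = ennreal s"
  proof (cases "has_pv w x \<and> w x \<noteq> 0 \<and> ?M w \<noteq> top")
    case True
    then have "0 < w x" using w0[of x] by simp
    moreover obtain s where "0 \<le> s" "?M w = ennreal s" using True by (cases "?M w") auto
    ultimately show ?thesis using pos that(4)[of s] True unfolding \<alpha>_def by auto
  qed (use that in blast)
  then show ?thesis
  proof cases
    case 1
    then have "hilbert w x = 0" using pv hilbert_no_pv by auto
    then show ?thesis by (simp add: hilbert_density_def)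
  next
    case 2
    then show ?thesis by (simp add: hilbert_density_eq_0)
  next
    case 3
    then show ?thesis by (simp add: hilbert_density_def \<alpha>_def)
  next
    case 4
    have vm: "v n \<in> borel_measurable lebesgue" for n
      by (intro measurable_completion) (simp add: test_function_measurable[OF v(1)])
    have Hlim: "(\<lambda>n. hilbert (v n) x) \<longlonglongrightarrow> hilbert w x"
    proof -
      have "has_pv (v n) x" for n using v(1)[of n] by (rule test_function_pv) blast
      then have eq: "hilbert (\<lambda>y. w y - v n y) x = hilbert w x - hilbert (v n) x" for n
        using 4(1) w test_function_integrable(2)[OF v(1)] by (intro hilbert_diff) auto
      have "(\<lambda>n. hilbert w x - hilbert (v n) x) \<longlonglongrightarrow> 0"
        using H unfolding eq by (intro Lim_null_comparison[OF _ geo]) simp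
      from tendsto_diff[OF tendsto_const this, of "hilbert w x"] show ?thesis by simp
    qed
    have wlim: "(\<lambda>n. v n x) \<longlonglongrightarrow> w x"
    proof -
      have "(\<lambda>n. w x - v n x) \<longlonglongrightarrow> 0" using W by (intro Lim_null_comparison[OF _ geo]) simp
      from tendsto_diff[OF tendsto_const this, of "w x"] show ?thesis by simp
    qed
    define s' where "s' = (\<lambda>n. s + (1/2) ^ n)"
    have s': "0 < s' n" for n using 4(3) unfolding s'_def by (intro add_pos_nonneg) auto
    have slim: "s' \<longlonglongrightarrow> s" unfolding s'_def using tendsto_add[OF tendsto_const geo, of s] by simp
    have Mn: "\<forall>\<^sub>F n in sequentially. ?M (v n) \<le> ennreal (s' n)"
      using M
    proof eventually_elim
      case (elim n)
      have "?M (v n) \<le> interval_maximal (\<lambda>y. ennreal (w y powr \<alpha>) + ennreal \<bar>w y powr \<alpha> - v n y powr \<alpha>\<bar>) x"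
        by (rule interval_maximal_mono) (auto simp: ennreal_plus[symmetric] intro!: ennreal_leI simp del: ennreal_plus)
      also have "\<dots> \<le> ?M w + interval_maximal (\<lambda>y. ennreal \<bar>w y powr \<alpha> - v n y powr \<alpha>\<bar>) x"
      proof (rule interval_maximal_add_le)
        note [measurable] = meas vm
        show "(\<lambda>y. ennreal (w y powr \<alpha>)) \<in> borel_measurable lebesgue"
          "(\<lambda>y. ennreal \<bar>w y powr \<alpha> - v n y powr \<alpha>\<bar>) \<in> borel_measurable lebesgue" by measurable
      qed
      also have "\<dots> \<le> ennreal s + ennreal ((1/2) ^ n)"
        unfolding 4(4) using elim unfolding \<alpha>_def by (intro add_left_mono) simp
      also have "\<dots> = ennreal (s' n)" unfolding s'_def using 4(3) by (intro ennreal_plus[symmetric]) auto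
      finally show ?case .
    qed
    have lim: "(\<lambda>n. ennreal (v n x powr \<alpha> * s' n powr (- (2 / r)) * (hilbert (v n) x)\<^sup>2))
       \<longlonglongrightarrow> ennreal (w x powr \<alpha> * s powr (- (2 / r)) * (hilbert w x)\<^sup>2)"
      using 4(2,3) by (intro tendsto_ennrealI tendsto_intros wlim slim Hlim) auto
    have "hilbert_density r w x = ennreal (w x powr \<alpha> * s powr (- (2 / r)) * (hilbert w x)\<^sup>2)"
      unfolding \<alpha>_def by (rule hilbert_density_eq_ennreal) (use 4 r in \<open>simp_all add: \<alpha>_def\<close>)
    also have "\<dots> = liminf (\<lambda>n. ennreal (v n x powr \<alpha> * s' n powr (- (2 / r)) * (hilbert (v n) x)\<^sup>2))"
      by (rule lim_imp_Liminf[OF sequentially_bot lim, symmetric])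
    also have "\<dots> \<le> liminf (\<lambda>n. hilbert_density r (v n) x)"
      by (rule Liminf_mono, use Mn in eventually_elim)
         (unfold \<alpha>_def, rule hilbert_density_ge, use s' r in \<open>auto simp: \<alpha>_def\<close>)
    finally show ?thesis .
  qed
qed

text \<open>
  If \<open>w\<^sup>\<alpha>\<close> is not integrable, then \<open>M\<^sub>\<alpha> w\<close> is infinite on \<open>[0, 1]\<close> and the left-hand side is 0. Otherwise take
  test functions \<open>v n\<close> with errors \<open>4 powr (- n)\<close> in \<open>L\<^sup>1\<close>; the weak type inequalities bound the measures of the
  exceptional sets at level \<open>2 powr (- n)\<close> by a multiple of \<open>2 powr (- n)\<close>, and the Borel-Cantelli lemma gives
  almost everywhere convergence.
\<close>
lemma hilbert_density_estimate:
  assumes hyp: "weak_type_bound r A" and A: "0 \<le> A" and r: "1 < r" "r < 2" and C: "0 < C"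
    and test: "\<And>v. test_function v \<Longrightarrow> (\<And>x. 0 \<le> v x) \<Longrightarrow>
      (\<integral>\<^sup>+x. hilbert_density r v x \<partial>lborel) \<le> ennreal C * (\<integral>\<^sup>+x. ennreal (v x) \<partial>lborel)"
    and w: "weight w" and supp: "\<And>x. x \<notin> {0..1} \<Longrightarrow> w x = 0"
  shows "(\<integral>\<^sup>+x. hilbert_density r w x \<partial>lborel) \<le> ennreal C * (\<integral>\<^sup>+x. ennreal (w x) \<partial>lborel)"
proof -
  define \<alpha> where "\<alpha> = r / (2 - r)"
  have \<alpha>: "1 \<le> \<alpha>" using r by (simp add: \<alpha>_def field_simps)
  have wm [measurable]: "w \<in> borel_measurable lebesgue" and w0: "\<And>x. 0 \<le> w x" using w by (auto simp: weight_def)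
  have supp': "(\<integral>\<^sup>+x\<in>{0..1}. ennreal (w x powr \<alpha>) \<partial>lebesgue) = (\<integral>\<^sup>+x. ennreal (w x powr \<alpha>) \<partial>lborel)"
    unfolding nn_integral_completion using supp by (intro nn_integral_cong) (auto simp: indicator_def)
  have avg: "(\<integral>\<^sup>+x. ennreal (w x powr \<alpha>) \<partial>lborel) \<le> interval_maximal (\<lambda>y. ennreal (w y powr \<alpha>)) x" if "x \<in> {0..1}" for x
    using interval_maximal_ge_average[of 0 1 x "\<lambda>y. ennreal (w y powr \<alpha>)"] that unfolding supp' by (simp add: divide_ennreal_def)
  show ?thesis
  proof (cases "(\<integral>\<^sup>+x. ennreal (w x powr \<alpha>) \<partial>lborel) = \<infinity>")
    case True
    have "hilbert_density r w x = 0" for x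
    proof (cases "x \<in> {0..1}")
      case x: True
      have "interval_maximal (\<lambda>y. ennreal (w y powr \<alpha>)) x = top"
        using avg[OF x] True by (simp add: top_unique)
      then show ?thesis by (simp add: hilbert_density_def \<alpha>_def)
    qed (simp add: hilbert_density_eq_0 supp)
    then show ?thesis by simp
  next
    case False
    then have fin1: "(\<integral>\<^sup>+x. ennreal (w x powr \<alpha>) \<partial>lborel) < \<infinity>" by (simp add: less_top)
    have fin2: "(\<integral>\<^sup>+x. ennreal (w x) \<partial>lborel) < \<infinity>"
    proof -
      have "(\<integral>\<^sup>+x. ennreal (w x) \<partial>lebesgue) \<le> (\<integral>\<^sup>+x. indicator {0..1} x + ennreal (w x powr \<alpha>) \<partial>lebesgue)"
      proof (rule nn_integral_mono)
        fix x
        have "w x \<le> 1 + w x powr \<alpha>"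
        proof (cases "w x \<le> 1")
          case False
          then have "w x powr 1 \<le> w x powr \<alpha>" using \<alpha> by (intro powr_mono) auto
          then show ?thesis using False by simp
        qed (simp add: add_increasing2)
        then have "ennreal (w x) \<le> 1 + ennreal (w x powr \<alpha>)"
          by (metis ennreal_1 ennreal_leI ennreal_plus powr_ge_zero zero_le_one)
        then show "ennreal (w x) \<le> indicator {0..1} x + ennreal (w x powr \<alpha>)"
          using supp[of x] by (cases "x \<in> {0..1}") auto
      qed
      also have "\<dots> = (\<integral>\<^sup>+x. indicator {0..1::real} x \<partial>lebesgue) + (\<integral>\<^sup>+x. ennreal (w x powr \<alpha>) \<partial>lebesgue)"
        by (rule nn_integral_add) (auto intro!: borel_measurable_indicator)
      also have "\<dots> < \<infinity>" using fin1 by (simp add: nn_integral_completion)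
      finally show ?thesis by (simp add: nn_integral_completion)
    qed
    have wint: "integrable lebesgue w"
      unfolding integrable_iff_bounded nn_integral_completion using fin2 w0 by simp
    define P where "P = (\<lambda>n v. test_function v \<and> (\<forall>x. 0 \<le> v x)
        \<and> (\<integral>\<^sup>+x. ennreal \<bar>w x - v x\<bar> \<partial>lborel) \<le> ennreal ((1/4) ^ n)
        \<and> (\<integral>\<^sup>+x. ennreal \<bar>w x powr \<alpha> - v x powr \<alpha>\<bar> \<partial>lborel) \<le> ennreal ((1/4) ^ n))"
    have "\<exists>v. P n v" for n
    proof -
      have "0 < (1/4::real) ^ n" by simp
      from test_function_approximation[OF w supp \<alpha> fin1 fin2 this]
      show ?thesis unfolding P_def by blast
    qed
    then obtain v where "\<And>n. P n (v n)" by metis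
    then have v: "\<And>n. test_function (v n)" "\<And>n x. 0 \<le> v n x"
      "\<And>n. (\<integral>\<^sup>+x. ennreal \<bar>w x - v n x\<bar> \<partial>lborel) \<le> ennreal ((1/4) ^ n)"
      "\<And>n. (\<integral>\<^sup>+x. ennreal \<bar>w x powr \<alpha> - v n x powr \<alpha>\<bar> \<partial>lborel) \<le> ennreal ((1/4) ^ n)"
      unfolding P_def by blast+
    have vm [measurable]: "v n \<in> borel_measurable lebesgue" for n
      by (intro measurable_completion) (simp add: test_function_measurable[OF v(1)])
    have quarter: "(2::real) ^ n * (1/4) ^ n = (1/2) ^ n" for n by (simp add: power_mult_distrib[symmetric])
    have diff: "integrable lebesgue (\<lambda>y. w y - v n y)" for n
      using wint test_function_integrable(2)[OF v(1)] by (rule Bochner_Integration.integrable_diff)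
    have "AE x in lborel. \<forall>\<^sub>F n in sequentially. x \<notin> {x. (1/2) ^ n < \<bar>hilbert (\<lambda>y. w y - v n y) x\<bar>}"
    proof (rule AE_eventually_not_in_of_geometric_measure)
      fix n
      note [measurable] = borel_measurable_hilbert[OF diff]
      show "{x. (1/2) ^ n < \<bar>hilbert (\<lambda>y. w y - v n y) x\<bar>} \<in> sets lborel" by measurable
      let ?e = "emeasure lborel {x. (1/2) ^ n < \<bar>hilbert (\<lambda>y. w y - v n y) x\<bar>}"
      have "ennreal ((1/2) ^ n) * ?e \<le> ennreal A * (\<integral>\<^sup>+x. ennreal \<bar>w x - v n x\<bar> \<partial>lborel)"
        by (rule weak_type_bound_lebesgue[OF hyp _ A diff]) (use r in auto)
      also have "\<dots> \<le> ennreal A * ennreal ((1/4) ^ n)" by (intro mult_left_mono v) simp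
      finally have "ennreal (2 ^ n) * (ennreal ((1/2) ^ n) * ?e) \<le> ennreal (2 ^ n) * (ennreal A * ennreal ((1/4) ^ n))"
        by (rule mult_left_mono) simp
      moreover have "ennreal (2 ^ n) * (ennreal ((1/2) ^ n) * ?e) = ?e"
      proof -
        have "ennreal (2 ^ n) * ennreal ((1/2) ^ n) = 1" by (simp add: ennreal_mult[symmetric] power_mult_distrib[symmetric])
        then show ?thesis by (simp add: mult.assoc[symmetric])
      qed
      moreover have "ennreal (2 ^ n) * (ennreal A * ennreal ((1/4) ^ n)) = ennreal (A * (1/2) ^ n)"
        using A by (simp add: ennreal_mult[symmetric] quarter[symmetric] mult_ac)
      ultimately show "?e \<le> ennreal (A * (1/2) ^ n)" by simp
    qed
    then have AE_H: "AE x in lborel. \<forall>\<^sub>F n in sequentially. \<bar>hilbert (\<lambda>y. w y - v n y) x\<bar> \<le> (1/2) ^ n"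
      by (simp add: not_less)
    have AE_M: "AE x in lborel. \<forall>\<^sub>F n in sequentially.
       interval_maximal (\<lambda>y. ennreal \<bar>w y powr \<alpha> - v n y powr \<alpha>\<bar>) x \<le> ennreal ((1/2) ^ n)"
    proof -
      define F where "F = (\<lambda>n y. ennreal \<bar>w y powr \<alpha> - v n y powr \<alpha>\<bar>)"
      define R where "R = (\<lambda>n B. B \<in> sets borel \<and> {x. ennreal ((1/2) ^ n) < interval_maximal (F n) x} \<subseteq> B
         \<and> emeasure lborel B \<le> ennreal (2 * (1/2) ^ n))"
      have "\<exists>B. R n B" for n
      proof -
        have "F n \<in> borel_measurable lebesgue" unfolding F_def by measurable
        moreover have "0 < (1/2::real) ^ n" by simp
        ultimately obtain B where B: "B \<in> sets borel" "{x. ennreal ((1/2) ^ n) < interval_maximal (F n) x} \<subseteq> B"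
          "emeasure lborel B \<le> ennreal (2 / (1/2) ^ n) * (\<integral>\<^sup>+x. F n x \<partial>lborel)"
          by (rule interval_maximal_weak_type)
        have "emeasure lborel B \<le> ennreal (2 / (1/2) ^ n) * ennreal ((1/4) ^ n)"
          by (rule order_trans[OF B(3)], rule mult_left_mono) (simp_all add: F_def v)
        also have "\<dots> = ennreal (2 / (1/2) ^ n * (1/4) ^ n)" by (rule ennreal_mult[symmetric]) simp_all
        also have "2 / (1/2) ^ n * (1/4) ^ n = 2 * (1/2::real) ^ n"
        proof -
          have "2 / (1/2::real) ^ n = 2 * 2 ^ n" by (simp add: power_divide)
          then show ?thesis by (simp only: mult.assoc quarter)
        qed
        finally show ?thesis using B(1,2) unfolding R_def by blast
      qed
      then obtain B where "\<And>n. R n (B n)" by metis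
      then have B: "\<And>n. B n \<in> sets borel" "\<And>n. {x. ennreal ((1/2) ^ n) < interval_maximal (F n) x} \<subseteq> B n"
        "\<And>n. emeasure lborel (B n) \<le> ennreal (2 * (1/2) ^ n)" unfolding R_def by blast+
      have "AE x in lborel. \<forall>\<^sub>F n in sequentially. x \<notin> B n"
        by (rule AE_eventually_not_in_of_geometric_measure) (use B in auto)
      then have "AE x in lborel. \<forall>\<^sub>F n in sequentially. interval_maximal (F n) x \<le> ennreal ((1/2) ^ n)"
      proof eventually_elim
        case (elim x)
        then show ?case
        proof eventually_elim
          case (elim n)
          then have "x \<notin> {x. ennreal ((1/2) ^ n) < interval_maximal (F n) x}" using B(2)[of n] by blast
          then show ?case by simp
        qed
      qed
      then show ?thesis unfolding F_def .
    qed
    have AE_W: "AE x in lborel. \<forall>\<^sub>F n in sequentially. \<bar>w x - v n x\<bar> \<le> (1/2) ^ n"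
    proof -
      have "AE x in lebesgue. \<forall>\<^sub>F n in sequentially. x \<notin> {x \<in> space lebesgue. 1 \<le> ennreal (2 ^ n) * ennreal \<bar>w x - v n x\<bar>}"
      proof (rule AE_eventually_not_in_of_geometric_measure)
        fix n
        show "{x \<in> space lebesgue. 1 \<le> ennreal (2 ^ n) * ennreal \<bar>w x - v n x\<bar>} \<in> sets lebesgue" by measurable
        have "emeasure lebesgue {x \<in> space lebesgue. 1 \<le> ennreal (2 ^ n) * ennreal \<bar>w x - v n x\<bar>}
            \<le> ennreal (2 ^ n) * (\<integral>\<^sup>+x. ennreal \<bar>w x - v n x\<bar> \<partial>lebesgue)"
          using nn_integral_Markov_inequality[of "\<lambda>x. ennreal \<bar>w x - v n x\<bar>" UNIV lebesgue "ennreal (2 ^ n)"]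
          by simp
        also have "\<dots> \<le> ennreal (2 ^ n) * ennreal ((1/4) ^ n)"
          unfolding nn_integral_completion by (intro mult_left_mono v) simp
        also have "\<dots> = ennreal (1 * (1/2) ^ n)" by (simp add: ennreal_mult[symmetric] quarter)
        finally show "emeasure lebesgue {x \<in> space lebesgue. 1 \<le> ennreal (2 ^ n) * ennreal \<bar>w x - v n x\<bar>} \<le> ennreal (1 * (1/2) ^ n)" .
      qed
      then have "AE x in lborel. \<forall>\<^sub>F n in sequentially. x \<notin> {x \<in> space lebesgue. 1 \<le> ennreal (2 ^ n) * ennreal \<bar>w x - v n x\<bar>}"
        by (simp add: AE_completion_iff)
      then show ?thesis
      proof eventually_elim
        case (elim x)
        then show ?case
        proof eventually_elim
          case (elim n)
          then have "ennreal (2 ^ n * \<bar>w x - v n x\<bar>) < ennreal 1" by (simp add: not_le ennreal_mult)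
          then have "2 ^ n * \<bar>w x - v n x\<bar> < 1" by (subst (asm) ennreal_less_iff) auto
          then have "\<bar>w x - v n x\<bar> < 1 / 2 ^ n" by (simp add: field_simps)
          then show ?case by (simp add: power_divide)
        qed
      qed
    qed
    have AE_pv: "AE x in lborel. no_pv_value = 0 \<or> has_pv w x"
      using has_pv_AE_or_no_pv_value_eq_0[OF hyp _ A wint] r by auto
    have AE_pos: "AE x in lborel. 0 < w x \<longrightarrow> 0 < interval_maximal (\<lambda>y. ennreal (w y powr \<alpha>)) x"
    proof (cases "(\<integral>\<^sup>+x. ennreal (w x powr \<alpha>) \<partial>lborel) = 0")
      case True
      then have "AE x in lebesgue. ennreal (w x powr \<alpha>) = 0"
        by (subst nn_integral_0_iff_AE[symmetric]) (auto simp: nn_integral_completion)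
      then have "AE x in lborel. ennreal (w x powr \<alpha>) = 0" by (simp add: AE_completion_iff)
      then show ?thesis by eventually_elim auto
    next
      case False
      then have "0 < interval_maximal (\<lambda>y. ennreal (w y powr \<alpha>)) x" if "0 < w x" for x
        using avg[of x] supp[of x] that by (metis less_le_trans less_numeral_extra(3) not_gr_zero)
      then show ?thesis by simp
    qed
    have AE_le: "AE x in lborel. hilbert_density r w x \<le> liminf (\<lambda>n. hilbert_density r (v n) x)"
      using AE_H AE_M AE_W AE_pv AE_pos
    proof eventually_elim
      case (elim x)
      show ?case
        by (rule hilbert_density_le_liminf[OF r wint v(1,2) wm w0]) (use elim in \<open>auto simp: \<alpha>_def\<close>)
    qed
    have "(\<integral>\<^sup>+x. hilbert_density r w x \<partial>lborel) \<le> (\<integral>\<^sup>+x. liminf (\<lambda>n. hilbert_density r (v n) x) \<partial>lborel)"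
      by (rule nn_integral_mono_AE[OF AE_le])
    also have "\<dots> \<le> liminf (\<lambda>n. \<integral>\<^sup>+x. hilbert_density r (v n) x \<partial>lborel)"
      by (rule nn_integral_liminf) (simp add: borel_measurable_hilbert_density v r)
    also have "\<dots> \<le> liminf (\<lambda>n. ennreal C * ((\<integral>\<^sup>+x. ennreal (w x) \<partial>lborel) + ennreal ((1/4) ^ n)))"
    proof (intro Liminf_mono always_eventually allI)
      fix n
      have "(\<integral>\<^sup>+x. ennreal (v n x) \<partial>lebesgue) \<le> (\<integral>\<^sup>+x. ennreal (w x) + ennreal \<bar>w x - v n x\<bar> \<partial>lebesgue)"
        using w0 by (intro nn_integral_mono) (auto simp: ennreal_plus[symmetric] intro!: ennreal_leI simp del: ennreal_plus)
      also have "\<dots> = (\<integral>\<^sup>+x. ennreal (w x) \<partial>lebesgue) + (\<integral>\<^sup>+x. ennreal \<bar>w x - v n x\<bar> \<partial>lebesgue)"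
        by (rule nn_integral_add) measurable
      also have "\<dots> \<le> (\<integral>\<^sup>+x. ennreal (w x) \<partial>lebesgue) + ennreal ((1/4) ^ n)"
        using v(3)[of n] unfolding nn_integral_completion by (rule add_left_mono)
      finally have "(\<integral>\<^sup>+x. ennreal (v n x) \<partial>lborel) \<le> (\<integral>\<^sup>+x. ennreal (w x) \<partial>lborel) + ennreal ((1/4) ^ n)"
        unfolding nn_integral_completion .
      then have "ennreal C * (\<integral>\<^sup>+x. ennreal (v n x) \<partial>lborel) \<le> ennreal C * ((\<integral>\<^sup>+x. ennreal (w x) \<partial>lborel) + ennreal ((1/4) ^ n))"
        by (rule mult_left_mono) simp
      then show "(\<integral>\<^sup>+x. hilbert_density r (v n) x \<partial>lborel) \<le> ennreal C * ((\<integral>\<^sup>+x. ennreal (w x) \<partial>lborel) + ennreal ((1/4) ^ n))"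
        using test[OF v(1,2)] by (rule order_trans[rotated])
    qed
    also have "\<dots> = ennreal C * ((\<integral>\<^sup>+x. ennreal (w x) \<partial>lborel) + 0)"
    proof (rule lim_imp_Liminf)
      have "(\<lambda>n. ennreal ((1/4) ^ n)) \<longlonglongrightarrow> ennreal 0"
        by (intro tendsto_ennrealI LIMSEQ_realpow_zero) auto
      then show "(\<lambda>n. ennreal C * ((\<integral>\<^sup>+x. ennreal (w x) \<partial>lborel) + ennreal ((1/4) ^ n)))
         \<longlonglongrightarrow> ennreal C * ((\<integral>\<^sup>+x. ennreal (w x) \<partial>lborel) + 0)"
        by (intro ennreal_tendsto_cmult tendsto_add tendsto_const) auto
    qed simp
    finally show ?thesis by simp
  qed
qed

theorem lemma3p1:
  shows "\<exists>c::real. 0 < c \<and>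
    (\<forall>A :: real \<Rightarrow> real.
      (\<forall>r. 1 < r \<and> r < 2 \<longrightarrow> 0 < A r) \<longrightarrow>
      (\<forall>r w f. 1 < r \<and> r < 2 \<and> weight w \<and> f \<in> L1_space (maximal r w) \<longrightarrow>
         weak_L1_norm (\<lambda>x. ennreal (w x)) (hilbert f)
           \<le> ennreal (A r) * L1_norm (maximal r w) f) \<longrightarrow>
      (\<forall>r w. 1 < r \<and> r < 2 \<and> weight w \<and> (\<forall>x. x \<notin> {0..1} \<longrightarrow> w x = 0) \<longrightarrow>
         (let \<alpha> = r / (2 - r) in
           (\<integral>\<^sup>+x\<in>{0..1}. (ennreal \<bar>hilbert w x\<bar> / ennpowr (maximal \<alpha> w x) (\<alpha> / r))\<^sup>2
                * ennreal (w x powr \<alpha>) \<partial>lebesgue)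
             \<le> ennreal (c * (A r)\<^sup>2) * (\<integral>\<^sup>+x\<in>{0..1}. ennreal (w x) \<partial>lebesgue))))"
proof -
  \<comment> \<open>The constant must not depend on \<open>A\<close>, so some number admissible for the exponent \<open>4/3\<close> is chosen before
    \<open>A\<close> is given. If no family is admissible, the choice is arbitrary and the claim vacuous.\<close>
  define c where "c = max 96 (13824 * (SOME a. 0 < a \<and> weak_type_bound (4/3) a)\<^sup>2)"
  show ?thesis
  proof (intro exI[of _ c] conjI allI impI)
    show "0 < c" by (simp add: c_def)
    fix A :: "real \<Rightarrow> real" and r :: real and w :: "real \<Rightarrow> real"
    assume Apos: "\<forall>r. 1 < r \<and> r < 2 \<longrightarrow> 0 < A r"
      and bound: "\<forall>r w f. 1 < r \<and> r < 2 \<and> weight w \<and> f \<in> L1_space (maximal r w) \<longrightarrow>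
         weak_L1_norm (\<lambda>x. ennreal (w x)) (hilbert f) \<le> ennreal (A r) * L1_norm (maximal r w) f"
      and rw: "1 < r \<and> r < 2 \<and> weight w \<and> (\<forall>x. x \<notin> {0..1} \<longrightarrow> w x = 0)"
    have r: "1 < r" "r < 2" and w: "weight w" and supp: "\<And>x. x \<notin> {0..1} \<Longrightarrow> w x = 0" using rw by auto
    have hyp: "weak_type_bound s (A s)" if "1 < s" "s < 2" for s
      unfolding weak_type_bound_def using bound that by blast
    define a where "a = (SOME a. 0 < a \<and> weak_type_bound (4/3) a)"
    have "0 < A (4/3) \<and> weak_type_bound (4/3) (A (4/3))" using Apos hyp[of "4/3"] by simp
    then have a: "0 < a \<and> weak_type_bound (4/3) a" unfolding a_def by (rule someI)
    have Ar: "0 < A r" using Apos r by simp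
    define \<alpha> where "\<alpha> = r / (2 - r)"
    have \<alpha>: "0 < \<alpha>" using r by (simp add: \<alpha>_def)
    have w0: "0 \<le> w x" for x using w by (simp add: weight_def)
    have "ennpowr (maximal \<alpha> w x) (\<alpha> / r) = ennpowr (interval_maximal (\<lambda>y. ennreal (w y powr \<alpha>)) x) (1 / r)" for x
      unfolding maximal_eq[OF \<alpha>] ennpowr_powr using \<alpha> w0 by simp
    then have density: "(ennreal \<bar>hilbert w x\<bar> / ennpowr (maximal \<alpha> w x) (\<alpha> / r))\<^sup>2 * ennreal (w x powr \<alpha>)
        = hilbert_density r w x" for x
      unfolding hilbert_density_def \<alpha>_def by simp
    have "(\<integral>\<^sup>+x\<in>{0..1}. hilbert_density r w x \<partial>lebesgue) = (\<integral>\<^sup>+x. hilbert_density r w x \<partial>lborel)"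
      unfolding nn_integral_completion
      by (intro nn_integral_cong) (auto simp: indicator_def hilbert_density_eq_0 supp)
    also have "\<dots> \<le> ennreal (c * (A r)\<^sup>2) * (\<integral>\<^sup>+x. ennreal (w x) \<partial>lborel)"
    proof (rule hilbert_density_estimate[OF hyp[OF r] _ r _ _ w supp])
      fix v :: "real \<Rightarrow> real" assume "test_function v" "\<And>x. 0 \<le> v x"
      then show "(\<integral>\<^sup>+x. hilbert_density r v x \<partial>lborel) \<le> ennreal (c * (A r)\<^sup>2) * (\<integral>\<^sup>+x. ennreal (v x) \<partial>lborel)"
        unfolding c_def a_def[symmetric] using test_function_estimate[OF hyp[OF r] _ Ar _ r] a by blast
    qed (use Ar in \<open>simp_all add: c_def\<close>)
    also have "(\<integral>\<^sup>+x. ennreal (w x) \<partial>lborel) = (\<integral>\<^sup>+x\<in>{0..1}. ennreal (w x) \<partial>lebesgue)"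
      unfolding nn_integral_completion by (intro nn_integral_cong) (auto simp: indicator_def supp)
    finally show "let \<alpha> = r / (2 - r) in
           (\<integral>\<^sup>+x\<in>{0..1}. (ennreal \<bar>hilbert w x\<bar> / ennpowr (maximal \<alpha> w x) (\<alpha> / r))\<^sup>2
                * ennreal (w x powr \<alpha>) \<partial>lebesgue)
             \<le> ennreal (c * (A r)\<^sup>2) * (\<integral>\<^sup>+x\<in>{0..1}. ennreal (w x) \<partial>lebesgue)"
      unfolding Let_def \<alpha>_def[symmetric] density .
  qed
qed

end
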